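(* Let $d\ge1$ and let $G=(V,E)$ be a graph. For every generic $d$-dimensional realization $(G,p)$ of $G$ we have $c(G,p)\ge 2^{c_d(G)}$. Furthermore, $G$ is $d$-joined if and only if $c(G,p)=2^{c_d(G)}$ holds for every generic $d$-dimensional realization $(G,p)$.
   Context: A $d$-dimensional realization of $G$ is a pair $(G,p)$ with $p:V\to\mathbb{R}^d$; it is generic if the $d|V|$ coordinates of $p$ are algebraically independent over $\mathbb{Q}$. $(G,p),(G,q)$ are equivalent if $\|p(x)-p(y)\|=\|q(x)-q(y)\|$ for all edges $xy$, congruent if this holds for all pairs of vertices. $c(G,p)$ denotes the maximum number (possibly infinite) of pairwise noncongruent $d$-dimensional realizations that are equivalent to $(G,p)$. For $S\subseteq V$ let $b_G(S)$ be the number of connected components of $G-S$, and $c_d(G)=\sum_{S\subseteq V,\,|S|=d}(b_G(S)-1)$. $G$ is rigid in $\mathbb{R}^d$ if for a generic realization $(G,p)$ there is $\varepsilon>0$ such that every equivalent $(G,q)$ with $\|p(x)-q(x)\|<\varepsilon$ for all $x$ is congruent to $(G,p)$. A pair $\{x,y\}$ is globally linked in $G$ in $\mathbb{R}^d$ if for every generic realization $(G,p)$ and every equivalent realization $(G,q)$ in $\mathbb{R}^d$, $\|p(x)-p(y)\|=\|q(x)-q(y)\|$. $\kappa(G,x,y)$ is the maximum number of internally vertex-disjoint $x$–$y$ paths. $G$ is $d$-joined if $|V|\ge d+1$, $G$ is rigid in $\mathbb{R}^d$, and for all $x,y\in V$: $\{x,y\}$ is globally linked iff $xy\in E$ or $\kappa(G,x,y)\ge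 d+1$.
   Formalization: The equivalence is stated only for graphs other than complete graphs on fewer than d vertices: those are not d-joined as |V| < d+1, yet c(G,p) = 1 = 2^{c_d(G)} (e.g. K_1 with d = 2); the lower bound holds for all graphs. *)

theory Defs
  imports "HOL-Analysis.Analysis" "HOL-Library.Poly_Mapping"
begin

section \<open>Finite simple graphs\<close>

definition simple_graph :: "'v set \<Rightarrow> 'v set set \<Rightarrow> bool" where
  "simple_graph V E \<longleftrightarrow> finite V \<and> E \<subseteq> {{x, y} | x y. x \<in> V \<and> y \<in> V \<and> x \<noteq> y}"

definition complete_graph :: "'v set \<Rightarrow> 'v set set \<Rightarrow> bool" where
  "complete_graph V E \<longleftrightarrow> (\<forall>x\<in>V. \<forall>y\<in>V. x \<noteq> y \<longrightarrow> {x, y} \<in> E)"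

definition adj_on :: "'v set set \<Rightarrow> 'v set \<Rightarrow> ('v \<times> 'v) set" where
  "adj_on E W = {(x, y). x \<in> W \<and> y \<in> W \<and> {x, y} \<in> E}"

definition num_components_minus :: "'v set \<Rightarrow> 'v set set \<Rightarrow> 'v set \<Rightarrow> nat" where
  "num_components_minus V E S = card ((V - S) // (adj_on E (V - S))\<^sup>*)"

text \<open>
  The value is an integer, and the subtraction is not truncated: for \<open>card V = d\<close> the only
  summand is \<open>S = V\<close>, which leaves no component at all and contributes \<open>-1\<close>.
  For \<open>card V > d\<close> every summand is nonnegative.
\<close>

definition separator_count :: "nat \<Rightarrow> 'v set \<Rightarrow> 'v set set \<Rightarrow> int" where
  "separator_count d V E =
     (\<Sum>S | S \<subseteq> V \<and> card S = d. int (num_components_minus V E S) - 1)"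

definition is_path :: "'v set \<Rightarrow> 'v set set \<Rightarrow> 'v \<Rightarrow> 'v \<Rightarrow> 'v list \<Rightarrow> bool" where
  "is_path V E x y xs \<longleftrightarrow>
     xs \<noteq> [] \<and> hd xs = x \<and> last xs = y \<and> distinct xs \<and> set xs \<subseteq> V \<and>
     successively (\<lambda>u v. {u, v} \<in> E) xs"

text \<open>For finite \<open>V\<close> there are only finitely many paths, so the maximum is well defined.\<close>

definition local_connectivity :: "'v set \<Rightarrow> 'v set set \<Rightarrow> 'v \<Rightarrow> 'v \<Rightarrow> nat" where
  "local_connectivity V E x y =
     Max {card P | P. (\<forall>xs\<in>P. is_path V E x y xs) \<and>
                      pairwise (\<lambda>xs ys. set xs \<inter> set ys \<subseteq> {x, y}) P}"


section \<open>Algebraic independence over the rationals\<close>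

text \<open>
  Polynomials with rational coefficients in indeterminates of type \<open>'i\<close> are finitely supported
  maps from monomials \<open>'i \<Rightarrow>\<^sub>0 nat\<close> to coefficients.
\<close>

definition eval_poly :: "('i \<Rightarrow> real) \<Rightarrow> (('i \<Rightarrow>\<^sub>0 nat) \<Rightarrow>\<^sub>0 rat) \<Rightarrow> real" where
  "eval_poly a P =
     (\<Sum>m\<in>Poly_Mapping.keys P. of_rat (Poly_Mapping.lookup P m) *
        (\<Prod>i\<in>Poly_Mapping.keys m. a i ^ Poly_Mapping.lookup m i))"

definition algebraically_independent_over_rat :: "'i set \<Rightarrow> ('i \<Rightarrow> real) \<Rightarrow> bool" where
  "algebraically_independent_over_rat I a \<longleftrightarrow>
     (\<forall>P. (\<forall>m\<in>Poly_Mapping.keys P. Poly_Mapping.keys m \<subseteq> I) \<and> eval_poly a P = 0 \<longrightarrow> P = 0)"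


section \<open>Realizations\<close>

text \<open>
  A realization in dimension \<open>CARD('d)\<close> is a function \<open>'v \<Rightarrow> real ^ 'd\<close>, of which only the values
  on \<open>V\<close> matter; all notions below ignore its values elsewhere.
\<close>

definition generic_realization :: "'v set \<Rightarrow> ('v \<Rightarrow> real ^ 'd) \<Rightarrow> bool" where
  "generic_realization V p \<longleftrightarrow>
     algebraically_independent_over_rat (V \<times> (UNIV :: 'd set)) (\<lambda>(v, i). p v $ i)"

definition equivalent_realizations ::
    "'v set set \<Rightarrow> ('v \<Rightarrow> real ^ 'd) \<Rightarrow> ('v \<Rightarrow> real ^ 'd) \<Rightarrow> bool" where
  "equivalent_realizations E p q \<longleftrightarrow>
     (\<forall>x y. {x, y} \<in> E \<longrightarrow> norm (p x - p y) = norm (q x - q y))"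

definition congruent_realizations ::
    "'v set \<Rightarrow> ('v \<Rightarrow> real ^ 'd) \<Rightarrow> ('v \<Rightarrow> real ^ 'd) \<Rightarrow> bool" where
  "congruent_realizations V p q \<longleftrightarrow>
     (\<forall>x\<in>V. \<forall>y\<in>V. norm (p x - p y) = norm (q x - q y))"

definition num_realizations :: "'v set \<Rightarrow> 'v set set \<Rightarrow> ('v \<Rightarrow> real ^ 'd) \<Rightarrow> enat" where
  "num_realizations V E p =
     Sup {enat (card Q) | Q. finite Q \<and> (\<forall>q\<in>Q. equivalent_realizations E p q) \<and>
                             pairwise (\<lambda>q r. \<not> congruent_realizations V q r) Q}"

text \<open>
  Local rigidity takes the same value at all generic realizations, and generic realizations
  exist; ``a generic realization'' is rendered as ``every generic realization''.
\<close>

definition rigid :: "'d::finite itself \<Rightarrow> 'v set \<Rightarrow> 'v set set \<Rightarrow> bool" where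
  "rigid (_ :: 'd itself) V E \<longleftrightarrow>
     (\<forall>p :: 'v \<Rightarrow> real ^ 'd. generic_realization V p \<longrightarrow>
        (\<exists>\<epsilon>>0. \<forall>q. equivalent_realizations E p q \<and> (\<forall>x\<in>V. norm (p x - q x) < \<epsilon>) \<longrightarrow>
                  congruent_realizations V p q))"

definition globally_linked ::
    "'d::finite itself \<Rightarrow> 'v set \<Rightarrow> 'v set set \<Rightarrow> 'v \<Rightarrow> 'v \<Rightarrow> bool" where
  "globally_linked (_ :: 'd itself) V E x y \<longleftrightarrow>
     (\<forall>p q :: 'v \<Rightarrow> real ^ 'd. generic_realization V p \<and> equivalent_realizations E p q \<longrightarrow>
        norm (p x - p y) = norm (q x - q y))"

text \<open>A pair consists of two distinct vertices.\<close>

definition joined :: "'d::finite itself \<Rightarrow> 'v set \<Rightarrow> 'v set set \<Rightarrow> bool" where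
  "joined (_ :: 'd itself) V E \<longleftrightarrow>
     card V \<ge> CARD('d) + 1 \<and> rigid TYPE('d) V E \<and>
     (\<forall>x\<in>V. \<forall>y\<in>V. x \<noteq> y \<longrightarrow>
        (globally_linked TYPE('d) V E x y \<longleftrightarrow>
           {x, y} \<in> E \<or> local_connectivity V E x y \<ge> CARD('d) + 1))"

text \<open>
  A complete graph on fewer than \<open>d\<close> vertices is not \<open>d\<close>-joined, although it has exactly
  one realization up to congruence and \<open>separator_count d V E = 0\<close>. These graphs have to be
  excluded from the characterization of \<open>d\<close>-joined graphs by the number of realizations.
\<close>

definition small_complete_graph :: "nat \<Rightarrow> 'v set \<Rightarrow> 'v set set \<Rightarrow> bool" where
  "small_complete_graph d V E \<longleftrightarrow> card V < d \<and> complete_graph V E"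

end

theory Submission imports Defs begin

text \<open>
  Let \<open>S\<close> be a set of \<open>d\<close> vertices. Reflecting a component of \<open>G - S\<close> in the hyperplane spanned by the
  points of \<open>S\<close> preserves the edge lengths, and it preserves genericity since it is a rational
  involution.

  If fewer than \<open>d\<close> vertices separate the graph, then one side can be rotated about them. If two
  separators of size \<open>d\<close> cross, then the composition of a reflection in one and a reflection in the
  other has infinite order modulo congruence: by genericity it suffices to exhibit one configuration
  with an infinite orbit, and a parallelogram linkage which is folded alternately along its two
  diagonals is such a configuration. So there are infinitely many noncongruent realizations at every
  generic \<open>p\<close>. As partial reflections preserve the Lebesgue measure, some generic \<open>p\<close> is moreover
  recurrent under this composition, hence the graph is not rigid.

  In all other cases, a pair of vertices with the least positive number of separators of size \<open>d\<close> has a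
  single one, say \<open>S\<close>. Joining the pairs of vertices in the same two components of \<open>G - S\<close> which have
  no other separator lowers \<open>c_d\<close> by one. The realizations of the new graph equivalent to \<open>p\<close> or to its
  partial reflection in \<open>S\<close> are realizations of \<open>G\<close> equivalent to \<open>p\<close>, and there are no others if every
  nonadjacent pair of vertices has a separator of size \<open>d\<close>. By Menger's theorem, a \<open>d\<close>-joined graph has
  this property after adding globally linked pairs.
\<close>


section \<open>Rational functions and generic realizations\<close>

text \<open>Infinitely many noncongruent realizations at a generic \<open>p\<close> do not by
  themselves refute rigidity, which is a local notion: that a rigid graph has only finitely many is
  a theorem of real algebraic geometry. Recurrence replaces it. Rigidity is required at every
  generic realization, so one generic realization with noncongruent equivalent ones arbitrarily
  close by is enough, and measure theory supplies it on a bounded invariant set of configurations.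

  Folding is only a rational map. Transferring infinite order from one configuration to all generic
  ones therefore requires that no mirror degenerates along the whole orbit of that configuration;
  hence the search for a family of linkages that is invariant under folding.

  The induction adds edges because pairs with the single separator \<open>S\<close> can be joined
  without changing the components left by any other set of \<open>d\<close> vertices. Joining all
  such pairs between the two components, rather than one pair, keeps the property that nonadjacent
  pairs have a separator, on which the upper bound rests.\<close>

abbreviation poly_over :: "'i set \<Rightarrow> (('i \<Rightarrow>\<^sub>0 nat) \<Rightarrow>\<^sub>0 rat) \<Rightarrow> bool" where
  "poly_over I P \<equiv> \<forall>m\<in>Poly_Mapping.keys P. Poly_Mapping.keys m \<subseteq> I"

definition eval_monom :: "('i \<Rightarrow> real) \<Rightarrow> ('i \<Rightarrow>\<^sub>0 nat) \<Rightarrow> real" where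
  "eval_monom a m = (\<Prod>i\<in>Poly_Mapping.keys m. a i ^ Poly_Mapping.lookup m i)"

lemma eval_monom_superset:
  assumes "finite J" "Poly_Mapping.keys m \<subseteq> J"
  shows "eval_monom a m = (\<Prod>i\<in>J. a i ^ Poly_Mapping.lookup m i)"
  unfolding eval_monom_def
  by (rule prod.mono_neutral_left) (use assms in \<open>auto simp: in_keys_iff\<close>)

lemma eval_monom_add: "eval_monom a (m + n) = eval_monom a m * eval_monom a n"
proof -
  let ?J = "Poly_Mapping.keys m \<union> Poly_Mapping.keys n"
  have "eval_monom a k = (\<Prod>i\<in>?J. a i ^ Poly_Mapping.lookup k i)" if "k \<in> {m, n, m + n}" for k
    by (rule eval_monom_superset) (use that keys_add[of m n] in auto)
  then show ?thesis
    by (simp add: lookup_add power_add prod.distrib)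
qed

lemma eval_poly_superset:
  assumes "finite K" "Poly_Mapping.keys P \<subseteq> K"
  shows "eval_poly a P = (\<Sum>m\<in>K. of_rat (Poly_Mapping.lookup P m) * eval_monom a m)"
  unfolding eval_poly_def eval_monom_def
  by (rule sum.mono_neutral_left) (use assms in \<open>auto simp: in_keys_iff\<close>)

lemma eval_poly_0 [simp]: "eval_poly a 0 = 0"
  by (simp add: eval_poly_def)

lemma eval_poly_add: "eval_poly a (P + Q) = eval_poly a P + eval_poly a Q"
proof -
  let ?K = "Poly_Mapping.keys P \<union> Poly_Mapping.keys Q"
  have "eval_poly a R = (\<Sum>m\<in>?K. of_rat (Poly_Mapping.lookup R m) * eval_monom a m)"
    if "R \<in> {P, Q, P + Q}" for R
    by (rule eval_poly_superset) (use that keys_add[of P Q] in auto)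
  then show ?thesis
    by (simp add: lookup_add of_rat_add distrib_right sum.distrib)
qed

lemma eval_poly_sum: "eval_poly a (\<Sum>x\<in>A. P x) = (\<Sum>x\<in>A. eval_poly a (P x))"
  by (induction A rule: infinite_finite_induct) (auto simp: eval_poly_add)

lemma eval_poly_single: "eval_poly a (Poly_Mapping.single m c) = of_rat c * eval_monom a m"
  by (cases "c = 0") (auto simp: eval_poly_def eval_monom_def)

lemma poly_mapping_sum_single:
  "P = (\<Sum>m\<in>Poly_Mapping.keys P. Poly_Mapping.single m (Poly_Mapping.lookup P m))"
proof (rule poly_mapping_eqI)
  fix k
  have "(\<Sum>m\<in>Poly_Mapping.keys P. Poly_Mapping.lookup (Poly_Mapping.single m (Poly_Mapping.lookup P m)) k)
      = (\<Sum>m\<in>Poly_Mapping.keys P. if m = k then Poly_Mapping.lookup P k else 0)"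
    by (rule sum.cong) (auto simp: lookup_single)
  also have "\<dots> = Poly_Mapping.lookup P k"
    by (auto simp: in_keys_iff)
  finally show "Poly_Mapping.lookup P k
      = Poly_Mapping.lookup (\<Sum>m\<in>Poly_Mapping.keys P. Poly_Mapping.single m (Poly_Mapping.lookup P m)) k"
    by (simp add: lookup_sum)
qed

lemma eval_poly_mult: "eval_poly a (P * Q) = eval_poly a P * eval_poly a Q"
proof -
  let ?s = "\<lambda>P m. Poly_Mapping.single m (Poly_Mapping.lookup P m)"
  let ?P = "\<Sum>m\<in>Poly_Mapping.keys P. ?s P m" and ?Q = "\<Sum>n\<in>Poly_Mapping.keys Q. ?s Q n"
  have "eval_poly a (?P * ?Q) = eval_poly a ?P * eval_poly a ?Q"
    by (simp add: sum_product mult_single eval_poly_sum eval_poly_single eval_monom_add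
        of_rat_mult mult_ac)
  then show ?thesis
    by (simp flip: poly_mapping_sum_single)
qed

lemma poly_over_add: "poly_over I P \<Longrightarrow> poly_over I Q \<Longrightarrow> poly_over I (P + Q)"
  using keys_add[of P Q] by blast

lemma poly_over_mult:
  fixes P Q :: "('i \<Rightarrow>\<^sub>0 nat) \<Rightarrow>\<^sub>0 rat"
  assumes "poly_over I P" "poly_over I Q"
  shows "poly_over I (P * Q)"
proof
  fix m assume "m \<in> Poly_Mapping.keys (P * Q)"
  then obtain k l where "k \<in> Poly_Mapping.keys P" "l \<in> Poly_Mapping.keys Q" "m = k + l"
    using keys_mult[of P Q] by blast
  then show "Poly_Mapping.keys m \<subseteq> I"
    using assms keys_add[of k l] by blast
qed

abbreviation coords :: "('v \<Rightarrow> real ^ 'd) \<Rightarrow> 'v \<times> 'd \<Rightarrow> real" where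
  "coords p \<equiv> (\<lambda>(v, i). p v $ i)"

definition config_polynomial :: "'v set \<Rightarrow> (('v \<Rightarrow> real ^ 'd) \<Rightarrow> real) \<Rightarrow> bool" where
  "config_polynomial V f \<longleftrightarrow>
     (\<exists>P. poly_over (V \<times> UNIV) P \<and> (\<forall>p. f p = eval_poly (coords p) P))"

lemma config_polynomial_const: "config_polynomial V (\<lambda>p. of_rat c)"
  unfolding config_polynomial_def
  by (rule exI[of _ "Poly_Mapping.single 0 c"]) (auto simp: eval_poly_single eval_monom_def)

lemma config_polynomial_coord:
  assumes "v \<in> V"
  shows "config_polynomial V (\<lambda>p. p v $ i)"
  unfolding config_polynomial_def
  by (rule exI[of _ "Poly_Mapping.single (Poly_Mapping.single (v, i) 1) 1"])
    (use assms in \<open>auto simp: eval_poly_single eval_monom_def\<close>)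

lemma config_polynomial_add:
  assumes "config_polynomial V f" "config_polynomial V g"
  shows "config_polynomial V (\<lambda>p. f p + g p)"
proof -
  obtain P Q where "poly_over (V \<times> UNIV) P" "\<And>p. f p = eval_poly (coords p) P"
    "poly_over (V \<times> UNIV) Q" "\<And>p. g p = eval_poly (coords p) Q"
    using assms unfolding config_polynomial_def by blast
  then show ?thesis
    unfolding config_polynomial_def
    by (intro exI[of _ "P + Q"] conjI poly_over_add) (simp_all add: eval_poly_add)
qed

lemma config_polynomial_mult:
  assumes "config_polynomial V f" "config_polynomial V g"
  shows "config_polynomial V (\<lambda>p. f p * g p)"
proof -
  obtain P Q where "poly_over (V \<times> UNIV) P" "\<And>p. f p = eval_poly (coords p) P"
    "poly_over (V \<times> UNIV) Q" "\<And>p. g p = eval_poly (coords p) Q"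
    using assms unfolding config_polynomial_def by blast
  then show ?thesis
    unfolding config_polynomial_def
    by (intro exI[of _ "P * Q"] conjI poly_over_mult) (simp_all add: eval_poly_mult)
qed

text \<open>One configuration \<open>t\<close>, generic or not, at which \<open>f\<close> does not
  vanish shows that the polynomial behind \<open>f\<close> is nonzero; algebraic independence does
  the rest. All nondegeneracy statements about generic realizations are transferred from special
  configurations in this way.\<close>

lemma generic_polynomial_nonzero:
  assumes "generic_realization V p" "config_polynomial V f" "f t \<noteq> 0"
  shows "f p \<noteq> 0"
proof -
  obtain P where P: "poly_over (V \<times> UNIV) P" "\<And>p. f p = eval_poly (coords p) P"
    using assms(2) unfolding config_polynomial_def by blast
  then have "P \<noteq> 0"
    using assms(3) by auto
  then show ?thesis
    using assms(1) P unfolding generic_realization_def algebraically_independent_over_rat_def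
    by metis
qed

text \<open>
  The functions which are regular at \<open>t\<close> form a local ring; a function in this ring which does not
  vanish at \<open>t\<close> does not vanish at any generic realization.
\<close>

definition regular_at :: "'v set \<Rightarrow> ('v \<Rightarrow> real ^ 'd) \<Rightarrow> (('v \<Rightarrow> real ^ 'd) \<Rightarrow> real) \<Rightarrow> bool" where
  "regular_at V t f \<longleftrightarrow>
     (\<exists>N D. config_polynomial V N \<and> config_polynomial V D \<and> D t \<noteq> 0 \<and>
            (\<forall>p. D p \<noteq> 0 \<longrightarrow> f p = N p / D p))"

lemma generic_regular_nonzero:
  assumes "generic_realization V p" "regular_at V t f" "f t \<noteq> 0"
  shows "f p \<noteq> 0"
proof -
  obtain N D where ND: "config_polynomial V N" "config_polynomial V D" "D t \<noteq> 0"
    "\<And>p. D p \<noteq> 0 \<Longrightarrow> f p = N p / D p"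
    using assms(2) unfolding regular_at_def by blast
  have "N t \<noteq> 0"
    using ND(4)[OF ND(3)] assms(3) by auto
  then have "N p \<noteq> 0" "D p \<noteq> 0"
    using generic_polynomial_nonzero[OF assms(1)] ND(1-3) by blast+
  then show ?thesis
    by (simp add: ND(4))
qed

lemma regular_at_polynomial:
  assumes "config_polynomial V f"
  shows "regular_at V t f"
  unfolding regular_at_def
  by (rule exI[of _ f], rule exI[of _ "\<lambda>_. 1"])
    (use assms config_polynomial_const[of V 1] in simp)

lemma regular_at_const: "regular_at V t (\<lambda>p. of_rat c)"
  by (intro regular_at_polynomial config_polynomial_const)

lemma regular_at_of_int: "regular_at V t (\<lambda>p. of_int c)"
  using regular_at_const[of V t "of_int c"] by simp

lemma regular_at_numeral: "regular_at V t (\<lambda>p. numeral c)"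
  using regular_at_of_int[of V t "numeral c"] by simp

lemma regular_at_0: "regular_at V t (\<lambda>p. 0)" and regular_at_1: "regular_at V t (\<lambda>p. 1)"
  using regular_at_of_int[of V t 0] regular_at_of_int[of V t 1] by simp_all

lemma regular_at_coord: "v \<in> V \<Longrightarrow> regular_at V t (\<lambda>p. p v $ i)"
  by (intro regular_at_polynomial config_polynomial_coord)

lemma regular_at_mult:
  assumes "regular_at V t f" "regular_at V t g"
  shows "regular_at V t (\<lambda>p. f p * g p)"
proof -
  obtain N D N' D' where "config_polynomial V N" "config_polynomial V D" "D t \<noteq> 0"
    "\<And>p. D p \<noteq> 0 \<Longrightarrow> f p = N p / D p" "config_polynomial V N'" "config_polynomial V D'" "D' t \<noteq> 0"
    "\<And>p. D' p \<noteq> 0 \<Longrightarrow> g p = N' p / D' p"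
    using assms unfolding regular_at_def by blast
  then show ?thesis
    unfolding regular_at_def
    by (intro exI[of _ "\<lambda>p. N p * N' p"] exI[of _ "\<lambda>p. D p * D' p"])
      (auto intro!: config_polynomial_mult)
qed

lemma regular_at_add:
  assumes "regular_at V t f" "regular_at V t g"
  shows "regular_at V t (\<lambda>p. f p + g p)"
proof -
  obtain N D N' D' where "config_polynomial V N" "config_polynomial V D" "D t \<noteq> 0"
    "\<And>p. D p \<noteq> 0 \<Longrightarrow> f p = N p / D p" "config_polynomial V N'" "config_polynomial V D'" "D' t \<noteq> 0"
    "\<And>p. D' p \<noteq> 0 \<Longrightarrow> g p = N' p / D' p"
    using assms unfolding regular_at_def by blast
  then show ?thesis
    unfolding regular_at_def
    by (intro exI[of _ "\<lambda>p. N p * D' p + N' p * D p"] exI[of _ "\<lambda>p. D p * D' p"])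
      (auto intro!: config_polynomial_mult config_polynomial_add simp: field_simps)
qed

lemma regular_at_diff:
  assumes "regular_at V t f" "regular_at V t g"
  shows "regular_at V t (\<lambda>p. f p - g p)"
  using regular_at_add[OF assms(1) regular_at_mult[OF regular_at_of_int[of V t "-1"] assms(2)]]
  by simp

lemma regular_at_divide:
  assumes "regular_at V t f" "regular_at V t g" "g t \<noteq> 0"
  shows "regular_at V t (\<lambda>p. f p / g p)"
proof -
  obtain N D N' D' where *: "config_polynomial V N" "config_polynomial V D" "D t \<noteq> 0"
    "\<And>p. D p \<noteq> 0 \<Longrightarrow> f p = N p / D p" "config_polynomial V N'" "config_polynomial V D'" "D' t \<noteq> 0"
    "\<And>p. D' p \<noteq> 0 \<Longrightarrow> g p = N' p / D' p"
    using assms unfolding regular_at_def by blast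
  then have "N' t \<noteq> 0"
    using assms(3) by auto
  \<comment> \<open>The extra factor \<open>D'\<close> in numerator and denominator ensures that the
    new denominator is nonzero only where the representation of \<open>g\<close> is valid.\<close>
  with * show ?thesis
    unfolding regular_at_def
    by (intro exI[of _ "\<lambda>p. (N p * D' p) * D' p"] exI[of _ "\<lambda>p. (D p * N' p) * D' p"])
      (auto intro!: config_polynomial_mult)
qed

lemma regular_at_sum:
  "(\<And>x. x \<in> A \<Longrightarrow> regular_at V t (f x)) \<Longrightarrow> regular_at V t (\<lambda>p. \<Sum>x\<in>A. f x p)"
  by (induction A rule: infinite_finite_induct) (auto simp: regular_at_0 intro: regular_at_add)

lemma regular_at_prod:
  "(\<And>x. x \<in> A \<Longrightarrow> regular_at V t (f x)) \<Longrightarrow> regular_at V t (\<lambda>p. \<Prod>x\<in>A. f x p)"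
  by (induction A rule: infinite_finite_induct) (auto simp: regular_at_1 intro: regular_at_mult)

lemma regular_at_power: "regular_at V t f \<Longrightarrow> regular_at V t (\<lambda>p. f p ^ n)"
  by (induction n) (auto simp: regular_at_1 intro: regular_at_mult)

lemma regular_at_det:
  fixes M :: "('v \<Rightarrow> real ^ 'd) \<Rightarrow> real ^ 'n::finite ^ 'n"
  assumes "\<And>i j. regular_at V t (\<lambda>p. M p $ i $ j)"
  shows "regular_at V t (\<lambda>p. det (M p))"
  unfolding det_def
  by (intro regular_at_sum regular_at_mult regular_at_prod assms regular_at_of_int)

section \<open>Vector-valued rational maps of a configuration\<close>

definition regular_vec_at ::
    "'v set \<Rightarrow> ('v \<Rightarrow> real ^ 'd) \<Rightarrow> (('v \<Rightarrow> real ^ 'd) \<Rightarrow> real ^ 'n) \<Rightarrow> bool" where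
  "regular_vec_at V t F \<longleftrightarrow> (\<forall>i. regular_at V t (\<lambda>p. F p $ i))"

lemma regular_vec_at_nth: "regular_vec_at V t F \<Longrightarrow> regular_at V t (\<lambda>p. F p $ i)"
  by (simp add: regular_vec_at_def)

lemma regular_vec_at_vertex: "v \<in> V \<Longrightarrow> regular_vec_at V t (\<lambda>p. p v)"
  by (simp add: regular_vec_at_def regular_at_coord)

lemma regular_vec_at_diff:
  "regular_vec_at V t F \<Longrightarrow> regular_vec_at V t G \<Longrightarrow> regular_vec_at V t (\<lambda>p. F p - G p)"
  by (simp add: regular_vec_at_def regular_at_diff)

lemma regular_vec_at_scaleR:
  "regular_at V t f \<Longrightarrow> regular_vec_at V t G \<Longrightarrow> regular_vec_at V t (\<lambda>p. f p *\<^sub>R G p)"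
  by (simp add: regular_vec_at_def regular_at_mult)

lemma regular_vec_at_axis: "regular_vec_at V t (\<lambda>p. axis k 1)"
  by (auto simp: regular_vec_at_def axis_def regular_at_0 regular_at_1)

lemma regular_at_inner:
  fixes F G :: "('v \<Rightarrow> real ^ 'd) \<Rightarrow> real ^ 'n::finite"
  assumes "regular_vec_at V t F" "regular_vec_at V t G"
  shows "regular_at V t (\<lambda>p. F p \<bullet> G p)"
  using assms unfolding inner_vec_def regular_vec_at_def
  by (auto intro!: regular_at_sum regular_at_mult)

lemma regular_at_eval_poly:
  assumes "poly_over (V \<times> UNIV) P" "\<And>v. v \<in> V \<Longrightarrow> regular_vec_at V t (\<lambda>p. F p v)"
  shows "regular_at V t (\<lambda>p. eval_poly (coords (F p)) P)"
  unfolding eval_poly_def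
proof (intro regular_at_sum regular_at_mult regular_at_const regular_at_prod regular_at_power)
  fix m x assume "m \<in> Poly_Mapping.keys P" "x \<in> Poly_Mapping.keys m"
  then obtain v i where "x = (v, i)" "v \<in> V"
    using assms(1) by blast
  then show "regular_at V t (\<lambda>p. coords (F p) x)"
    using assms(2) by (simp add: regular_vec_at_nth)
qed


section \<open>Partial reflections\<close>

text \<open>The reflection in the hyperplane through \<open>s\<close> with normal \<open>n\<close>,
  where \<open>n\<close> is not assumed to be a unit vector. For \<open>n = 0\<close>, division by
  zero makes it the identity.\<close>

definition reflect :: "'a::real_inner \<Rightarrow> 'a \<Rightarrow> 'a \<Rightarrow> 'a" where
  "reflect n s x = x - (2 * (n \<bullet> (x - s)) / (n \<bullet> n)) *\<^sub>R n"

lemma reflect_fixed: "n \<bullet> (x - s) = 0 \<Longrightarrow> reflect n s x = x"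
  by (simp add: reflect_def)

lemma inner_reflect: "n \<bullet> (reflect n s x - s) = - (n \<bullet> (x - s))"
  by (cases "n = 0") (simp_all add: reflect_def inner_diff_right)

lemma reflect_reflect [simp]: "reflect n s (reflect n s x) = x"
proof -
  have "reflect n s (reflect n s x) = reflect n s x + (2 * (n \<bullet> (x - s)) / (n \<bullet> n)) *\<^sub>R n"
    by (subst reflect_def, subst inner_reflect) simp
  then show ?thesis
    by (simp add: reflect_def)
qed

text \<open>For nonzero \<open>n\<close> the correction term is four times the product of the signed
  distances of \<open>x\<close> and \<open>y\<close> from the mirror. So reflecting just one of two
  points changes their distance exactly if neither lies on the mirror.\<close>

lemma norm_reflect_diff_square:
  "(norm (reflect n s x - y))\<^sup>2 =
     (norm (x - y))\<^sup>2 + 4 * (n \<bullet> (x - s)) * (n \<bullet> (y - s)) / (n \<bullet> n)"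
proof (cases "n = 0")
  case True
  then show ?thesis by (simp add: reflect_def)
next
  case False
  define a where "a = n \<bullet> (x - s)"
  define b where "b = n \<bullet> (y - s)"
  have ab: "n \<bullet> (x - y) = a - b"
    by (simp add: a_def b_def inner_diff_right)
  have *: "(norm (z - k *\<^sub>R n))\<^sup>2 = (norm z)\<^sup>2 - 2 * k * (n \<bullet> z) + k\<^sup>2 * (n \<bullet> n)" for z k
    unfolding power2_norm_eq_inner
    by (simp add: inner_diff_left inner_diff_right inner_commute power2_eq_square)
  have "(norm (reflect n s x - y))\<^sup>2 = (norm ((x - y) - (2 * a / (n \<bullet> n)) *\<^sub>R n))\<^sup>2"
    by (simp add: reflect_def a_def algebra_simps)
  also have "\<dots> = (norm (x - y))\<^sup>2 - 2 * (2 * a / (n \<bullet> n)) * (n \<bullet> (x - y))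
      + (2 * a / (n \<bullet> n))\<^sup>2 * (n \<bullet> n)"
    by (rule *)
  also have "\<dots> = (norm (x - y))\<^sup>2 + 4 * a * b / (n \<bullet> n)"
    unfolding ab using False by (simp add: power2_eq_square field_simps)
  finally show ?thesis by (simp add: a_def b_def)
qed

lemma norm_reflect_fixed: "n \<bullet> (y - s) = 0 \<Longrightarrow> norm (reflect n s x - y) = norm (x - y)"
  using norm_reflect_diff_square[of n s x y] by (simp add: power2_eq_iff_nonneg)

lemma norm_reflect_reflect: "norm (reflect n s x - reflect n s y) = norm (x - y)"
proof -
  have "(norm (reflect n s x - reflect n s y))\<^sup>2 = (norm (y - x))\<^sup>2"
    unfolding norm_reflect_diff_square inner_reflect
    by (subst norm_minus_commute, subst norm_reflect_diff_square) simp
  then show ?thesis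
    by (simp add: norm_minus_commute power2_eq_iff_nonneg)
qed

lemma reflect_scaleR: "c \<noteq> 0 \<Longrightarrow> reflect (c *\<^sub>R n) s x = reflect n s x"
  by (simp add: reflect_def field_simps)

lemma reflect_cong_base: "n \<bullet> (s - s') = 0 \<Longrightarrow> reflect n s x = reflect n s' x"
  by (simp add: reflect_def inner_diff_right)

section \<open>Hyperplanes through \<open>d\<close> vertices\<close>

definition base_index :: "'d::finite" where
  "base_index = (SOME i. True)"

text \<open>The edge vector of the base vertex itself would be zero, so its row is free for
  \<open>y\<close>. The determinant is then a linear form in \<open>y\<close> which vanishes on all
  edge vectors.\<close>

definition simplex_matrix :: "('d::finite \<Rightarrow> 'v) \<Rightarrow> ('v \<Rightarrow> real ^ 'd) \<Rightarrow> real ^ 'd \<Rightarrow> real ^ 'd ^ 'd" where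
  "simplex_matrix e p y = (\<chi> i. if i = base_index then y else p (e i) - p (e base_index))"

text \<open>
  The generalized cross product of the edge vectors of the simplex with vertices \<open>p (e i)\<close>, which
  vanishes if and only if these vertices are affinely dependent.
\<close>

definition normal :: "('d::finite \<Rightarrow> 'v) \<Rightarrow> ('v \<Rightarrow> real ^ 'd) \<Rightarrow> real ^ 'd" where
  "normal e p = (\<chi> k. det (simplex_matrix e p (axis k 1)))"

lemma normal_inner: "normal e p \<bullet> y = det (simplex_matrix e p y)"
proof -
  have "det (simplex_matrix e p y) =
      det (\<chi> i. if i = base_index then (\<Sum>k\<in>UNIV. y $ k *s axis k 1)
                else p (e i) - p (e base_index))"
    by (simp only: basis_expansion simplex_matrix_def)
  also have "\<dots> = (\<Sum>k\<in>UNIV. y $ k * det (simplex_matrix e p (axis k 1)))"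
    by (simp add: det_linear_row_sum[where a = "\<lambda>_ k. y $ k *s axis k 1"]
        det_row_mul[where a = "\<lambda>_. axis _ 1"] simplex_matrix_def)
  finally show ?thesis
    by (simp add: inner_vec_def normal_def mult.commute)
qed

lemma normal_orthogonal: "normal e p \<bullet> (p (e i) - p (e base_index)) = 0"
proof (cases "i = base_index")
  case False
  then show ?thesis
    unfolding normal_inner
    by (intro det_identical_rows[of base_index i]) (auto simp: simplex_matrix_def row_def)
qed simp

lemma simplex_matrix_mult:
  "(simplex_matrix e p y *v z) $ i =
     (if i = base_index then y \<bullet> z else (p (e i) - p (e base_index)) \<bullet> z)"
  by (simp add: simplex_matrix_def matrix_vector_mul_component)

lemma det_nonzero_iff_kernel:
  fixes M :: "real ^ 'n::finite ^ 'n"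
  shows "det M \<noteq> 0 \<longleftrightarrow> (\<forall>z. M *v z = 0 \<longrightarrow> z = 0)"
  by (metis invertible_det_nz invertible_left_inverse matrix_left_invertible_ker)

text \<open>After its component along \<open>normal e p\<close> is removed, \<nu> is orthogonal to
  all rows of \<open>simplex_matrix e p (normal e p)\<close>. The determinant of this matrix is the
  squared length of the normal, so nothing remains.\<close>

lemma normal_unique:
  assumes "normal e p \<noteq> 0" "\<And>i. \<nu> \<bullet> (p (e i) - p (e base_index)) = 0"
  shows "\<exists>c. \<nu> = c *\<^sub>R normal e p"
proof -
  let ?n = "normal e p"
  let ?c = "(\<nu> \<bullet> ?n) / (?n \<bullet> ?n)"
  let ?z = "\<nu> - ?c *\<^sub>R ?n"
  have "det (simplex_matrix e p ?n) \<noteq> 0"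
    using assms(1) by (simp flip: normal_inner)
  moreover have "simplex_matrix e p ?n *v ?z = 0"
  proof -
    have "(p (e i) - p (e base_index)) \<bullet> ?z = 0" for i
      using assms(2)[of i] normal_orthogonal[of e p i]
      by (simp add: inner_diff_right inner_commute)
    moreover have "?n \<bullet> ?z = 0"
      using assms(1) by (simp add: inner_diff_right inner_commute)
    ultimately show ?thesis
      by (simp add: vec_eq_iff simplex_matrix_mult)
  qed
  ultimately have "?z = 0"
    using det_nonzero_iff_kernel by blast
  then show ?thesis
    by (intro exI[of _ ?c]) simp
qed

text \<open>A vector \<open>y\<close> which completes the edge vectors to a spanning set certifies
  that the simplex is nondegenerate; spanning is expressed by a trivial orthogonal
  complement.\<close>

lemma normal_nonzeroI:
  assumes "\<And>z. z \<bullet> y = 0 \<Longrightarrow> (\<And>i. z \<bullet> (p (e i) - p (e base_index)) = 0) \<Longrightarrow> z = 0"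
  shows "normal e p \<noteq> 0"
proof -
  have "z = 0" if "simplex_matrix e p y *v z = 0" for z
  proof (rule assms)
    have *: "(simplex_matrix e p y *v z) $ i = 0" for i
      by (simp add: that)
    show "z \<bullet> y = 0"
      using *[of base_index] by (simp add: simplex_matrix_mult inner_commute)
    show "z \<bullet> (p (e i) - p (e base_index)) = 0" for i
      using *[of i] by (cases "i = base_index") (simp_all add: simplex_matrix_mult inner_commute)
  qed
  then have "normal e p \<bullet> y \<noteq> 0"
    unfolding normal_inner det_nonzero_iff_kernel by blast
  then show ?thesis by auto
qed

lemma normal_cong:
  assumes "\<And>i. p (e i) = q (e i)"
  shows "normal e p = normal e q"
  unfolding normal_def simplex_matrix_def assms ..

definition partial_reflection ::
    "('d::finite \<Rightarrow> 'v) \<Rightarrow> 'v set \<Rightarrow> ('v \<Rightarrow> real ^ 'd) \<Rightarrow> 'v \<Rightarrow> real ^ 'd" where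
  "partial_reflection e U p =
     (\<lambda>v. if v \<in> U then reflect (normal e p) (p (e base_index)) (p v) else p v)"

lemma partial_reflection_outside [simp]: "v \<notin> U \<Longrightarrow> partial_reflection e U p v = p v"
  by (simp add: partial_reflection_def)

lemma partial_reflection_vertex [simp]: "U \<inter> range e = {} \<Longrightarrow> partial_reflection e U p (e i) = p (e i)"
  by (auto simp: partial_reflection_def)

text \<open>The mirror is determined by vertices outside \<open>U\<close>, so it does not move and
  is the same for the second reflection.\<close>

lemma partial_reflection_involutive:
  assumes "U \<inter> range e = {}"
  shows "partial_reflection e U (partial_reflection e U p) = p"
proof -
  have "normal e (partial_reflection e U p) = normal e p"
    by (rule normal_cong) (simp add: assms)
  then show ?thesis
    using assms by (auto simp: partial_reflection_def)
qed

lemma norm_partial_reflection: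
  assumes "x \<in> U \<Longrightarrow> y \<in> U \<union> range e" "y \<in> U \<Longrightarrow> x \<in> U \<union> range e"
  shows "norm (partial_reflection e U p x - partial_reflection e U p y) = norm (p x - p y)"
proof -
  have *: "norm (reflect (normal e p) (p (e base_index)) (p v) - p w) = norm (p v - p w)"
    if "w \<in> range e" for v w
    using that normal_orthogonal[of e p] by (auto intro!: norm_reflect_fixed)
  show ?thesis
    using assms *[of y x] *[of x y]
    by (auto simp: partial_reflection_def norm_reflect_reflect norm_minus_commute)
qed

lemma partial_reflection_equivalent:
  assumes "\<And>x y. {x, y} \<in> E \<Longrightarrow> x \<in> U \<Longrightarrow> y \<in> U \<union> range e"
  shows "equivalent_realizations E p (partial_reflection e U p)"
  unfolding equivalent_realizations_def
proof (intro allI impI)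
  fix x y assume "{x, y} \<in> E"
  then show "norm (p x - p y) = norm (partial_reflection e U p x - partial_reflection e U p y)"
    using assms[of x y] assms[of y x] by (simp add: norm_partial_reflection insert_commute)
qed

lemma regular_normal:
  assumes "range e \<subseteq> V" "\<And>v. v \<in> V \<Longrightarrow> regular_vec_at V t (\<lambda>p. F p v)"
  shows "regular_vec_at V t (\<lambda>p. normal e (F p))"
proof -
  have "regular_vec_at V t (\<lambda>p. F p (e i))" for i
    using assms by blast
  then have "regular_at V t (\<lambda>p. simplex_matrix e (F p) (axis k 1) $ i $ j)" for i j k
    using regular_vec_at_diff[of V t "\<lambda>p. F p (e i)" "\<lambda>p. F p (e base_index)"]
      regular_vec_at_axis[of V t k]
    by (cases "i = base_index") (auto simp: simplex_matrix_def regular_vec_at_def)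
  then show ?thesis
    by (auto simp: normal_def regular_vec_at_def intro!: regular_at_det)
qed

text \<open>Formulated for a configuration \<open>F p\<close> that depends rationally on
  \<open>p\<close>, so that reflections can be iterated. The only new denominator is the squared
  length of the normal, which is nonzero at \<open>t\<close>.\<close>

lemma regular_partial_reflection:
  assumes "range e \<subseteq> V" "\<And>v. v \<in> V \<Longrightarrow> regular_vec_at V t (\<lambda>p. F p v)"
    and "normal e (F t) \<noteq> 0" "v \<in> V"
  shows "regular_vec_at V t (\<lambda>p. partial_reflection e U (F p) v)"
proof (cases "v \<in> U")
  case True
  have b: "regular_vec_at V t (\<lambda>p. F p (e base_index))"
    using assms(1,2) by blast
  note n = regular_normal[OF assms(1,2)]
  show ?thesis
    unfolding partial_reflection_def reflect_def if_P[OF True]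
    by (intro regular_vec_at_diff assms regular_vec_at_scaleR regular_at_divide regular_at_mult
        regular_at_inner n b regular_at_numeral) (use assms(3) in simp_all)
qed (simp add: assms)

text \<open>
  A polynomial which vanishes at the reflected realization vanishes at \<open>p\<close> as well: partial
  reflections are involutions which are regular at the reflected realization.
\<close>

lemma generic_partial_reflection:
  fixes e :: "'d::finite \<Rightarrow> 'v"
  assumes p: "generic_realization V p"
    and e: "range e \<subseteq> V" "U \<inter> range e = {}" "normal e p \<noteq> 0"
  shows "generic_realization V (partial_reflection e U p)"
  unfolding generic_realization_def algebraically_independent_over_rat_def
proof (intro allI impI, elim conjE)
  fix P :: "('v \<times> 'd \<Rightarrow>\<^sub>0 nat) \<Rightarrow>\<^sub>0 rat"
  let ?t = "partial_reflection e U p"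
  assume P: "poly_over (V \<times> UNIV) P" "eval_poly (coords ?t) P = 0"
  have "normal e ?t = normal e p"
    by (rule normal_cong) (simp add: e(2))
  then have "regular_at V ?t (\<lambda>q. eval_poly (coords (partial_reflection e U q)) P)"
    using e by (intro regular_at_eval_poly P regular_partial_reflection regular_vec_at_vertex) auto
  with p have "eval_poly (coords (partial_reflection e U ?t)) P = 0"
    using generic_regular_nonzero P(2) by blast
  then show "P = 0"
    using p P(1) e(2)
    by (simp add: partial_reflection_involutive generic_realization_def
        algebraically_independent_over_rat_def)
qed

text \<open>A test configuration for general position: the vertices of \<open>e\<close> are the
  origin and unit vectors of the hyperplane where coordinate \<open>base_index\<close> is zero, and
  every other vertex lies at height one over this hyperplane.\<close>

definition simplex_config :: "('d::finite \<Rightarrow> 'v) \<Rightarrow> 'v \<Rightarrow> real ^ 'd" where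
  "simplex_config e v =
     (if v \<in> range e then (if v = e base_index then 0 else axis (inv e v) 1) else axis base_index 1)"

lemma normal_simplex_config:
  assumes "inj e"
  shows "normal e (simplex_config e) \<bullet> axis base_index 1 = 1"
proof -
  have "simplex_matrix e (simplex_config e) (axis base_index 1) = mat 1"
    using assms by (auto simp: vec_eq_iff simplex_matrix_def simplex_config_def mat_def axis_def inj_eq)
  then show ?thesis
    by (simp add: normal_inner)
qed

lemma generic_normal_nonzero:
  fixes e :: "'d::finite \<Rightarrow> 'v"
  assumes p: "generic_realization V p" and e: "inj e" "range e \<subseteq> V"
  shows "normal e p \<noteq> 0"
proof -
  let ?t = "simplex_config e"
  have "regular_at V ?t (\<lambda>q. normal e q \<bullet> axis base_index 1)"
    using e by (intro regular_at_inner regular_vec_at_axis regular_normal regular_vec_at_vertex)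
  then have "normal e p \<bullet> axis base_index 1 \<noteq> 0"
    by (rule generic_regular_nonzero[OF p]) (simp add: normal_simplex_config e)
  then show ?thesis by auto
qed

lemma generic_height_nonzero:
  fixes e :: "'d::finite \<Rightarrow> 'v"
  assumes p: "generic_realization V p" and e: "inj e" "range e \<subseteq> V" and v: "v \<in> V - range e"
  shows "normal e p \<bullet> (p v - p (e base_index)) \<noteq> 0"
proof -
  let ?t = "simplex_config e"
  have "regular_at V ?t (\<lambda>q. normal e q \<bullet> (q v - q (e base_index)))"
    using e v by (intro regular_at_inner regular_vec_at_diff regular_normal regular_vec_at_vertex) auto
  moreover have "normal e ?t \<bullet> (?t v - ?t (e base_index)) \<noteq> 0"
    using normal_simplex_config[OF e(1)] v by (simp add: simplex_config_def)
  ultimately show ?thesis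
    by (rule generic_regular_nonzero[OF p])
qed

lemma norm_partial_reflection_square:
  assumes "x \<in> U" "y \<notin> U"
  shows "(norm (partial_reflection e U p x - partial_reflection e U p y))\<^sup>2 = (norm (p x - p y))\<^sup>2
    + 4 * (normal e p \<bullet> (p x - p (e base_index))) * (normal e p \<bullet> (p y - p (e base_index)))
      / (normal e p \<bullet> normal e p)"
  using assms norm_reflect_diff_square by (simp add: partial_reflection_def)

text \<open>Vertices outside a separator have nonzero height over its mirror in a generic
  realization, and the change of the squared distance is proportional to the product of the two
  heights.\<close>

lemma norm_partial_reflection_neq:
  fixes e :: "'d::finite \<Rightarrow> 'v"
  assumes p: "generic_realization V p" and e: "inj e" "range e \<subseteq> V" "U \<inter> range e = {}"
    and x: "x \<in> V" "x \<in> U" and y: "y \<in> V" "y \<notin> U" "y \<notin> range e"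
  shows "norm (partial_reflection e U p x - partial_reflection e U p y) \<noteq> norm (p x - p y)"
proof -
  have "normal e p \<bullet> (p x - p (e base_index)) \<noteq> 0" "normal e p \<bullet> (p y - p (e base_index)) \<noteq> 0"
    "normal e p \<noteq> 0"
    using generic_height_nonzero[OF p e(1,2)] generic_normal_nonzero[OF p e(1,2)] e x y by auto
  then show ?thesis
    using norm_partial_reflection_square[OF x(2) y(2), of e p] by auto
qed


section \<open>Crossing separators\<close>

text \<open>
  A flexible linkage: \<open>c \<plusminus> e / 2\<close> and \<open>k \<plusminus> r\<close> are the opposite pairs of vertices of a (planar or
  spherical) parallelogram, and all other vertices are at points of \<open>X\<close>. The last condition
  distinguishes the planar case (dimension 2) from the spherical case with centre \<open>0 \<in> X\<close>.
\<close>

definition parallelogram_linkage :: "'a::real_inner set \<Rightarrow> 'a \<Rightarrow> 'a \<Rightarrow> 'a \<Rightarrow> 'a \<Rightarrow> bool" where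
  "parallelogram_linkage X c k e r \<longleftrightarrow>
     e \<bullet> (c - k) = 0 \<and> r \<bullet> (c - k) = 0 \<and> (\<forall>x\<in>X. e \<bullet> (x - k) = 0 \<and> r \<bullet> (x - k) = 0) \<and>
     r \<bullet> e \<noteq> 0 \<and> r - ((r \<bullet> e) / (e \<bullet> e)) *\<^sub>R e \<noteq> 0 \<and>
     (\<forall>z. z \<bullet> e = 0 \<and> z \<bullet> r = 0 \<and> (\<forall>x\<in>X. z \<bullet> (x - c) = 0) \<longrightarrow> z = 0) \<and>
     (X = {} \<and> c = k \<or> 0 \<in> X \<and> k \<noteq> 0 \<and> (\<forall>x\<in>X. x \<bullet> k = 0) \<and> (\<exists>l. l \<noteq> 0 \<and> c = l *\<^sub>R k))"

text \<open>
  Folding the parallelogram along one diagonal yields an antiparallelogram, and folding this along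
  its other diagonal yields a parallelogram again, whose first diagonal is longer than before.
\<close>

lemma parallelogram_linkage_step:
  fixes c k e r :: "'a::real_inner"
  assumes st: "parallelogram_linkage X c k e r"
  obtains c' k' e' r' n m where
    "parallelogram_linkage X c' k' e' r'" "norm e < norm e'"
    "n \<noteq> 0" "n \<bullet> e = 0" "\<forall>x\<in>X. n \<bullet> (x - (c - e /\<^sub>R 2)) = 0"
    "reflect n (c - e /\<^sub>R 2) (k - r) = k' - r'" "k + r = k' + r'"
    "\<forall>z. z \<bullet> r = 0 \<and> z \<bullet> e = 0 \<and> (\<forall>x\<in>X. z \<bullet> (x - (c - e /\<^sub>R 2)) = 0) \<longrightarrow> z = 0"
    "m \<noteq> 0" "m \<bullet> r' = 0" "\<forall>x\<in>X. m \<bullet> (x - (k' + r')) = 0"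
    "reflect m (k' + r') (c + e /\<^sub>R 2) = c' + e' /\<^sub>R 2" "c - e /\<^sub>R 2 = c' - e' /\<^sub>R 2"
    "\<forall>z. z \<bullet> m = 0 \<and> z \<bullet> r' = 0 \<and> (\<forall>x\<in>X. z \<bullet> (x - (k' + r')) = 0) \<longrightarrow> z = 0"
proof -
  \<comment> \<open>\<open>g\<close> is the component of \<open>r\<close> orthogonal to
    \<open>e\<close> and is normal to the first mirror. Folding replaces \<open>r\<close> by its
    component \<open>\<rho> *\<^sub>R e\<close>, so in the antiparallelogram the two diagonals are
    parallel.\<close>
  define \<rho> where "\<rho> = (r \<bullet> e) / (e \<bullet> e)"
  define g where "g = r - \<rho> *\<^sub>R e"
  have re: "r \<bullet> e \<noteq> 0" and g0: "g \<noteq> 0" and ec: "e \<bullet> (c - k) = 0" and rc: "r \<bullet> (c - k) = 0"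
    and ex: "\<And>x. x \<in> X \<Longrightarrow> e \<bullet> (x - k) = 0" and rx: "\<And>x. x \<in> X \<Longrightarrow> r \<bullet> (x - k) = 0"
    and nd: "\<And>z. z \<bullet> e = 0 \<Longrightarrow> z \<bullet> r = 0 \<Longrightarrow> (\<And>x. x \<in> X \<Longrightarrow> z \<bullet> (x - c) = 0) \<Longrightarrow> z = 0"
    using st unfolding parallelogram_linkage_def g_def \<rho>_def by blast+
  have e0: "e \<noteq> 0" "\<rho> \<noteq> 0"
    using re by (auto simp: \<rho>_def)
  have r: "r = g + \<rho> *\<^sub>R e"
    by (simp add: g_def)
  have ge: "g \<bullet> e = 0"
    using e0 by (simp add: g_def \<rho>_def inner_diff_left)
  have gc: "g \<bullet> (c - k) = 0" and gx: "\<And>x. x \<in> X \<Longrightarrow> g \<bullet> (x - k) = 0"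
    using rc rx ec ex by (simp_all add: g_def inner_diff_left)
  have gg: "g \<bullet> g > 0"
    using g0 by simp
  define k' where "k' = k + g"
  define r' where "r' = \<rho> *\<^sub>R e"
  \<comment> \<open>\<open>c'\<close> is the foot of the perpendicular from \<open>c\<close> to the
    second mirror, which passes through \<open>k' + r'\<close>, \<open>k' - r'\<close> and
    \<open>X\<close>. So \<open>c' - c\<close> is normal to that mirror, and in the planar case
    \<open>c'\<close> is \<open>k'\<close> itself.\<close>
  obtain c' where c': "c' \<noteq> c" "(c' - c) \<bullet> e = 0" "(c' - c) \<bullet> (c' - k') = 0" "e \<bullet> (c' - k') = 0"
      "\<And>x. x \<in> X \<Longrightarrow> (c' - c) \<bullet> (x - k') = 0"
      "\<And>z. z \<bullet> e = 0 \<Longrightarrow> z \<bullet> (c' - c) = 0 \<Longrightarrow> (\<And>x. x \<in> X \<Longrightarrow> z \<bullet> (x - k') = 0) \<Longrightarrow> z = 0"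
      "\<And>z. z \<bullet> e = 0 \<Longrightarrow> z \<bullet> (c' - c) = 0 \<Longrightarrow> (\<And>x. x \<in> X \<Longrightarrow> z \<bullet> (x - c') = 0) \<Longrightarrow> z = 0"
      "X = {} \<and> c' = k' \<or> 0 \<in> X \<and> k' \<noteq> 0 \<and> (\<forall>x\<in>X. x \<bullet> k' = 0) \<and> (\<exists>l. l \<noteq> 0 \<and> c' = l *\<^sub>R k')"
  proof (cases "X = {} \<and> c = k")
    case True
    show ?thesis
    proof (rule that[of k'])
      show "z = 0" if "z \<bullet> e = 0" "z \<bullet> (k' - c) = 0" for z
        using nd[of z] that True by (simp add: k'_def r inner_add_right)
      then show "z = 0" if "z \<bullet> e = 0" "z \<bullet> (k' - c) = 0" for z
        using that by blast
    qed (use True g0 ge in \<open>simp_all add: k'_def inner_commute\<close>)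
  next
    case False
    then obtain l where l: "0 \<in> X" "k \<noteq> 0" "\<And>x. x \<in> X \<Longrightarrow> x \<bullet> k = 0" "l \<noteq> 0" "c = l *\<^sub>R k"
      using st unfolding parallelogram_linkage_def by blast
    have ek: "e \<bullet> k = 0" and rk: "r \<bullet> k = 0"
      using ex[OF l(1)] rx[OF l(1)] by simp_all
    have gk: "g \<bullet> k = 0"
      by (simp add: g_def ek rk inner_diff_left)
    have ex0: "e \<bullet> x = 0" and gx0: "g \<bullet> x = 0" if "x \<in> X" for x
      using ex[OF that] gx[OF that] ek gk by (simp_all add: inner_diff_right)
    have kk: "k \<bullet> k > 0"
      using l by simp
    \<comment> \<open>Since \<open>k\<close> and \<open>k'\<close> have inner product
      \<open>k \<bullet> k\<close>, this makes \<open>l' *\<^sub>R k'\<close> the orthogonal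
      projection of \<open>c = l *\<^sub>R k\<close> onto the line of \<open>k'\<close>.\<close>
    define l' where "l' = l * (k \<bullet> k) / (k \<bullet> k + g \<bullet> g)"
    have l'0: "l' \<noteq> 0"
      using l kk add_pos_pos[OF kk gg] by (simp add: l'_def)
    have kk': "k' \<bullet> k' = k \<bullet> k + g \<bullet> g"
      using gk by (simp add: k'_def inner_add_left inner_add_right inner_commute)
    have k'0: "k' \<noteq> 0"
      using add_pos_pos[OF kk gg] by (auto simp flip: kk')
    have l'k: "l' * (k' \<bullet> k') = l * (k \<bullet> k)"
      unfolding kk' using add_pos_pos[OF kk gg] by (simp add: l'_def)
    have "k \<bullet> k' = k \<bullet> k"
      using gk by (simp add: k'_def inner_add_right inner_commute)
    then have fk': "(l' *\<^sub>R k' - c) \<bullet> k' = 0"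
      using l'k by (simp add: l(5) inner_diff_left)
    have ek': "e \<bullet> k' = 0"
      using ek ge by (simp add: k'_def inner_add_right inner_commute)
    have xk': "x \<bullet> k' = 0" if "x \<in> X" for x
      using l(3)[OF that] gx0[OF that] by (simp add: k'_def inner_add_right inner_commute)
    have *: "z = 0" if "z \<bullet> e = 0" "z \<bullet> (l' *\<^sub>R k' - c) = 0" "z \<bullet> k' = 0" "\<And>x. x \<in> X \<Longrightarrow> z \<bullet> x = 0" for z
    proof -
      have "z \<bullet> k = 0"
        using that(2,3) l by (simp add: inner_diff_right)
      then have "z \<bullet> g = 0"
        using that(3) by (simp add: k'_def inner_add_right)
      then show ?thesis
        using nd[of z] that \<open>z \<bullet> k = 0\<close> by (simp add: r l inner_add_right inner_diff_right)
    qed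
    show ?thesis
    proof (rule that[of "l' *\<^sub>R k'"])
      show "l' *\<^sub>R k' \<noteq> c"
      proof
        assume "l' *\<^sub>R k' = c"
        then have "g \<bullet> (l' *\<^sub>R k') = 0"
          using gk l by (simp add: inner_commute)
        then show False
          using gk l'0 gg by (simp add: k'_def inner_add_right)
      qed
      show "(l' *\<^sub>R k' - c) \<bullet> e = 0"
        using ek ek' l by (simp add: inner_diff_right inner_commute[of _ e])
      show "(l' *\<^sub>R k' - c) \<bullet> (l' *\<^sub>R k' - k') = 0"
        using fk' by (simp add: inner_diff_right)
      show "e \<bullet> (l' *\<^sub>R k' - k') = 0"
        using ek' by (simp add: inner_diff_right)
      show "(l' *\<^sub>R k' - c) \<bullet> (x - k') = 0" if "x \<in> X" for x
        using fk' xk'[OF that] l(3)[OF that] l(5)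
        by (simp add: inner_diff_right inner_diff_left inner_commute)
      show "z = 0" if z: "z \<bullet> e = 0" "z \<bullet> (l' *\<^sub>R k' - c) = 0" "\<And>x. x \<in> X \<Longrightarrow> z \<bullet> (x - k') = 0" for z
        using *[OF z(1,2)] z(3) z(3)[OF l(1)] by (simp add: inner_diff_right)
      show "z = 0" if z: "z \<bullet> e = 0" "z \<bullet> (l' *\<^sub>R k' - c) = 0"
        "\<And>x. x \<in> X \<Longrightarrow> z \<bullet> (x - l' *\<^sub>R k') = 0" for z
        using *[OF z(1,2)] z(3) z(3)[OF l(1)] l'0 by (simp add: inner_diff_right)
      show "X = {} \<and> l' *\<^sub>R k' = k' \<or>
        0 \<in> X \<and> k' \<noteq> 0 \<and> (\<forall>x\<in>X. x \<bullet> k' = 0) \<and> (\<exists>l. l \<noteq> 0 \<and> l' *\<^sub>R k' = l *\<^sub>R k')"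
        using l(1) xk' l'0 k'0 by (intro disjI2 conjI ballI exI[of _ l']) auto
    qed
  qed
  define f where "f = 2 *\<^sub>R (c' - c)"
  define e' where "e' = e + f"
  have f: "f \<noteq> 0" "f \<bullet> e = 0" "f \<bullet> (c' - k') = 0" "\<And>x. x \<in> X \<Longrightarrow> f \<bullet> (x - k') = 0"
    using c' by (simp_all add: f_def)
  have cf: "c' = c + f /\<^sub>R 2"
    by (simp add: f_def)
  have ff: "f \<bullet> f > 0"
    using f by simp
  \<comment> \<open>The diagonal gains the orthogonal vector \<open>f\<close>, so it grows by
    Pythagoras.\<close>
  have ee': "e' \<bullet> e' = e \<bullet> e + f \<bullet> f"
    using f(2) by (simp add: e'_def inner_add_left inner_add_right inner_commute)
  have re': "r' \<bullet> e' = r \<bullet> e"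
    using f(2) e0 by (simp add: e'_def r'_def inner_add_right inner_commute \<rho>_def)
  have exk': "e \<bullet> (x - k') = 0" if "x \<in> X" for x
    using ex[OF that] ge by (simp add: k'_def inner_diff_right inner_add_right inner_commute)
  show ?thesis
  proof (rule that[of c' k' e' r' g f])
    show "parallelogram_linkage X c' k' e' r'"
      unfolding parallelogram_linkage_def
    proof (intro conjI ballI allI impI)
      show "e' \<bullet> (c' - k') = 0" "r' \<bullet> (c' - k') = 0"
        using c'(4) f(3) by (simp_all add: e'_def r'_def inner_add_left)
      show "e' \<bullet> (x - k') = 0" "r' \<bullet> (x - k') = 0" if "x \<in> X" for x
        using exk'[OF that] f(4)[OF that] by (simp_all add: e'_def r'_def inner_add_left)
      show "r' \<bullet> e' \<noteq> 0"
        using re re' by simp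
      show "r' - (r' \<bullet> e' / (e' \<bullet> e')) *\<^sub>R e' \<noteq> 0"
      proof
        assume *: "r' - (r' \<bullet> e' / (e' \<bullet> e')) *\<^sub>R e' = 0"
        have "f \<bullet> r' = 0" "f \<bullet> e' = f \<bullet> f"
          using f(2) by (simp_all add: r'_def e'_def inner_add_right)
        then have "(r' \<bullet> e' / (e' \<bullet> e')) * (f \<bullet> f) = 0"
          using arg_cong[OF *, of "\<lambda>x. f \<bullet> x"] by (simp add: inner_diff_right)
        moreover have "r' \<bullet> e' \<noteq> 0" "e' \<noteq> 0"
          using re re' by auto
        ultimately show False
          using ff by simp
      qed
      show "z = 0" if "z \<bullet> e' = 0 \<and> z \<bullet> r' = 0 \<and> (\<forall>x\<in>X. z \<bullet> (x - c') = 0)" for z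
      proof (rule c'(7))
        show "z \<bullet> e = 0"
          using that e0 by (simp add: r'_def)
        then show "z \<bullet> (c' - c) = 0"
          using that by (simp add: e'_def f_def inner_add_right)
      qed (use that in blast)
    qed (fact c'(8))
    show "norm e < norm e'"
      using ee' ff by (simp add: norm_eq_sqrt_inner)
    show "g \<noteq> 0" "g \<bullet> e = 0"
      by fact+
    show "\<forall>x\<in>X. g \<bullet> (x - (c - e /\<^sub>R 2)) = 0"
      using gx gc ge by (simp add: inner_diff_right)
    have "g \<bullet> ((k - r) - (c - e /\<^sub>R 2)) = - (g \<bullet> g)"
      using gc ge by (simp add: r inner_diff_right inner_add_right)
    then show "reflect g (c - e /\<^sub>R 2) (k - r) = k' - r'"
      using gg by (simp add: reflect_def k'_def r'_def r scaleR_2)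
    show "k + r = k' + r'"
      by (simp add: k'_def r'_def r)
    show "\<forall>z. z \<bullet> r = 0 \<and> z \<bullet> e = 0 \<and> (\<forall>x\<in>X. z \<bullet> (x - (c - e /\<^sub>R 2)) = 0) \<longrightarrow> z = 0"
      by (intro allI impI nd) (auto simp: inner_diff_right)
    show "f \<noteq> 0" by fact
    show "f \<bullet> r' = 0"
      using f(2) by (simp add: r'_def)
    then show "\<forall>x\<in>X. f \<bullet> (x - (k' + r')) = 0"
      using f(4) by (simp add: inner_diff_right inner_add_right)
    have "f \<bullet> ((c + e /\<^sub>R 2) - (k' + r')) = - (f \<bullet> f) / 2"
      using f(2,3) \<open>f \<bullet> r' = 0\<close> by (simp add: cf inner_diff_right inner_add_right)
    then have "reflect f (k' + r') (c + e /\<^sub>R 2) = (c + e /\<^sub>R 2) + f"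
      using ff by (simp add: reflect_def)
    also have "\<dots> = c' + e' /\<^sub>R 2"
      by (simp add: cf e'_def algebra_simps flip: scaleR_left_distrib)
    finally show "reflect f (k' + r') (c + e /\<^sub>R 2) = c' + e' /\<^sub>R 2" .
    show "c - e /\<^sub>R 2 = c' - e' /\<^sub>R 2"
      by (simp add: cf e'_def algebra_simps)
    show "\<forall>z. z \<bullet> f = 0 \<and> z \<bullet> r' = 0 \<and> (\<forall>x\<in>X. z \<bullet> (x - (k' + r')) = 0) \<longrightarrow> z = 0"
    proof (intro allI impI, elim conjE, rule c'(6))
      fix z assume z: "z \<bullet> f = 0" "z \<bullet> r' = 0" "\<forall>x\<in>X. z \<bullet> (x - (k' + r')) = 0"
      show "z \<bullet> e = 0"
        using z(2) e0 by (simp add: r'_def)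
      show "z \<bullet> (c' - c) = 0"
        using z(1) by (simp add: f_def)
      show "z \<bullet> (x - k') = 0" if "x \<in> X" for x
        using z(2) bspec[OF z(3) that] by (simp add: inner_diff_right inner_add_right)
    qed
  qed
qed

text \<open>A separator will consist of the two ends of a diagonal and \<open>d - 2\<close> further
  vertices, which explains the size of \<open>X\<close>. In dimension 2 the parallelogram is centred
  at the origin. In higher dimensions it lies in the plane spanned by two unit vectors, shifted by a
  third one, and \<open>X\<close> consists of the origin and the remaining unit vectors.\<close>

lemma parallelogram_linkage_exists:
  assumes "CARD('d::finite) \<ge> 2"
  obtains X and c k e r :: "real ^ 'd" where "parallelogram_linkage X c k e r"
    "finite X" "card X + 2 = CARD('d)"
proof -
  obtain i j :: 'd where ij: "i \<noteq> j"
    using assms card_le_Suc0_iff_eq[of "UNIV :: 'd set"] by auto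
  let ?a = "\<lambda>i. axis i 1 :: real ^ 'd"
  have ax: "z \<bullet> ?a l = z $ l" "?a l \<bullet> z = z $ l" for z l
    by (simp_all add: inner_axis inner_axis')
  have axn: "?a l $ m = (if l = m then 1 else 0)" for l m
    by (simp add: axis_def)
  have red: "r - (r \<bullet> e / (e \<bullet> e)) *\<^sub>R e = ?a j" if "r = ?a i + ?a j" "e = ?a i" for r e
    using ij by (simp add: that ax axn)
  show ?thesis
  proof (cases "CARD('d) = 2")
    case True
    then have "card {i, j} = card (UNIV :: 'd set)"
      using ij by simp
    then have U: "UNIV = {i, j}"
      by (metis card_subset_eq finite subset_UNIV)
    have "parallelogram_linkage {} 0 0 (?a i) (?a i + ?a j)"
      unfolding parallelogram_linkage_def red[OF refl refl]
      using ij U by (auto simp: ax axn vec_eq_iff inner_add_right inner_add_left)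
    then show ?thesis
      by (rule that) (use True in auto)
  next
    case False
    then have "\<not> UNIV \<subseteq> {i, j}"
      using assms ij card_mono[of "{i, j}" "UNIV :: 'd set"] by force
    then obtain m where m: "m \<noteq> i" "m \<noteq> j" by auto
    let ?I = "UNIV - {i, j, m}"
    let ?X = "insert 0 (?a ` ?I)"
    have "inj_on ?a ?I"
      by (rule inj_onI) (simp add: axis_eq_axis)
    moreover have "(0 :: real ^ 'd) \<notin> ?a ` ?I"
      by (auto simp: axis_eq_0_iff)
    moreover have "card ?I = CARD('d) - 3"
      using ij m by (subst card_Diff_subset) auto
    ultimately have card: "card ?X + 2 = CARD('d)"
      using assms False by (simp add: card_image)
    have "z = 0" if "z \<bullet> ?a i = 0" "z \<bullet> (?a i + ?a j) = 0" "\<forall>x\<in>?X. z \<bullet> (x - ?a m) = 0" for z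
    proof -
      have "z $ i = 0" "z $ j = 0" "z $ m = 0"
        using that by (auto simp: ax inner_add_right)
      moreover have "z $ l = 0" if "l \<in> ?I" for l
        using \<open>\<forall>x\<in>?X. _ x\<close> that \<open>z $ m = 0\<close> by (auto simp: ax inner_diff_right)
      ultimately have "z $ l = 0" for l
        by (cases "l \<in> {i, j, m}") auto
      then show ?thesis
        by (simp add: vec_eq_iff)
    qed
    moreover have "\<exists>l. l \<noteq> 0 \<and> ?a m = l *\<^sub>R ?a m"
      by (rule exI[of _ 1]) simp
    ultimately have "parallelogram_linkage ?X (?a m) (?a m) (?a i) (?a i + ?a j)"
      unfolding parallelogram_linkage_def red[OF refl refl]
      using ij m by (auto simp: ax axn axis_eq_0_iff inner_add_left inner_diff_right)
    then show ?thesis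
      by (rule that) (use card in auto)
  qed
qed

text \<open>Allows the determinantal normal to be replaced by any explicit normal of the same
  hyperplane.\<close>

lemma partial_reflection_eq:
  assumes "normal e p \<noteq> 0" "\<nu> \<noteq> 0" "\<And>i. \<nu> \<bullet> (p (e i) - s) = 0"
  shows "partial_reflection e U p v = (if v \<in> U then reflect \<nu> s (p v) else p v)"
proof -
  have "\<nu> \<bullet> (p (e i) - p (e base_index)) = 0" for i
    using assms(3)[of i] assms(3)[of base_index] by (simp add: inner_diff_right)
  then obtain c where c: "\<nu> = c *\<^sub>R normal e p"
    using normal_unique[OF assms(1)] by blast
  then have "c \<noteq> 0"
    using assms(2) by auto
  have "reflect \<nu> s x = reflect \<nu> (p (e base_index)) x" for x
    by (intro reflect_cong_base) (use assms(3)[of base_index] in \<open>simp add: inner_diff_right\<close>)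
  then show ?thesis
    by (simp add: partial_reflection_def c reflect_scaleR \<open>c \<noteq> 0\<close>)
qed

text \<open>The separators are \<open>range eS\<close> and \<open>range eT\<close>. Moving
  \<open>D\<close> splits \<open>u\<close> from \<open>w\<close>, and moving \<open>B\<close> splits
  \<open>a\<close> from \<open>b\<close>; these pairs will be the ends of the two diagonals of the
  linkage.\<close>

locale crossing =
  fixes V :: "'v set" and eS eT :: "'d::finite \<Rightarrow> 'v" and B D :: "'v set" and u w a b :: 'v
  assumes eS: "inj eS" "range eS \<subseteq> V" "B \<inter> range eS = {}"
    and eT: "inj eT" "range eT \<subseteq> V" "D \<inter> range eT = {}"
    and uw: "u \<in> range eS - range eT" "w \<in> range eS - range eT" "u \<notin> D" "w \<in> D"
    and ab: "a \<in> range eT - range eS" "b \<in> range eT - range eS" "a \<notin> B" "b \<in> B"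
begin

definition fold_twice :: "('v \<Rightarrow> real ^ 'd) \<Rightarrow> 'v \<Rightarrow> real ^ 'd" where
  "fold_twice p = partial_reflection eT D (partial_reflection eS B p)"

text \<open>Both separators place their remaining \<open>d - 2\<close> vertices on \<open>X\<close>,
  so each mirror is spanned by \<open>X\<close> and one diagonal. Vertices outside both separators
  may lie anywhere.\<close>

definition linkage_config :: "(real ^ 'd) set \<Rightarrow> ('v \<Rightarrow> real ^ 'd) \<Rightarrow> bool" where
  "linkage_config X p \<longleftrightarrow>
     (\<exists>c k e r. parallelogram_linkage X c k e r \<and> p u = c - e /\<^sub>R 2 \<and> p w = c + e /\<^sub>R 2 \<and>
        p a = k + r \<and> p b = k - r) \<and>
     p ` (range eS - {u, w}) = X \<and> p ` (range eT - {a, b}) = X"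

lemma linkage_config_step:
  assumes "linkage_config X p"
  shows "linkage_config X (fold_twice p)" "norm (p w - p u) < norm (fold_twice p w - fold_twice p u)"
    "normal eS p \<noteq> 0" "normal eT (partial_reflection eS B p) \<noteq> 0"
proof -
  let ?q = "partial_reflection eS B p"
  obtain c k e r where st: "parallelogram_linkage X c k e r"
    and p: "p u = c - e /\<^sub>R 2" "p w = c + e /\<^sub>R 2" "p a = k + r" "p b = k - r"
    and X: "p ` (range eS - {u, w}) = X" "p ` (range eT - {a, b}) = X"
    using assms unfolding linkage_config_def by blast
  obtain c' k' e' r' n m where st': "parallelogram_linkage X c' k' e' r'" "norm e < norm e'"
    and n: "n \<noteq> 0" "n \<bullet> e = 0" "\<forall>x\<in>X. n \<bullet> (x - (c - e /\<^sub>R 2)) = 0"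
      "reflect n (c - e /\<^sub>R 2) (k - r) = k' - r'" "k + r = k' + r'"
    and nd: "\<forall>z. z \<bullet> r = 0 \<and> z \<bullet> e = 0 \<and> (\<forall>x\<in>X. z \<bullet> (x - (c - e /\<^sub>R 2)) = 0) \<longrightarrow> z = 0"
    and m: "m \<noteq> 0" "m \<bullet> r' = 0" "\<forall>x\<in>X. m \<bullet> (x - (k' + r')) = 0"
      "reflect m (k' + r') (c + e /\<^sub>R 2) = c' + e' /\<^sub>R 2" "c - e /\<^sub>R 2 = c' - e' /\<^sub>R 2"
    and md: "\<forall>z. z \<bullet> m = 0 \<and> z \<bullet> r' = 0 \<and> (\<forall>x\<in>X. z \<bullet> (x - (k' + r')) = 0) \<longrightarrow> z = 0"
    by (rule parallelogram_linkage_step[OF st])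
  show nS: "normal eS p \<noteq> 0"
  proof (rule normal_nonzeroI[of r])
    fix z assume z: "z \<bullet> r = 0" "\<And>i. z \<bullet> (p (eS i) - p (eS base_index)) = 0"
    have zS: "z \<bullet> (p v - p v') = 0" if vv: "v \<in> range eS" "v' \<in> range eS" for v v'
    proof -
      obtain i j where "v = eS i" "v' = eS j"
        using vv by blast
      then show ?thesis
        using z(2)[of i] z(2)[of j] by (simp add: inner_diff_right)
    qed
    show "z = 0"
    proof (intro nd[rule_format] conjI ballI)
      show "z \<bullet> e = 0"
        using zS[of w u] uw by (simp add: p inner_diff_right inner_add_right)
      show "z \<bullet> (x - (c - e /\<^sub>R 2)) = 0" if "x \<in> X" for x
      proof -
        obtain v where "v \<in> range eS" "x = p v"
          using \<open>x \<in> X\<close> X(1) by blast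
        then show ?thesis
          using zS[of v u] uw by (simp add: p(1))
      qed
    qed fact
  qed
  have nX: "n \<bullet> (p v - (c - e /\<^sub>R 2)) = 0" if "v \<in> range eS \<or> v \<in> range eT - {a, b}" for v
  proof (cases "v \<in> {u, w}")
    case True
    then show ?thesis
      using n(2) by (auto simp: p inner_diff_right inner_add_right)
  next
    case False
    then have "p v \<in> X"
      using that X by blast
    then show ?thesis
      using n(3) by blast
  qed
  then have q_eq: "?q v = (if v \<in> B then reflect n (c - e /\<^sub>R 2) (p v) else p v)" for v
    by (intro partial_reflection_eq nS n) auto
  have q: "?q u = c' - e' /\<^sub>R 2" "?q w = c + e /\<^sub>R 2" "?q a = k' + r'" "?q b = k' - r'"
    using eS uw ab n p m by (auto simp: q_eq)
  have q_fix: "?q v = p v" if "v \<in> range eS \<or> v \<in> range eT - {a, b}" for v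
    using nX[OF that] by (simp add: q_eq reflect_fixed)
  have "?q ` (range eS - {u, w}) = p ` (range eS - {u, w})"
    "?q ` (range eT - {a, b}) = p ` (range eT - {a, b})"
    by (intro image_cong refl q_fix; blast)+
  with X have qX: "?q ` (range eS - {u, w}) = X" "?q ` (range eT - {a, b}) = X"
    by simp_all
  show nT: "normal eT ?q \<noteq> 0"
  proof (rule normal_nonzeroI[of m])
    fix z assume z: "z \<bullet> m = 0" "\<And>i. z \<bullet> (?q (eT i) - ?q (eT base_index)) = 0"
    have zT: "z \<bullet> (?q v - ?q v') = 0" if vv: "v \<in> range eT" "v' \<in> range eT" for v v'
    proof -
      obtain i j where "v = eT i" "v' = eT j"
        using vv by blast
      then show ?thesis
        using z(2)[of i] z(2)[of j] by (simp add: inner_diff_right)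
    qed
    show "z = 0"
    proof (intro md[rule_format] conjI ballI)
      show "z \<bullet> r' = 0"
        using zT[of a b] ab by (simp add: q flip: scaleR_2)
      show "z \<bullet> (x - (k' + r')) = 0" if "x \<in> X" for x
      proof -
        obtain v where "v \<in> range eT" "x = ?q v"
          using \<open>x \<in> X\<close> qX(2) by blast
        then show ?thesis
          using zT[of v a] ab q(3) by simp
      qed
    qed fact
  qed
  have mX: "m \<bullet> (?q v - (k' + r')) = 0" if "v \<in> range eT \<or> v \<in> range eS - {u, w}" for v
  proof (cases "v \<in> {a, b}")
    case True
    then show ?thesis
      using m(2) by (auto simp: q inner_diff_right inner_add_right)
  next
    case False
    then have "?q v \<in> X"
      using that qX by blast
    then show ?thesis
      using m(3) by blast
  qed
  then have h_eq: "fold_twice p v = (if v \<in> D then reflect m (k' + r') (?q v) else ?q v)" for v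
    unfolding fold_twice_def by (intro partial_reflection_eq nT m) auto
  have h: "fold_twice p u = c' - e' /\<^sub>R 2" "fold_twice p w = c' + e' /\<^sub>R 2"
    "fold_twice p a = k' + r'" "fold_twice p b = k' - r'"
    using eT uw ab m q by (auto simp: h_eq)
  have h_fix: "fold_twice p v = ?q v" if "v \<in> range eT \<or> v \<in> range eS - {u, w}" for v
    using mX[OF that] by (simp add: h_eq reflect_fixed)
  have "fold_twice p ` (range eS - {u, w}) = ?q ` (range eS - {u, w})"
    "fold_twice p ` (range eT - {a, b}) = ?q ` (range eT - {a, b})"
    by (intro image_cong refl h_fix; blast)+
  with qX have "fold_twice p ` (range eS - {u, w}) = X" "fold_twice p ` (range eT - {a, b}) = X"
    by simp_all
  then show "linkage_config X (fold_twice p)"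
    unfolding linkage_config_def using st'(1) h by blast
  show "norm (p w - p u) < norm (fold_twice p w - fold_twice p u)"
    using st'(2) by (simp add: p h algebra_simps flip: scaleR_left_distrib)
qed

text \<open>The separators may share vertices. A bijection of the rest of the first separator onto
  \<open>X\<close> is kept on the shared vertices, and the other vertices of the second separator
  are sent bijectively to the points of \<open>X\<close> that are left.\<close>

lemma linkage_config_exists:
  obtains X t where "linkage_config X t"
proof -
  have "u \<noteq> w" "a \<noteq> b"
    using uw ab by auto
  have card: "card (range eS) = CARD('d)" "card (range eT) = CARD('d)"
    using eS(1) eT(1) by (simp_all add: card_image)
  have "CARD('d) \<ge> 2"
    using card_mono[of "range eS" "{u, w}"] uw \<open>u \<noteq> w\<close> card(1) by simp
  then obtain X and c k e r :: "real ^ 'd" where X: "parallelogram_linkage X c k e r"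
    "finite X" "card X + 2 = CARD('d)"
    using parallelogram_linkage_exists by blast
  let ?S = "range eS - {u, w}" and ?T = "range eT - {a, b}"
  let ?Z = "?S \<inter> ?T"
  have "card ?S = card X" "card ?T = card X"
    using uw ab \<open>u \<noteq> w\<close> \<open>a \<noteq> b\<close> card X(3) by (simp_all add: card_Diff_subset)
  then obtain g where g: "bij_betw g ?S X"
    using finite_same_card_bij X(2) by (metis finite_Diff finite_imageI finite_UNIV finite)
  have gZ: "g ` ?Z \<subseteq> X" "card (g ` ?Z) = card ?Z"
    using g by (auto simp: bij_betw_def intro!: card_image inj_on_subset[of g ?S])
  have "card (?T - ?Z) = card (X - g ` ?Z)"
    using gZ X(2) \<open>card ?T = card X\<close> by (simp add: card_Diff_subset finite_subset)
  then obtain g' where g': "bij_betw g' (?T - ?Z) (X - g ` ?Z)"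
    using finite_same_card_bij[of "?T - ?Z" "X - g ` ?Z"] X(2) by auto
  define t where "t = (\<lambda>v. if v = u then c - e /\<^sub>R 2 else if v = w then c + e /\<^sub>R 2
    else if v = a then k + r else if v = b then k - r else if v \<in> ?S then g v else g' v)"
  have "t v = g v" if "v \<in> ?S" for v
  proof -
    have "v \<noteq> u" "v \<noteq> w" "v \<noteq> a" "v \<noteq> b"
      using that ab(1,2) by blast+
    with that show ?thesis
      by (simp add: t_def)
  qed
  then have "t ` ?S = g ` ?S"
    by (rule image_cong[OF refl])
  then have 1: "t ` ?S = X"
    using g by (simp add: bij_betw_def)
  have "t v = g' v" if "v \<in> ?T - ?Z" for v
  proof -
    have "v \<noteq> u" "v \<noteq> w" "v \<noteq> a" "v \<noteq> b" "v \<notin> ?S"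
      using that uw(1,2) by blast+
    then show ?thesis
      unfolding t_def by (simp only: if_False)
  qed
  then have "t ` (?T - ?Z) = g' ` (?T - ?Z)"
    by (rule image_cong[OF refl])
  moreover have "t ` ?Z = g ` ?Z"
    using \<open>\<And>v. v \<in> ?S \<Longrightarrow> t v = g v\<close> by (intro image_cong refl) blast
  moreover have "t ` ?T = t ` ?Z \<union> t ` (?T - ?Z)"
    unfolding image_Un[symmetric] by (rule arg_cong[of _ _ "image t"]) blast
  ultimately have "t ` ?T = g ` ?Z \<union> g' ` (?T - ?Z)"
    by simp
  also have "\<dots> = X"
    using g' gZ(1) unfolding bij_betw_def by blast
  finally have 2: "t ` ?T = X" .
  have "t u = c - e /\<^sub>R 2 \<and> t w = c + e /\<^sub>R 2 \<and> t a = k + r \<and> t b = k - r"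
    using uw ab \<open>u \<noteq> w\<close> \<open>a \<noteq> b\<close> by (auto simp: t_def)
  with X(1) 1 2 have "linkage_config X t"
    unfolding linkage_config_def by blast
  then show ?thesis
    by (rule that)
qed

text \<open>The difference of the two squared distances is a rational function of the configuration.
  It is regular at a linkage configuration \<open>t\<close>, because no mirror degenerates along the
  orbit of \<open>t\<close>, and nonzero there, because the diagonal from \<open>u\<close> to
  \<open>w\<close> grows with every double fold.\<close>

lemma generic_fold_twice_neq:
  assumes p: "generic_realization V p" and mn: "m < n"
  shows "norm ((fold_twice ^^ m) p w - (fold_twice ^^ m) p u)
       \<noteq> norm ((fold_twice ^^ n) p w - (fold_twice ^^ n) p u)"
proof -
  obtain X t where t: "linkage_config X t"
    using linkage_config_exists .
  have lc: "linkage_config X ((fold_twice ^^ l) t)" for l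
    by (induction l) (simp_all add: t linkage_config_step)
  let ?d = "\<lambda>l p. ((fold_twice ^^ l) p w - (fold_twice ^^ l) p u)"
  have reg: "regular_vec_at V t (\<lambda>p. (fold_twice ^^ l) p v)" if "v \<in> V" for l v
    using that
  proof (induction l arbitrary: v)
    case (Suc l)
    show ?case
      unfolding funpow.simps(2) o_apply fold_twice_def[of "(fold_twice ^^ l) p" for p]
      using linkage_config_step(3,4)[OF lc[of l]] eS(2) eT(2) Suc
      by (intro regular_partial_reflection) auto
  qed (simp add: regular_vec_at_vertex)
  have "strict_mono (\<lambda>l. norm (?d l t))"
    using linkage_config_step(2)[OF lc] by (intro strict_mono_Suc_iff[THEN iffD2]) simp
  then have "norm (?d m t) < norm (?d n t)"
    using mn by (auto dest: strict_monoD)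
  then have "?d m t \<bullet> ?d m t - ?d n t \<bullet> ?d n t \<noteq> 0"
    by (simp add: norm_eq_sqrt_inner)
  moreover have "u \<in> V" "w \<in> V"
    using uw eS by auto
  ultimately have "?d m p \<bullet> ?d m p - ?d n p \<bullet> ?d n p \<noteq> 0"
    by (intro generic_regular_nonzero[OF p, of t "\<lambda>p. ?d m p \<bullet> ?d m p - ?d n p \<bullet> ?d n p"]
        regular_at_diff regular_at_inner regular_vec_at_diff reg)
  then show ?thesis
    by (simp add: norm_eq_sqrt_inner)
qed

end


section \<open>Almost every realization is generic\<close>

text \<open>\<open>P\<close> is read as a polynomial in the variable \<open>j\<close>: the
  coefficient \<open>c k\<close> collects the monomials in which \<open>j\<close> has exponent
  \<open>k\<close>, with this exponent erased. Monomials with the same exponent of \<open>j\<close>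
  remain distinct, so nothing cancels.\<close>

lemma eval_poly_fun_upd:
  "\<exists>N c. (\<forall>I k. poly_over I P \<longrightarrow> poly_over (I - {j}) (c k)) \<and>
     (\<forall>a t. eval_poly (a(j := t)) P = (\<Sum>k\<le>N. eval_poly a (c k) * t ^ k)) \<and>
     (P \<noteq> 0 \<longrightarrow> (\<exists>k\<le>N. c k \<noteq> 0))"
proof -
  let ?K = "Poly_Mapping.keys P" and ?r = "Poly_Mapping.update j (0::nat)"
  let ?Kj = "\<lambda>k. {m. m \<in> ?K \<and> Poly_Mapping.lookup m j = k}"
  define c where "c = (\<lambda>k. \<Sum>m\<in>?Kj k. Poly_Mapping.single (?r m) (Poly_Mapping.lookup P m))"
  define N where "N = Max (insert 0 ((\<lambda>m. Poly_Mapping.lookup m j) ` ?K))"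
  have N: "Poly_Mapping.lookup m j \<le> N" if "m \<in> ?K" for m
    using that by (auto simp: N_def)
  have monom: "eval_monom (a(j := t)) m = eval_monom a (?r m) * t ^ Poly_Mapping.lookup m j" for a t m
  proof -
    let ?J = "insert j (Poly_Mapping.keys m)"
    have "eval_monom (a(j := t)) m = (\<Prod>i\<in>?J. (a(j := t)) i ^ Poly_Mapping.lookup m i)"
      by (rule eval_monom_superset) auto
    also have "\<dots> = t ^ Poly_Mapping.lookup m j *
        (\<Prod>i\<in>?J - {j}. (a(j := t)) i ^ Poly_Mapping.lookup m i)"
      by (subst prod.remove[of _ j]) auto
    also have "(\<Prod>i\<in>?J - {j}. (a(j := t)) i ^ Poly_Mapping.lookup m i)
        = (\<Prod>i\<in>?J - {j}. a i ^ Poly_Mapping.lookup (?r m) i)"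
      by (rule prod.cong) (auto simp: lookup_update)
    also have "\<dots> = eval_monom a (?r m)"
      by (rule eval_monom_superset[symmetric]) (auto simp: keys_update)
    finally show ?thesis
      by (simp only: mult.commute)
  qed
  have ev: "eval_poly (a(j := t)) P = (\<Sum>k\<le>N. eval_poly a (c k) * t ^ k)" for a t
  proof -
    have "eval_poly (a(j := t)) P = (\<Sum>m\<in>?K. of_rat (Poly_Mapping.lookup P m) *
        eval_monom a (?r m) * t ^ Poly_Mapping.lookup m j)"
      by (subst eval_poly_superset[OF finite_keys order_refl]) (simp add: monom mult_ac)
    also have "\<dots> = (\<Sum>k\<le>N. \<Sum>m\<in>?Kj k. of_rat (Poly_Mapping.lookup P m) *
        eval_monom a (?r m) * t ^ Poly_Mapping.lookup m j)"
      by (rule sum.group[symmetric]) (use N in auto)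
    also have "\<dots> = (\<Sum>k\<le>N. eval_poly a (c k) * t ^ k)"
      by (rule sum.cong) (auto simp: c_def eval_poly_sum eval_poly_single sum_distrib_right)
    finally show ?thesis .
  qed
  have "poly_over (I - {j}) (c k)" if "poly_over I P" for I k
  proof
    fix n assume "n \<in> Poly_Mapping.keys (c k)"
    then obtain m where "m \<in> ?K" "n = ?r m"
      unfolding c_def using keys_sum[of "\<lambda>m. Poly_Mapping.single (?r m) (Poly_Mapping.lookup P m)" "?Kj k"]
      by (auto split: if_splits)
    then show "Poly_Mapping.keys n \<subseteq> I - {j}"
      using that by (auto simp: keys_update)
  qed
  note poly = this
  have nz: "\<exists>k\<le>N. c k \<noteq> 0" if P: "P \<noteq> 0"
  proof -
    obtain m where m: "m \<in> ?K"
      using P by fastforce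
    let ?k = "Poly_Mapping.lookup m j"
    have inj: "m' = m" if "?r m' = ?r m" "Poly_Mapping.lookup m' j = ?k" for m'
    proof (rule poly_mapping_eqI)
      fix i
      show "Poly_Mapping.lookup m' i = Poly_Mapping.lookup m i"
        using that(2) fun_cong[OF arg_cong[OF that(1), of Poly_Mapping.lookup], of i]
        by (simp add: lookup_update split: if_splits)
    qed
    have "Poly_Mapping.lookup (c ?k) (?r m) =
        (\<Sum>m'\<in>?Kj ?k. if m' = m then Poly_Mapping.lookup P m else 0)"
      unfolding c_def lookup_sum by (rule sum.cong) (auto simp: lookup_single when_def dest: inj)
    also have "\<dots> = Poly_Mapping.lookup P m"
      using m by simp
    finally have "c ?k \<noteq> 0"
      using m by (auto simp: in_keys_iff)
    then show ?thesis
      using N[OF m] by blast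
  qed
  show ?thesis
    using poly ev nz by blast
qed

lemma eval_poly_nonzero_exists:
  assumes "finite I" "poly_over I P" "P \<noteq> 0"
  shows "\<exists>a. eval_poly a P \<noteq> 0"
  using assms
proof (induction I arbitrary: P rule: finite_induct)
  case empty
  then have K: "Poly_Mapping.keys P \<subseteq> {0}"
    by auto
  then have "eval_poly a P = of_rat (Poly_Mapping.lookup P 0)" for a
    by (subst eval_poly_superset[of "{0}"]) (auto simp: eval_monom_def)
  moreover have "Poly_Mapping.lookup P 0 \<noteq> 0"
  proof
    assume "Poly_Mapping.lookup P 0 = 0"
    then have "0 \<notin> Poly_Mapping.keys P"
      by (simp add: in_keys_iff)
    with K have "Poly_Mapping.keys P = {}"
      by blast
    then show False
      using empty.prems(2) by simp
  qed
  ultimately show ?case by simp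
next
  case (insert j I)
  obtain N c where N: "\<forall>I k. poly_over I P \<longrightarrow> poly_over (I - {j}) (c k)"
    "\<forall>a t. eval_poly (a(j := t)) P = (\<Sum>k\<le>N. eval_poly a (c k) * t ^ k)"
    "P \<noteq> 0 \<longrightarrow> (\<exists>k\<le>N. c k \<noteq> 0)"
    using eval_poly_fun_upd[of P j] by (elim exE conjE)
  then obtain k where k: "k \<le> N" "c k \<noteq> 0"
    using insert.prems by blast
  have "insert j I - {j} = I"
    using insert.hyps by auto
  then have "poly_over I (c k)"
    using N(1)[THEN spec, THEN spec, THEN mp, OF insert.prems(1), of k] by simp
  then obtain a where a: "eval_poly a (c k) \<noteq> 0"
    using insert.IH k by blast
  have "\<not> (\<forall>t. (\<Sum>k\<le>N. eval_poly a (c k) * t ^ k) = 0)"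
    using a k(1) by (subst Transcendental.polyfun_eq_0) blast
  then show ?case
    using N(2) by metis
qed

lemma AE_eval_poly_fun_upd:
  assumes "eval_poly a P \<noteq> 0"
  shows "AE t in lborel. eval_poly (a(j := t)) P \<noteq> 0"
proof -
  obtain N c where "\<forall>a t. eval_poly (a(j := t)) P = (\<Sum>k\<le>N. eval_poly a (c k) * t ^ k)"
    using eval_poly_fun_upd[of P j] by (elim exE conjE)
  then have N: "eval_poly (a(j := t)) P = (\<Sum>k\<le>N. eval_poly a (c k) * t ^ k)" for t
    by blast
  have "\<not> (\<forall>t. (\<Sum>k\<le>N. eval_poly a (c k) * t ^ k) = 0)"
    using assms N[of "a j"] by auto
  then have "\<exists>k\<le>N. eval_poly a (c k) \<noteq> 0"
    by (subst (asm) Transcendental.polyfun_eq_0) blast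
  then have "finite {t. (\<Sum>k\<le>N. eval_poly a (c k) * t ^ k) = 0}"
    by (subst polyfun_finite_roots)
  then have "{t. eval_poly (a(j := t)) P = 0} \<in> null_sets lborel"
    unfolding N by (rule finite_imp_null_set_lborel)
  from AE_not_in[OF this] show ?thesis by simp
qed

text \<open>Fubini's theorem, one factor at a time: from the nonzero point \<open>c\<close>, almost
  every change of coordinate \<open>j\<close> leads to a nonzero point again, which then serves as
  the base point for the other coordinates. The abstract form serves both the coordinates of a
  vector and the vertices of a configuration; points of the product are completed by
  \<open>c\<close> outside the index set.\<close>

lemma (in product_sigma_finite) AE_PiM_nonzero:
  fixes f :: "('i \<Rightarrow> 'a) \<Rightarrow> real"
  assumes J: "finite J" and c: "f c \<noteq> 0" "c \<in> UNIV \<rightarrow> U"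
    and space: "\<And>i. i \<in> J \<Longrightarrow> space (M i) = U"
    and meas: "\<And>K c. K \<subseteq> J \<Longrightarrow>
      (\<lambda>x. f (\<lambda>i. if i \<in> K then x i else c i)) \<in> borel_measurable (PiM K M)"
    and AE: "\<And>x i. i \<in> J \<Longrightarrow> f x \<noteq> 0 \<Longrightarrow> x \<in> UNIV \<rightarrow> U \<Longrightarrow> AE y in M i. f (x(i := y)) \<noteq> 0"
  shows "AE x in PiM J M. f (\<lambda>i. if i \<in> J then x i else c i) \<noteq> 0"
  using J c space meas AE
proof (induction J arbitrary: c rule: finite_induct)
  case empty
  then show ?case by simp
next
  case (insert j J)
  let ?f = "\<lambda>K c x. f (\<lambda>i. if i \<in> K then x i else c i)"
  have [measurable]: "?f (insert j J) c \<in> borel_measurable (PiM (insert j J) M)"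
    by (rule insert.prems(4)) simp
  have upd: "?f (insert j J) c (x(j := y)) = ?f J (c(j := y)) x" for x y
    by (rule arg_cong[of _ _ f]) (use insert.hyps in auto)
  have "AE y in M j. AE x in PiM J M. ?f (insert j J) c (x(j := y)) \<noteq> 0"
    using insert.prems(5)[OF insertI1 insert.prems(1,2)] AE_space
  proof eventually_elim
    case (elim y)
    then have "c(j := y) \<in> UNIV \<rightarrow> U"
      using insert.prems(2,3) by auto
    then show ?case
      unfolding upd using elim(1) insert.prems(3,5)
      by (intro insert.IH insert.prems(4)) blast+
  qed
  \<comment> \<open>Almost sure nonvanishing is expressed by the integral of the indicator of the
    exceptional set, so that the integral over the product can be split.\<close>
  moreover have "(AE x in PiM J M. ?f (insert j J) c (x(j := y)) \<noteq> 0) \<longleftrightarrow>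
      (\<integral>\<^sup>+ x. indicator {x. \<not> ?f (insert j J) c x \<noteq> 0} (x(j := y)) \<partial>PiM J M) = 0"
    if "y \<in> space (M j)" for y
  proof -
    have [measurable]: "(\<lambda>x. ?f (insert j J) c (x(j := y))) \<in> borel_measurable (PiM J M)"
      unfolding upd using insert.prems(4) by blast
    have "(\<integral>\<^sup>+ x. indicator {x. \<not> ?f (insert j J) c x \<noteq> 0} (x(j := y)) \<partial>PiM J M)
        = (\<integral>\<^sup>+ x. indicator {x. \<not> ?f (insert j J) c (x(j := y)) \<noteq> 0} x \<partial>PiM J M)"
      by (rule nn_integral_cong) (simp add: indicator_def)
    moreover have "{x \<in> space (PiM J M). ?f (insert j J) c (x(j := y)) \<noteq> 0} \<in> sets (PiM J M)"
      by measurable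
    ultimately show ?thesis
      by (simp only: AE_iff_nn_integral)
  qed
  ultimately have "AE y in M j.
      (\<integral>\<^sup>+ x. indicator {x. \<not> ?f (insert j J) c x \<noteq> 0} (x(j := y)) \<partial>PiM J M) = 0"
    using AE_space by (auto elim: AE_mp)
  then have "(\<integral>\<^sup>+ y. \<integral>\<^sup>+ x. indicator {x. \<not> ?f (insert j J) c x \<noteq> 0} (x(j := y)) \<partial>PiM J M \<partial>M j)
      = (\<integral>\<^sup>+ y. 0 \<partial>M j)"
    by (intro nn_integral_cong_AE)
  moreover have "{x \<in> space (PiM (insert j J) M). \<not> ?f (insert j J) c x \<noteq> 0} \<in> sets (PiM (insert j J) M)"
    by measurable
  then have "(indicator {x. \<not> ?f (insert j J) c x \<noteq> 0} :: _ \<Rightarrow> ennreal)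
      \<in> borel_measurable (PiM (insert j J) M)"
    by (subst borel_measurable_indicator_iff) (simp add: Collect_conj_eq Int_commute)
  ultimately have "(\<integral>\<^sup>+ x. indicator {x. \<not> ?f (insert j J) c x \<noteq> 0} x \<partial>PiM (insert j J) M) = 0"
    by (subst product_nn_integral_insert_rev[OF insert.hyps]) simp_all
  moreover have "{x \<in> space (PiM (insert j J) M). ?f (insert j J) c x \<noteq> 0} \<in> sets (PiM (insert j J) M)"
    by measurable
  ultimately show ?case
    by (simp only: AE_iff_nn_integral)
qed

section \<open>Polynomials in the positions of the vertices\<close>

lemma borel_measurable_vec_nth [measurable (raw)]:
  fixes f :: "'a \<Rightarrow> real ^ 'n::finite"
  assumes "f \<in> borel_measurable M"
  shows "(\<lambda>x. f x $ i) \<in> borel_measurable M"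
proof -
  have "(\<lambda>x. f x \<bullet> axis i 1) \<in> borel_measurable M"
    using assms by measurable
  then show ?thesis
    by (simp add: inner_axis)
qed

lemma borel_measurable_vecI:
  fixes f :: "'a \<Rightarrow> real ^ 'n::finite"
  assumes "\<And>i. (\<lambda>x. f x $ i) \<in> borel_measurable M"
  shows "f \<in> borel_measurable M"
proof (subst borel_measurable_euclidean_space, intro ballI)
  fix b :: "real ^ 'n" assume "b \<in> Basis"
  then obtain i where "b = axis i 1"
    by (auto simp: Basis_vec_def)
  then show "(\<lambda>x. f x \<bullet> b) \<in> borel_measurable M"
    using assms by (simp add: inner_axis)
qed

lemma borel_measurable_eval_poly:
  assumes "\<And>i. (\<lambda>x. F x i) \<in> borel_measurable M"
  shows "(\<lambda>x. eval_poly (F x) P) \<in> borel_measurable M"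
  unfolding eval_poly_def using assms by measurable

text \<open>Lebesgue measure on vectors is the image of a product measure over the basis, so the
  position of \<open>v\<close> can be varied one coordinate at a time; each coordinate has finitely
  many bad values.\<close>

lemma AE_eval_poly_vertex:
  fixes p :: "'v \<Rightarrow> real ^ 'd::finite"
  assumes "eval_poly (coords p) P \<noteq> 0"
  shows "AE y in lborel. eval_poly (coords (p(v := y))) P \<noteq> 0"
proof -
  interpret product_sigma_finite "\<lambda>_ :: real ^ 'd. lborel :: real measure"
    by standard
  let ?y = "\<lambda>x. \<Sum>b\<in>Basis. x b *\<^sub>R b :: real ^ 'd"
  let ?f = "\<lambda>x. eval_poly (coords (p(v := ?y x))) P"
  have y: "(\<Sum>b\<in>Basis. x b * b $ i) = x (axis i 1)" for x :: "real ^ 'd \<Rightarrow> real" and i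
    using inner_sum_left_Basis[of "axis i 1" x] by (simp add: inner_axis)
  have meas: "(\<lambda>x. eval_poly (coords (p(v := F x))) P) \<in> borel_measurable M"
    if "F \<in> borel_measurable M" for F and M :: "'b measure"
    by (rule borel_measurable_eval_poly) (use that in auto)
  have "AE x in PiM Basis (\<lambda>_ :: real ^ 'd. lborel).
      ?f (\<lambda>b. if b \<in> Basis then x b else (\<lambda>b. p v \<bullet> b) b) \<noteq> 0"
  proof (rule AE_PiM_nonzero)
    show "?f (\<lambda>b. p v \<bullet> b) \<noteq> 0"
      using assms by (simp add: euclidean_representation)
    show "(\<lambda>x. ?f (\<lambda>i. if i \<in> K then x i else c i)) \<in> borel_measurable (PiM K (\<lambda>_. lborel))" for K c
    proof (rule meas)
      have *: "(\<lambda>x. if b \<in> K then x b else c b) \<in> borel_measurable (PiM K (\<lambda>_. lborel))" for b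
        by (cases "b \<in> K") auto
      show "(\<lambda>x. ?y (\<lambda>i. if i \<in> K then x i else c i)) \<in> borel_measurable (PiM K (\<lambda>_. lborel))"
        by (intro borel_measurable_sum borel_measurable_scaleR *) simp
    qed
    fix x b assume b: "b \<in> (Basis :: (real ^ 'd) set)" "?f x \<noteq> 0"
    then obtain i where i: "b = axis i 1"
      by (auto simp: Basis_vec_def)
    have "coords (p(v := ?y (x(b := t)))) = (coords (p(v := ?y x)))((v, i) := t)" for t
      unfolding fun_eq_iff by (auto simp: y i axis_eq_axis)
    then show "AE t in lborel. ?f (x(b := t)) \<noteq> 0"
      using AE_eval_poly_fun_upd[OF b(2), of "(v, i)"] by simp
  qed (auto intro: Pi_I[of _ _ "\<lambda>_. UNIV"])
  then have "AE x in PiM Basis (\<lambda>_ :: real ^ 'd. lborel). ?f x \<noteq> 0"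
    by (auto cong: sum.cong)
  moreover have "{y. eval_poly (coords (p(v := y))) P \<noteq> 0} \<in> sets borel"
    using meas[of "\<lambda>x. x" borel] by measurable
  ultimately show ?thesis
    by (subst lborel_eq, subst AE_distr_iff) auto
qed

lemma AE_eval_poly_nonzero:
  assumes V: "finite V" and P: "poly_over (V \<times> UNIV) P" "P \<noteq> 0"
  shows "AE p in PiM V (\<lambda>_. lborel :: (real ^ 'd::finite) measure). eval_poly (coords p) P \<noteq> 0"
proof -
  interpret product_sigma_finite "\<lambda>_ :: 'a. lborel :: (real ^ 'd) measure"
    by standard
  obtain a where a: "eval_poly a P \<noteq> 0"
    using eval_poly_nonzero_exists[OF _ P] V by auto
  let ?c = "\<lambda>v. \<chi> i. a (v, i)"
  let ?f = "\<lambda>p :: 'a \<Rightarrow> real ^ 'd. eval_poly (coords p) P"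
  have "AE x in PiM V (\<lambda>_. lborel). ?f (\<lambda>v. if v \<in> V then x v else ?c v) \<noteq> 0"
  proof (rule AE_PiM_nonzero)
    have "coords ?c = a"
      by auto
    then show "?f ?c \<noteq> 0"
      using a by simp
    show "(\<lambda>x. ?f (\<lambda>v. if v \<in> K then x v else c v)) \<in> borel_measurable (PiM K (\<lambda>_. lborel))" for K c
    proof (rule borel_measurable_eval_poly)
      fix vi :: "'a \<times> 'd"
      have "(\<lambda>x. if fst vi \<in> K then x (fst vi) else c (fst vi)) \<in> borel_measurable (PiM K (\<lambda>_. lborel))"
        by (cases "fst vi \<in> K") auto
      from borel_measurable_vec_nth[OF this, of "snd vi"]
      show "(\<lambda>x. coords (\<lambda>v. if v \<in> K then x v else c v) vi) \<in> borel_measurable (PiM K (\<lambda>_. lborel))"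
        by (simp add: case_prod_beta)
    qed
  qed (use V AE_eval_poly_vertex in auto)
  moreover have "?f (\<lambda>v. if v \<in> V then x v else ?c v) = ?f x" for x
    unfolding eval_poly_def using P(1) by (intro sum.cong prod.cong arg_cong2[of _ _ _ _ "(*)"] refl) force
  ultimately show ?thesis by simp
qed

lemma countable_poly_over:
  assumes "finite I"
  shows "countable {P :: ('i \<Rightarrow>\<^sub>0 nat) \<Rightarrow>\<^sub>0 rat. poly_over I P}"
proof -
  let ?M = "{m :: 'i \<Rightarrow>\<^sub>0 nat. Poly_Mapping.keys m \<subseteq> I}"
  let ?r = "\<lambda>m. restrict (Poly_Mapping.lookup m) I"
  have "inj_on ?r ?M"
  proof (rule inj_onI, rule poly_mapping_eqI)
    fix m n i assume m: "m \<in> ?M" "n \<in> ?M" "?r m = ?r n"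
    show "Poly_Mapping.lookup m i = Poly_Mapping.lookup n i"
    proof (cases "i \<in> I")
      case True
      then show ?thesis
        using fun_cong[OF m(3), of i] by simp
    next
      case False
      then have "i \<notin> Poly_Mapping.keys m" "i \<notin> Poly_Mapping.keys n"
        using m by auto
      then show ?thesis
        by (simp add: in_keys_iff)
    qed
  qed
  moreover have "countable (\<Pi>\<^sub>E i\<in>I. UNIV :: nat set)"
    by (intro countable_PiE assms) simp
  then have "countable (?r ` ?M)"
    by (rule countable_subset[rotated]) auto
  ultimately have M: "countable ?M"
    by (rule countable_image_inj_on[rotated])
  let ?g = "\<lambda>P. (\<lambda>m. (m, Poly_Mapping.lookup P m)) ` Poly_Mapping.keys P"
  let ?P = "{P :: ('i \<Rightarrow>\<^sub>0 nat) \<Rightarrow>\<^sub>0 rat. poly_over I P}"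
  have "inj_on ?g ?P"
  proof (rule inj_onI, rule poly_mapping_eqI)
    fix P Q :: "('i \<Rightarrow>\<^sub>0 nat) \<Rightarrow>\<^sub>0 rat" and m
    assume g: "?g P = ?g Q"
    have *: "(m, x) \<in> ?g P \<longleftrightarrow> Poly_Mapping.lookup P m \<noteq> 0 \<and> x = Poly_Mapping.lookup P m"
      for P :: "('i \<Rightarrow>\<^sub>0 nat) \<Rightarrow>\<^sub>0 rat" and x
      by (auto simp: in_keys_iff)
    have "Poly_Mapping.lookup P m \<noteq> 0 \<and> x = Poly_Mapping.lookup P m \<longleftrightarrow>
        Poly_Mapping.lookup Q m \<noteq> 0 \<and> x = Poly_Mapping.lookup Q m" for x
      unfolding *[symmetric] g ..
    then show "Poly_Mapping.lookup P m = Poly_Mapping.lookup Q m"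
      by metis
  qed
  moreover have "countable {A. finite A \<and> A \<subseteq> ?M \<times> (UNIV :: rat set)}"
    by (intro countable_Collect_finite_subset countable_SIGMA M) simp
  then have "countable (?g ` ?P)"
    by (rule countable_subset[rotated]) auto
  ultimately show ?thesis
    by (rule countable_image_inj_on[rotated])
qed

text \<open>Genericity is a countable conjunction: finitely many variables admit only countably many
  rational polynomials, and each nonzero one excludes a null set.\<close>

lemma AE_generic:
  assumes "finite V"
  shows "AE p in PiM V (\<lambda>_. lborel :: (real ^ 'd::finite) measure). generic_realization V p"
proof -
  have "AE p in PiM V (\<lambda>_. lborel :: (real ^ 'd) measure).
      \<forall>P\<in>{P. poly_over (V \<times> UNIV) P} - {0}. eval_poly (coords p) P \<noteq> 0"
    using assms AE_eval_poly_nonzero[OF assms]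
    by (subst AE_ball_countable) (auto intro!: countable_Diff countable_poly_over)
  then show ?thesis
    by eventually_elim
      (auto simp: generic_realization_def algebraically_independent_over_rat_def)
qed


section \<open>Recurrence of partial reflections\<close>

lemma nn_integral_lborel_translate:
  fixes c :: "'a::euclidean_space"
  assumes [measurable]: "f \<in> borel_measurable borel"
  shows "(\<integral>\<^sup>+ x. f (c + x) \<partial>lborel) = (\<integral>\<^sup>+ x. f x \<partial>lborel)"
proof -
  have "(\<integral>\<^sup>+ x. f x \<partial>lborel) = (\<integral>\<^sup>+ x. f x \<partial>distr lborel borel ((+) c))"
    by (simp only: lborel_distr_plus)
  then show ?thesis
    by (simp add: nn_integral_distr)
qed

text \<open>
  The measures of \<open>B\<close> and of its preimage are compared by Fubini's theorem and translation
  invariance, since the unit ball is invariant under \<open>L\<close>.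
\<close>

lemma lborel_distr_isometric_involution:
  fixes L :: "'a::euclidean_space \<Rightarrow> 'a"
  assumes L: "linear L" "\<And>x. norm (L x) = norm x" "\<And>x. L (L x) = x"
  shows "distr lborel borel L = lborel"
proof (rule measure_eqI)
  fix B assume "B \<in> sets (distr lborel borel L)"
  then have [measurable]: "B \<in> sets borel" by simp
  have "continuous_on UNIV L"
    using L(1) by (simp add: linear_continuous_on linear_conv_bounded_linear)
  then have [measurable]: "L \<in> borel_measurable borel"
    by (rule borel_measurable_continuous_onI)
  let ?A = "ball (0 :: 'a) 1"
  have [measurable]: "?A \<in> sets borel" by simp
  let ?m = "emeasure (lborel :: 'a measure)"
  have ball: "(\<integral>\<^sup>+ y. indicator ?A (x - L y) \<partial>lborel) = ?m ?A" for x
  proof -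
    have "norm (x - L y) = norm (y - L x)" for y
      using L(2)[of "x - L y"] L(3)[of y] by (simp add: linear_diff[OF L(1)] norm_minus_commute)
    then have "(\<integral>\<^sup>+ y. indicator ?A (x - L y) \<partial>lborel) =
        (\<integral>\<^sup>+ y. indicator (ball (L x) 1) y \<partial>lborel)"
      by (intro nn_integral_cong) (auto simp: indicator_def dist_norm norm_minus_commute)
    also have "\<dots> = (\<integral>\<^sup>+ y. indicator (ball (L x) 1) (L x + y) \<partial>lborel)"
      by (rule nn_integral_lborel_translate[symmetric])
        (intro borel_measurable_indicator borel_open open_ball)
    also have "\<dots> = (\<integral>\<^sup>+ y. indicator ?A y \<partial>lborel)"
      by (intro nn_integral_cong) (auto simp: indicator_def dist_norm)
    finally show ?thesis by simp
  qed
  have "?m ?A * ?m B = (\<integral>\<^sup>+ x. indicator ?A x * ?m B \<partial>lborel)"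
    by (subst nn_integral_multc) simp_all
  also have "\<dots> = (\<integral>\<^sup>+ x. (\<integral>\<^sup>+ y. indicator ?A x * indicator B (L x + y) \<partial>lborel) \<partial>lborel)"
    by (subst nn_integral_cmult) (simp_all add: nn_integral_lborel_translate)
  also have "\<dots> = (\<integral>\<^sup>+ y. (\<integral>\<^sup>+ x. indicator ?A x * indicator B (L x + y) \<partial>lborel) \<partial>lborel)"
    by (rule lborel_pair.Fubini'[symmetric]) simp
  \<comment> \<open>For fixed \<open>y\<close>, the variable \<open>x\<close> is translated by
    \<open>- L y\<close>. As \<open>L (L y) = y\<close>, the argument of \<open>B\<close> becomes
    \<open>L x\<close>.\<close>
  also have "\<dots> = (\<integral>\<^sup>+ y. (\<integral>\<^sup>+ x. indicator ?A (x - L y) * indicator B (L x) \<partial>lborel) \<partial>lborel)"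
  proof (rule nn_integral_cong)
    fix y
    show "(\<integral>\<^sup>+ x. indicator ?A x * indicator B (L x + y) \<partial>lborel) =
        (\<integral>\<^sup>+ x. indicator ?A (x - L y) * indicator B (L x) \<partial>lborel)"
      by (subst nn_integral_lborel_translate[of _ "- L y", symmetric])
        (simp_all add: linear_add[OF L(1)] linear_diff[OF L(1)] linear_neg[OF L(1)] L(3))
  qed
  also have "\<dots> = (\<integral>\<^sup>+ x. (\<integral>\<^sup>+ y. indicator ?A (x - L y) * indicator B (L x) \<partial>lborel) \<partial>lborel)"
    by (rule lborel_pair.Fubini') simp
  also have "\<dots> = (\<integral>\<^sup>+ x. ?m ?A * indicator B (L x) \<partial>lborel)"
    by (subst nn_integral_multc) (simp_all add: ball)
  also have "\<dots> = ?m ?A * (\<integral>\<^sup>+ x. indicator B (L x) \<partial>lborel)"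
    by (rule nn_integral_cmult) simp
  also have "(\<integral>\<^sup>+ x. indicator B (L x) \<partial>lborel) = emeasure (distr lborel borel L) B"
  proof -
    have "(\<integral>\<^sup>+ x. indicator B (L x) \<partial>lborel) = (\<integral>\<^sup>+ x. indicator B x \<partial>distr lborel borel L)"
      by (rule nn_integral_distr[symmetric]) simp_all
    then show ?thesis
      by simp
  qed
  finally have "?m ?A * ?m B = ?m ?A * emeasure (distr lborel borel L) B" .
  moreover have "?m ?A \<noteq> top"
    using emeasure_lborel_ball_finite[of "0 :: 'a" 1] by simp
  moreover have "?m ?A \<noteq> 0"
  proof
    assume "?m ?A = 0"
    then have "measure lborel ?A = 0"
      by (simp add: measure_def)
    then show False
      using content_ball_pos[of 1 "0 :: 'a"] by simp
  qed
  ultimately show "emeasure (distr lborel borel L) B = ?m B"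
    by (simp add: ennreal_mult_cancel_left)
qed simp

lemma lborel_distr_reflect:
  fixes n s :: "'a::euclidean_space"
  shows "distr lborel borel (reflect n s) = lborel"
proof -
  have [measurable]: "reflect n s \<in> borel_measurable borel" for s
    unfolding reflect_def by measurable
  have "linear (reflect n 0)"
    by (rule linearI) (simp_all add: reflect_def inner_add_right algebra_simps add_divide_distrib)
  moreover have "norm (reflect n 0 x) = norm x" for x
    using norm_reflect_reflect[of n 0 x 0] by (simp add: reflect_def)
  ultimately have L: "distr lborel borel (reflect n 0) = lborel"
    by (intro lborel_distr_isometric_involution) simp_all
  \<comment> \<open>The affine reflection is the linear one followed by this translation.\<close>
  let ?c = "(2 * (n \<bullet> s) / (n \<bullet> n)) *\<^sub>R n"
  have "reflect n s = (+) ?c \<circ> reflect n 0"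
    by (auto simp: reflect_def fun_eq_iff inner_diff_right algebra_simps diff_divide_distrib)
  then have "distr lborel borel (reflect n s) = distr (distr lborel borel (reflect n 0)) borel ((+) ?c)"
    by (simp add: distr_distr)
  then show ?thesis
    by (simp only: L lborel_distr_plus)
qed

section \<open>Partial reflections preserve Lebesgue measure\<close>

abbreviation config_measure :: "'v set \<Rightarrow> ('v \<Rightarrow> real ^ 'd::finite) measure" where
  "config_measure V \<equiv> PiM V (\<lambda>_. lborel)"

lemma borel_measurable_normal:
  assumes "\<And>i. (\<lambda>x. F x (e i)) \<in> borel_measurable M"
  shows "(\<lambda>x. normal e (F x)) \<in> borel_measurable M"
proof (rule borel_measurable_vecI)
  fix k
  have *: "(\<lambda>x. simplex_matrix e (F x) (axis k 1) $ i $ j) \<in> borel_measurable M" for i j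
    using assms by (cases "i = base_index") (simp_all add: simplex_matrix_def borel_measurable_vec_nth)
  show "(\<lambda>x. normal e (F x) $ k) \<in> borel_measurable M"
    unfolding normal_def det_def vec_lambda_beta using * by measurable
qed

lemma measurable_partial_reflection:
  assumes "range e \<subseteq> V" "U \<subseteq> V"
  shows "partial_reflection e U \<in> measurable (config_measure V) (config_measure V)"
  unfolding partial_reflection_def[abs_def]
proof (rule measurable_PiM_single')
  fix v assume v: "v \<in> V"
  have vert: "(\<lambda>p. p w) \<in> borel_measurable (config_measure V)" if "w \<in> V" for w
    using measurable_component_singleton[OF that, of "\<lambda>_. lborel"] by simp
  have n: "(\<lambda>p. normal e p) \<in> borel_measurable (config_measure V)"
    using assms(1) by (intro borel_measurable_normal vert) auto
  have b: "e base_index \<in> V"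
    using assms by auto
  show "(\<lambda>p. if v \<in> U then reflect (normal e p) (p (e base_index)) (p v) else p v)
      \<in> measurable (config_measure V) lborel"
  proof (cases "v \<in> U")
    case True
    note [measurable] = n vert[OF v] vert[OF b]
    have "(\<lambda>p. reflect (normal e p) (p (e base_index)) (p v)) \<in> borel_measurable (config_measure V)"
      unfolding reflect_def by measurable
    with True show ?thesis by simp
  qed (use vert[OF v] in simp)
next
  show "(\<lambda>p v. if v \<in> U then reflect (normal e p) (p (e base_index)) (p v) else p v)
      \<in> space (config_measure V) \<rightarrow> (\<Pi>\<^sub>E v\<in>V. space lborel)"
    using assms by (auto simp: space_PiM PiE_def extensional_def)
qed

text \<open>With all vertices except \<open>u\<close> frozen, the mirror is fixed and the position
  of \<open>u\<close> undergoes a single reflection, which preserves Lebesgue measure. Integration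
  over the other vertices gives the claim.\<close>

lemma distr_partial_reflection_singleton:
  fixes e :: "'d::finite \<Rightarrow> 'v"
  assumes V: "finite V" and e: "range e \<subseteq> V" and u: "u \<in> V" "u \<notin> range e"
  shows "distr (config_measure V) (config_measure V) (partial_reflection e {u}) = config_measure V"
proof (rule measure_eqI)
  interpret product_sigma_finite "\<lambda>_ :: 'v. lborel :: (real ^ 'd) measure"
    by standard
  let ?M = "config_measure V :: ('v \<Rightarrow> real ^ 'd) measure" and ?V = "V - {u}"
  let ?t = "partial_reflection e {u}"
  have [measurable]: "?t \<in> measurable ?M ?M"
    using e u by (intro measurable_partial_reflection) auto
  fix A assume "A \<in> sets (distr ?M ?M ?t)"
  then have A [measurable]: "A \<in> sets ?M" by simp
  have iV: "insert u ?V = V"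
    using u by auto
  have Vu: "finite ?V" "u \<notin> ?V"
    using V by auto
  have upd: "(\<lambda>y. x(u := y)) \<in> measurable lborel ?M" if "x \<in> space (config_measure ?V)" for x :: "'v \<Rightarrow> real ^ 'd"
    using measurable_component_update[OF that Vu(2)] iV by simp
  have t: "?t (x(u := y)) = x(u := reflect (normal e x) (x (e base_index)) y)" for x y
  proof -
    have "normal e (x(u := y)) = normal e x"
      using u(2) by (intro normal_cong) auto
    moreover have "e base_index \<noteq> u"
      using u(2) by auto
    ultimately show ?thesis
      by (auto simp: partial_reflection_def)
  qed
  have refl: "(\<integral>\<^sup>+ y. indicator A (x(u := reflect n s y)) \<partial>lborel) = (\<integral>\<^sup>+ y. indicator A (x(u := y)) \<partial>lborel)"
    if "x \<in> space (config_measure ?V)" for x n s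
  proof -
    note [measurable] = upd[OF that]
    have [measurable]: "reflect n s \<in> borel_measurable borel"
      unfolding reflect_def by measurable
    have "(\<integral>\<^sup>+ y. indicator A (x(u := y)) \<partial>lborel)
        = (\<integral>\<^sup>+ y. indicator A (x(u := y)) \<partial>distr lborel borel (reflect n s))"
      by (simp only: lborel_distr_reflect)
    also have "\<dots> = (\<integral>\<^sup>+ y. indicator A (x(u := reflect n s y)) \<partial>lborel)"
      by (rule nn_integral_distr) measurable
    finally show ?thesis by simp
  qed
  have "emeasure (distr ?M ?M ?t) A = (\<integral>\<^sup>+ p. indicator A p \<partial>distr ?M ?M ?t)"
    by simp
  also have "\<dots> = (\<integral>\<^sup>+ p. indicator A (?t p) \<partial>?M)"
    by (rule nn_integral_distr) measurable
  also have "\<dots> = (\<integral>\<^sup>+ x. (\<integral>\<^sup>+ y. indicator A (?t (x(u := y))) \<partial>lborel) \<partial>config_measure ?V)"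
    using product_nn_integral_insert[OF Vu, of "\<lambda>p. indicator A (?t p)"] iV by simp
  also have "\<dots> = (\<integral>\<^sup>+ x. (\<integral>\<^sup>+ y. indicator A (x(u := y)) \<partial>lborel) \<partial>config_measure ?V)"
    unfolding t by (intro nn_integral_cong refl)
  also have "\<dots> = (\<integral>\<^sup>+ p. indicator A p \<partial>?M)"
    using product_nn_integral_insert[OF Vu, of "indicator A"] iV by simp
  finally show "emeasure (distr ?M ?M ?t) A = emeasure ?M A"
    by simp
qed simp

text \<open>The vertices of \<open>U\<close> can be reflected one after the other, because none of
  these reflections moves the mirror.\<close>

lemma distr_partial_reflection:
  fixes e :: "'d::finite \<Rightarrow> 'v"
  assumes V: "finite V" and e: "range e \<subseteq> V" and U: "U \<subseteq> V" "U \<inter> range e = {}"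
  shows "distr (config_measure V) (config_measure V) (partial_reflection e U) = config_measure V"
proof -
  have "finite U"
    using V U finite_subset by blast
  then show ?thesis
    using U
  proof (induction U rule: finite_induct)
    case empty
    have "partial_reflection e {} = (\<lambda>p. p)"
      by (simp add: fun_eq_iff)
    then show ?case
      by (simp add: distr_id)
  next
    case (insert u U)
    have "normal e (partial_reflection e U p) = normal e p" for p
      using insert.prems by (intro normal_cong) simp
    then have eq: "partial_reflection e (insert u U) = partial_reflection e {u} \<circ> partial_reflection e U"
      using insert.hyps insert.prems by (auto simp: fun_eq_iff partial_reflection_def)
    have "distr (config_measure V) (config_measure V) (partial_reflection e (insert u U)) =
      distr (distr (config_measure V) (config_measure V) (partial_reflection e U)) (config_measure V)
        (partial_reflection e {u})"
      unfolding eq using insert.prems e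
      by (intro distr_distr[symmetric] measurable_partial_reflection) auto
    then show ?case
      using insert V e distr_partial_reflection_singleton[of V e u] by auto
  qed
qed

text \<open>Poincare's recurrence theorem.\<close>

lemma AE_recurrent:
  assumes T [measurable]: "T \<in> measurable M M" and distr: "distr M M T = M"
    and K [measurable]: "K \<in> sets M" and fin: "emeasure M K \<noteq> \<infinity>"
    and inv: "\<And>x. x \<in> space M \<Longrightarrow> T x \<in> K \<longleftrightarrow> x \<in> K"
    and A [measurable]: "A \<in> sets M"
  shows "AE x in M. x \<in> A \<inter> K \<longrightarrow> (\<exists>n>0. (T ^^ n) x \<in> A)"
proof -
  have Tn [measurable]: "(T ^^ n) \<in> measurable M M" for n
    by (induction n) auto
  have distr_n: "distr M M (T ^^ n) = M" for n
  proof (induction n)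
    case (Suc n)
    have "distr M M (T ^^ Suc n) = distr (distr M M (T ^^ n)) M T"
      by (simp add: distr_distr)
    then show ?case
      by (simp only: Suc.IH distr)
  qed (simp add: id_def distr_id)
  have inv_n: "(T ^^ n) x \<in> K \<longleftrightarrow> x \<in> K" if "x \<in> space M" for n x
  proof (induction n)
    case (Suc n)
    have "(T ^^ n) x \<in> space M"
      using Tn that by (rule measurable_space)
    then show ?case
      using Suc inv by simp
  qed simp
  \<comment> \<open>The points of \<open>A \<inter> K\<close> that never return to \<open>A\<close>.
    The preimages of \<open>W\<close> under the iterates are disjoint, have equal measure and all
    lie in \<open>K\<close>, whose measure is finite; so \<open>W\<close> is a null set.\<close>
  define W where "W = {x \<in> space M. x \<in> A \<and> x \<in> K \<and> (\<forall>n\<in>{0<..}. (T ^^ n) x \<notin> A)}"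
  have W [measurable]: "W \<in> sets M"
    unfolding W_def by measurable
  define Wn where "Wn = (\<lambda>n. (T ^^ n) -` W \<inter> space M)"
  have Wn: "Wn n \<in> sets M" "emeasure M (Wn n) = emeasure M W" "Wn n \<subseteq> K" for n
  proof -
    show "Wn n \<in> sets M"
      unfolding Wn_def by measurable
    show "emeasure M (Wn n) = emeasure M W"
      using emeasure_distr[OF Tn W, of n] by (simp add: distr_n Wn_def)
    show "Wn n \<subseteq> K"
      using inv_n by (auto simp: Wn_def W_def)
  qed
  have disj: "Wn i \<inter> Wn j = {}" if "i < j" for i j
  proof (rule ccontr)
    assume "Wn i \<inter> Wn j \<noteq> {}"
    then obtain x where x: "x \<in> space M" "(T ^^ i) x \<in> W" "(T ^^ j) x \<in> W"
      by (auto simp: Wn_def)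
    have "(T ^^ (j - i)) ((T ^^ i) x) = (T ^^ j) x"
      using that by (simp flip: funpow_add o_apply[of "T ^^ _"])
    moreover have "(T ^^ (j - i)) ((T ^^ i) x) \<notin> A"
      using x(2) that by (simp add: W_def)
    ultimately show False
      using x(3) by (simp add: W_def)
  qed
  have "disjoint_family Wn"
    unfolding disjoint_family_on_def
  proof (intro ballI impI)
    fix i j :: nat assume "i \<noteq> j"
    then show "Wn i \<inter> Wn j = {}"
      using disj[of i j] disj[of j i] by (cases "i < j") auto
  qed
  then have "(\<Sum>n<N. emeasure M (Wn n)) = emeasure M (\<Union>n<N. Wn n)" for N
    using Wn(1) by (intro sum_emeasure) (auto simp: disjoint_family_on_def)
  also have "\<dots> N \<le> emeasure M K" for N
    using Wn(3) by (intro emeasure_mono K) auto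
  finally have le: "of_nat N * emeasure M W \<le> emeasure M K" for N
    by (simp add: Wn(2))
  have "emeasure M W = 0"
  proof (rule ccontr)
    assume "emeasure M W \<noteq> 0"
    moreover have "emeasure M W \<noteq> top"
      using le[of 1] fin by (auto simp: top_unique)
    ultimately obtain r where r: "emeasure M W = ennreal r" "r > 0"
      by (cases "emeasure M W") (auto simp: ennreal_eq_0_iff not_le)
    obtain s where s: "emeasure M K = ennreal s" "s \<ge> 0"
      using fin by (cases "emeasure M K") auto
    obtain N where "s < real N * r"
      using reals_Archimedean3[OF r(2)] by blast
    moreover have "ennreal (real N * r) \<le> ennreal s"
      using le[of N] r s by (simp add: ennreal_mult' ennreal_of_nat_eq_real_of_nat)
    ultimately show False
      using s by (simp add: ennreal_le_iff)
  qed
  then have "W \<in> null_sets M"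
    using W by (simp add: null_setsI)
  from AE_not_in[OF this] AE_space show ?thesis
    by eventually_elim (auto simp: W_def)
qed

text \<open>Recurrence requires an invariant set of finite measure, whereas the whole configuration
  space has infinite measure. The set \<open>K\<close> anchors \<open>u\<close>, which neither fold
  moves, and bounds the edge lengths, which folding preserves. Connectedness makes it bounded, and
  it contains all configurations in a ball of radius 1/2, so it has positive measure.\<close>

lemma (in crossing) generic_recurrent_exists:
  fixes E :: "'v set set"
  assumes V: "finite V" and BD: "B \<subseteq> V" "D \<subseteq> V"
    and E: "\<And>x y. {x, y} \<in> E \<Longrightarrow> x \<in> B \<Longrightarrow> y \<in> B \<union> range eS"
      "\<And>x y. {x, y} \<in> E \<Longrightarrow> x \<in> D \<Longrightarrow> y \<in> D \<union> range eT"
    and conn: "\<And>v. v \<in> V \<Longrightarrow> (u, v) \<in> (adj_on E V)\<^sup>*"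
  shows "\<exists>p :: 'v \<Rightarrow> real ^ 'd. generic_realization V p \<and>
    (\<forall>\<epsilon>>0. \<exists>n>0. \<forall>v\<in>V. norm (p v - (fold_twice ^^ n) p v) < \<epsilon>)"
proof -
  let ?M = "config_measure V :: ('v \<Rightarrow> real ^ 'd) measure"
  interpret product_sigma_finite "\<lambda>_ :: 'v. lborel :: (real ^ 'd) measure"
    by standard
  have ft: "fold_twice = partial_reflection eT D \<circ> partial_reflection eS B"
    by (simp add: fun_eq_iff fold_twice_def)
  have mS: "partial_reflection eS B \<in> measurable ?M ?M" and mT: "partial_reflection eT D \<in> measurable ?M ?M"
    using eS eT BD by (auto intro: measurable_partial_reflection)
  have T [measurable]: "fold_twice \<in> measurable ?M ?M"
    unfolding ft using mS mT by (rule measurable_comp)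
  have distr: "distr ?M ?M fold_twice = ?M"
    unfolding ft using distr_distr[OF mT mS] distr_partial_reflection[OF V eS(2) BD(1) eS(3)]
      distr_partial_reflection[OF V eT(2) BD(2) eT(3)] by simp
  have vert [measurable]: "(\<lambda>p. p w) \<in> borel_measurable ?M" if "w \<in> V" for w
    using measurable_component_singleton[OF that, of "\<lambda>_. lborel"] by simp
  have u: "u \<in> V" "u \<notin> B" "u \<notin> D"
    using uw eS by auto
  define K where "K = {p \<in> space ?M. norm (p u) \<le> 1 \<and>
    (\<forall>x\<in>V. \<forall>y\<in>V. {x, y} \<in> E \<longrightarrow> norm (p x - p y) \<le> 1)}"
  have K: "K \<in> sets ?M"
    unfolding K_def using V u(1) by measurable
  have inv: "fold_twice p \<in> K \<longleftrightarrow> p \<in> K" if "p \<in> space ?M" for p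
  proof -
    have "fold_twice p u = p u"
      using u by (simp add: fold_twice_def)
    moreover have "norm (fold_twice p x - fold_twice p y) = norm (p x - p y)" if "{x, y} \<in> E" for x y
      using partial_reflection_equivalent[of E B eS p, OF E(1)] that
        partial_reflection_equivalent[of E D eT "partial_reflection eS B p", OF E(2)]
      by (simp add: equivalent_realizations_def fold_twice_def)
    ultimately show ?thesis
      using that measurable_space[OF T that] by (auto simp: K_def)
  qed
  have "\<forall>v\<in>V. \<exists>n. (u, v) \<in> adj_on E V ^^ n"
    using conn by (simp add: rtrancl_power)
  from bchoice[OF this] obtain l where l: "\<And>v. v \<in> V \<Longrightarrow> (u, v) \<in> adj_on E V ^^ l v"
    by blast
  have dist: "norm (p v) \<le> 1 + real n" if "p \<in> K" "(u, v) \<in> adj_on E V ^^ n" for p v n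
    using that(2)
  proof (induction n arbitrary: v)
    case 0
    then show ?case
      using that(1) by (simp add: K_def)
  next
    case (Suc n)
    then obtain w where w: "(u, w) \<in> adj_on E V ^^ n" "(w, v) \<in> adj_on E V"
      by auto
    then have "norm (p w - p v) \<le> 1"
      using that(1) by (simp add: K_def adj_on_def)
    then show ?case
      using Suc.IH[OF w(1)] norm_triangle_sub[of "p v" "p w"] by (simp add: norm_minus_commute)
  qed
  have "K \<subseteq> (\<Pi>\<^sub>E v\<in>V. cball 0 (1 + real (l v)))"
    using dist l by (force simp: K_def space_PiM PiE_def)
  then have "emeasure ?M K \<le> (\<Prod>v\<in>V. emeasure lborel (cball (0 :: real ^ 'd) (1 + real (l v))))"
    using V by (subst emeasure_PiM[symmetric]) (auto intro!: emeasure_mono sets_PiM_I_finite)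
  also have "\<dots> < top"
    using emeasure_lborel_cball_finite[where ?'a = "real ^ 'd"]
    by (simp add: less_top[symmetric] ennreal_prod_eq_top)
  finally have fin: "emeasure ?M K \<noteq> \<infinity>"
    by simp
  have "(\<Pi>\<^sub>E v\<in>V. cball 0 (1/2)) \<subseteq> K"
  proof
    fix p :: "'v \<Rightarrow> real ^ 'd" assume p: "p \<in> (\<Pi>\<^sub>E v\<in>V. cball 0 (1/2))"
    then have *: "norm (p v) \<le> 1/2" if "v \<in> V" for v
      using that by auto
    have "norm (p x - p y) \<le> 1" if "x \<in> V" "y \<in> V" for x y
      using norm_triangle_ineq4[of "p x" "p y"] *[OF that(1)] *[OF that(2)] by simp
    moreover have "norm (p u) \<le> 1"
      using *[OF u(1)] by simp
    ultimately show "p \<in> K"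
      using p by (auto simp: K_def space_PiM PiE_def)
  qed
  then have "emeasure ?M (\<Pi>\<^sub>E v\<in>V. cball 0 (1/2)) \<le> emeasure ?M K"
    using K by (intro emeasure_mono)
  moreover have "emeasure ?M (\<Pi>\<^sub>E v\<in>V. cball 0 (1/2)) \<noteq> 0"
  proof -
    have "emeasure lborel (cball (0 :: real ^ 'd) (1/2)) \<noteq> 0"
      using content_cball_pos[of "1/2" "0 :: real ^ 'd"] by (auto simp: measure_def)
    then show ?thesis
      using V by (subst emeasure_PiM) auto
  qed
  ultimately have pos: "emeasure ?M K \<noteq> 0"
    by auto
  obtain Q :: "(real ^ 'd) set" where Q: "countable Q"
    "\<forall>X. open X \<longrightarrow> X \<noteq> {} \<longrightarrow> (\<exists>d\<in>Q. d \<in> X)"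
    using countable_dense_exists by blast
  \<comment> \<open>Countably many neighbourhoods with centres in a countable dense set: almost
    every \<open>p\<close> in \<open>K\<close> returns to each of them that contains
    \<open>p\<close>, and some of these are arbitrarily small.\<close>
  let ?A = "\<lambda>(c, k). {p \<in> space ?M. \<forall>v\<in>V. norm (p v - c v) < 1 / real (Suc k)}"
  let ?I = "(\<Pi>\<^sub>E v\<in>V. Q) \<times> (UNIV :: nat set)"
  have "countable ?I"
    using V Q(1) by (intro countable_SIGMA countable_PiE) auto
  then have "AE p in ?M. \<forall>i\<in>?I. p \<in> ?A i \<inter> K \<longrightarrow> (\<exists>n>0. (fold_twice ^^ n) p \<in> ?A i)"
  proof (rule AE_ball_countable[THEN iffD2], intro ballI)
    fix i assume "i \<in> ?I"
    obtain c k where i: "i = (c, k)"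
      by (cases i)
    have "{p \<in> space ?M. \<forall>v\<in>V. norm (p v - c v) < 1 / real (Suc k)} \<in> sets ?M"
      using V by measurable
    then show "AE p in ?M. p \<in> ?A i \<inter> K \<longrightarrow> (\<exists>n>0. (fold_twice ^^ n) p \<in> ?A i)"
      unfolding i by (intro AE_recurrent[OF T distr K fin inv]) auto
  qed
  with AE_generic[OF V] have AE: "AE p in ?M. generic_realization V p \<and>
      (\<forall>i\<in>?I. p \<in> ?A i \<inter> K \<longrightarrow> (\<exists>n>0. (fold_twice ^^ n) p \<in> ?A i))"
    by eventually_elim blast
  have "\<exists>p\<in>K. generic_realization V p \<and>
      (\<forall>i\<in>?I. p \<in> ?A i \<inter> K \<longrightarrow> (\<exists>n>0. (fold_twice ^^ n) p \<in> ?A i))"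
  proof (rule ccontr)
    assume neg: "\<not> ?thesis"
    from AE have "AE p in ?M. p \<notin> K"
      by eventually_elim (use neg in blast)
    then have "K \<in> null_sets ?M"
      using K by (simp add: AE_iff_null_sets)
    then show False
      using pos by auto
  qed
  then obtain p where p: "p \<in> K" "generic_realization V p"
    "\<And>i. i \<in> ?I \<Longrightarrow> p \<in> ?A i \<Longrightarrow> \<exists>n>0. (fold_twice ^^ n) p \<in> ?A i"
    by blast
  show ?thesis
  proof (intro exI[of _ p] conjI p(2) allI impI)
    fix \<epsilon> :: real assume \<epsilon>: "\<epsilon> > 0"
    obtain k where k: "1 / real (Suc k) < \<epsilon> / 2"
      using reals_Archimedean[of "\<epsilon> / 2"] \<epsilon> by (auto simp: inverse_eq_divide)
    have "\<exists>d\<in>Q. d \<in> ball (p v) (1 / real (Suc k))" for v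
      using Q(2)[rule_format, OF open_ball, of "p v" "1 / real (Suc k)"] by simp
    then obtain c' where c': "\<And>v. c' v \<in> Q" "\<And>v. c' v \<in> ball (p v) (1 / real (Suc k))"
      by metis
    let ?c = "restrict c' V"
    have "p \<in> ?A (?c, k)"
      using c'(2) p(1) by (auto simp: K_def dist_norm)
    moreover have "(?c, k) \<in> ?I"
      using c'(1) by auto
    ultimately obtain n where n: "n > 0" "(fold_twice ^^ n) p \<in> ?A (?c, k)"
      using p(3) by blast
    have "norm (p v - (fold_twice ^^ n) p v) < \<epsilon>" if "v \<in> V" for v
    proof -
      have "norm (p v - ?c v) < \<epsilon> / 2" "norm ((fold_twice ^^ n) p v - ?c v) < \<epsilon> / 2"
        using \<open>p \<in> ?A (?c, k)\<close> n(2) that k by fastforce+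
      then show ?thesis
        using norm_triangle_ineq4[of "p v - ?c v" "(fold_twice ^^ n) p v - ?c v"] by simp
    qed
    then show "\<exists>n>0. \<forall>v\<in>V. norm (p v - (fold_twice ^^ n) p v) < \<epsilon>"
      using n(1) by blast
  qed
qed

lemma generic_realization_exists:
  assumes "finite V"
  shows "\<exists>p :: 'v \<Rightarrow> real ^ 'd::finite. generic_realization V p"
proof (rule ccontr)
  let ?M = "config_measure V :: ('v \<Rightarrow> real ^ 'd) measure"
  interpret product_sigma_finite "\<lambda>_ :: 'v. lborel :: (real ^ 'd) measure"
    by standard
  assume "\<not> ?thesis"
  then have "AE p in ?M. False"
    using AE_generic[OF assms] by (auto elim: eventually_mono)
  then have "emeasure ?M (space ?M) = 0"
    by (subst (asm) AE_iff_measurable[of "space ?M"]) auto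
  moreover have "emeasure ?M (\<Pi>\<^sub>E v\<in>V. UNIV) = (\<Prod>v\<in>V. emeasure lborel (UNIV :: (real ^ 'd) set))"
    using assms by (subst emeasure_PiM) auto
  ultimately show False
    using assms by (simp add: space_PiM)
qed


section \<open>Families of noncongruent realizations\<close>

lemma congruent_realizations_sym: "congruent_realizations V p q \<Longrightarrow> congruent_realizations V q p"
  by (simp add: congruent_realizations_def)

lemma congruent_realizations_trans:
  "congruent_realizations V p q \<Longrightarrow> congruent_realizations V q r \<Longrightarrow> congruent_realizations V p r"
  by (simp add: congruent_realizations_def)

lemma congruent_realizations_refl [simp]: "congruent_realizations V p p"
  by (simp add: congruent_realizations_def)

lemma equivalent_realizations_trans:
  "equivalent_realizations E p q \<Longrightarrow> equivalent_realizations E q r \<Longrightarrow> equivalent_realizations E p r"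
  by (simp add: equivalent_realizations_def)

lemma equivalent_realizations_refl [simp]: "equivalent_realizations E p p"
  by (simp add: equivalent_realizations_def)

definition noncongruent_family ::
    "'v set \<Rightarrow> 'v set set \<Rightarrow> ('v \<Rightarrow> real ^ 'd) \<Rightarrow> ('v \<Rightarrow> real ^ 'd) set \<Rightarrow> bool" where
  "noncongruent_family V E p Q \<longleftrightarrow>
     finite Q \<and> (\<forall>q\<in>Q. equivalent_realizations E p q) \<and>
     pairwise (\<lambda>q r. \<not> congruent_realizations V q r) Q"

lemma num_realizations_eq:
  "num_realizations V E p = Sup {enat (card Q) | Q. noncongruent_family V E p Q}"
  by (simp add: num_realizations_def noncongruent_family_def)

lemma card_le_num_realizations:
  "noncongruent_family V E p Q \<Longrightarrow> enat (card Q) \<le> num_realizations V E p"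
  unfolding num_realizations_eq by (intro Sup_upper) blast

lemma num_realizations_le:
  "(\<And>Q. noncongruent_family V E p Q \<Longrightarrow> card Q \<le> n) \<Longrightarrow> num_realizations V E p \<le> enat n"
  unfolding num_realizations_eq by (intro Sup_least) auto

lemma num_realizations_infinite:
  assumes "\<And>n. \<exists>Q. noncongruent_family V E p Q \<and> card Q = n"
  shows "num_realizations V E p = \<infinity>"
proof -
  have "enat n \<le> num_realizations V E p" for n
    using assms[of n] card_le_num_realizations by blast
  then show ?thesis
    by (metis enat_ord_simps(1) not_less_eq_eq not_infinity_eq)
qed

lemma noncongruent_family_singleton: "noncongruent_family V E p {p}"
  by (simp add: noncongruent_family_def)

lemma noncongruent_family_insert:
  assumes "noncongruent_family V E p Q" "equivalent_realizations E p r"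
    "\<And>q. q \<in> Q \<Longrightarrow> \<not> congruent_realizations V q r"
  shows "noncongruent_family V E p (insert r Q)" "card (insert r Q) = Suc (card Q)"
proof -
  have "r \<notin> Q"
    using assms(3) by force
  then show "card (insert r Q) = Suc (card Q)"
    using assms(1) by (simp add: noncongruent_family_def)
  show "noncongruent_family V E p (insert r Q)"
    using assms congruent_realizations_sym
    unfolding noncongruent_family_def pairwise_insert by blast
qed

definition locally_rigid_at :: "'v set \<Rightarrow> 'v set set \<Rightarrow> ('v \<Rightarrow> real ^ 'd) \<Rightarrow> bool" where
  "locally_rigid_at V E p \<longleftrightarrow>
     (\<exists>\<epsilon>>0. \<forall>q. equivalent_realizations E p q \<and> (\<forall>x\<in>V. norm (p x - q x) < \<epsilon>) \<longrightarrow>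
               congruent_realizations V p q)"

lemma rigid_iff:
  "rigid TYPE('d::finite) V E \<longleftrightarrow>
     (\<forall>p :: 'v \<Rightarrow> real ^ 'd. generic_realization V p \<longrightarrow> locally_rigid_at V E p)"
  by (simp add: rigid_def locally_rigid_at_def)

text \<open>A distance that differs still differs if both of its ends move by less than half of the
  gap.\<close>

lemma not_congruent_nearby:
  assumes "\<not> congruent_realizations V p q"
  shows "\<exists>\<epsilon>>0. \<forall>r. (\<forall>x\<in>V. norm (p x - r x) < \<epsilon>) \<longrightarrow> \<not> congruent_realizations V q r"
proof -
  obtain x y where xy: "x \<in> V" "y \<in> V" "norm (p x - p y) \<noteq> norm (q x - q y)"
    using assms by (auto simp: congruent_realizations_def)
  let ?\<delta> = "\<bar>norm (p x - p y) - norm (q x - q y)\<bar>"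
  show ?thesis
  proof (intro exI[of _ "?\<delta> / 2"] conjI allI impI notI)
    fix r assume r: "\<forall>x\<in>V. norm (p x - r x) < ?\<delta> / 2" "congruent_realizations V q r"
    then have eq: "norm (q x - q y) = norm (r x - r y)"
      using xy by (simp add: congruent_realizations_def)
    have "\<bar>norm (p x - p y) - norm (r x - r y)\<bar> \<le> norm ((p x - r x) - (p y - r y))"
      using norm_triangle_ineq3[of "p x - p y" "r x - r y"] by (simp add: algebra_simps)
    also have "\<dots> \<le> norm (p x - r x) + norm (p y - r y)"
      by (rule norm_triangle_ineq4)
    also have "\<dots> < ?\<delta> / 2 + ?\<delta> / 2"
      using r(1) xy by (intro add_strict_mono) auto
    finally show False
      by (simp add: eq)
  qed (use xy in auto)
qed

text \<open>Each new realization is chosen so close to \<open>p\<close> that it cannot be congruent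
  to any of the earlier ones. This needs the earlier ones to be noncongruent to \<open>p\<close>
  itself, so the induction carries this along.\<close>

lemma not_locally_rigid_families:
  assumes "\<not> locally_rigid_at V E p"
  shows "\<exists>Q. noncongruent_family V E p Q \<and> card Q = n"
proof -
  have "\<exists>Q. noncongruent_family V E p Q \<and> card Q = n \<and> (\<forall>q\<in>Q. \<not> congruent_realizations V p q)"
  proof (induction n)
    case 0
    show ?case
      by (rule exI[of _ "{}"]) (simp add: noncongruent_family_def)
  next
    case (Suc n)
    then obtain Q where Q: "noncongruent_family V E p Q" "card Q = n"
      "\<And>q. q \<in> Q \<Longrightarrow> \<not> congruent_realizations V p q" by blast
    then have "finite Q"
      by (simp add: noncongruent_family_def)
    then have "\<exists>\<epsilon>>0. \<forall>q\<in>Q. \<forall>r. (\<forall>x\<in>V. norm (p x - r x) < \<epsilon>) \<longrightarrow> \<not> congruent_realizations V q r"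
      using Q(3)
    proof (induction Q rule: finite_induct)
      case empty
      then show ?case
        by (intro exI[of _ 1]) simp
    next
      case (insert q Q)
      obtain \<epsilon> where "\<epsilon> > 0" "\<forall>q\<in>Q. \<forall>r. (\<forall>x\<in>V. norm (p x - r x) < \<epsilon>) \<longrightarrow> \<not> congruent_realizations V q r"
        using insert by blast
      moreover obtain \<epsilon>' where "\<epsilon>' > 0" "\<forall>r. (\<forall>x\<in>V. norm (p x - r x) < \<epsilon>') \<longrightarrow> \<not> congruent_realizations V q r"
        using not_congruent_nearby insert.prems by blast
      ultimately show ?case
        by (intro exI[of _ "min \<epsilon> \<epsilon>'"]) auto
    qed
    then obtain \<epsilon> where \<epsilon>: "\<epsilon> > 0"
      "\<And>q r. q \<in> Q \<Longrightarrow> \<forall>x\<in>V. norm (p x - r x) < \<epsilon> \<Longrightarrow> \<not> congruent_realizations V q r"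
      by blast
    obtain r where r: "equivalent_realizations E p r" "\<forall>x\<in>V. norm (p x - r x) < \<epsilon>"
      "\<not> congruent_realizations V p r"
      using assms \<epsilon>(1) unfolding locally_rigid_at_def by blast
    have "noncongruent_family V E p (insert r Q)" "card (insert r Q) = Suc (card Q)"
      using noncongruent_family_insert[OF Q(1) r(1)] \<epsilon>(2) r(2) by blast+
    then show ?case
      using Q r(3) by (intro exI[of _ "insert r Q"]) auto
  qed
  then show ?thesis by blast
qed

lemma noncongruent_sequence_families:
  fixes r :: "nat \<Rightarrow> 'v \<Rightarrow> real ^ 'd"
  assumes "\<And>n. equivalent_realizations E p (r n)"
    and "\<And>m n. m < n \<Longrightarrow> \<not> congruent_realizations V (r m) (r n)"
  shows "\<exists>Q. noncongruent_family V E p Q \<and> card Q = n"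
proof -
  have neq: "\<not> congruent_realizations V (r i) (r j)" if "i \<noteq> j" for i j
    using assms(2)[of i j] assms(2)[of j i] congruent_realizations_sym[of V "r i" "r j"] that
    by (cases i j rule: linorder_cases) auto
  then have "inj_on r {..<n}"
    by (intro inj_onI) (metis congruent_realizations_refl)
  moreover have "noncongruent_family V E p (r ` {..<n})"
    by (auto simp: noncongruent_family_def assms(1) neq intro!: pairwise_imageI)
  ultimately show ?thesis
    by (intro exI[of _ "r ` {..<n}"]) (simp add: card_image)
qed

section \<open>Flexible realizations\<close>

text \<open>
  Reflecting \<open>A\<close> first in the hyperplane \<open>n0 \<bullet> x = c0\<close> and then in a nearby hyperplane of the
  pencil spanned by the two given hyperplanes yields a small deformation.
\<close>

lemma pencil_not_locally_rigid:
  fixes p :: "'v \<Rightarrow> real ^ 'd::finite"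
  assumes V: "finite V" "a \<in> V" "b \<in> V" and a: "a \<in> A" and b: "b \<notin> A"
    and E: "\<And>x y. {x, y} \<in> E \<Longrightarrow> x \<in> A \<Longrightarrow> y \<in> A \<union> Z"
    and n0: "\<And>z. z \<in> Z \<Longrightarrow> n0 \<bullet> p z = c0" "n0 \<bullet> p b = c0" "n0 \<bullet> p a \<noteq> c0"
    and n1: "\<And>z. z \<in> Z \<Longrightarrow> n1 \<bullet> p z = c1" "n1 \<bullet> p b \<noteq> c1"
  shows "\<not> locally_rigid_at V E p"
proof
  assume "locally_rigid_at V E p"
  then obtain \<epsilon> where \<epsilon>: "\<epsilon> > 0"
    "\<And>q. equivalent_realizations E p q \<Longrightarrow> \<forall>x\<in>V. norm (p x - q x) < \<epsilon> \<Longrightarrow> congruent_realizations V p q"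
    unfolding locally_rigid_at_def by blast
  define n where "n = (\<lambda>\<delta>. n0 + \<delta> *\<^sub>R n1)"
  \<comment> \<open>The foot of the perpendicular from the origin to the hyperplane
    \<open>n \<delta> \<bullet> x = c0 + \<delta> * c1\<close>.\<close>
  define s where "s = (\<lambda>\<delta>. ((c0 + \<delta> * c1) / (n \<delta> \<bullet> n \<delta>)) *\<^sub>R n \<delta>)"
  define q where "q = (\<lambda>\<delta> v. if v \<in> A then reflect (n \<delta>) (s \<delta>) (reflect (n 0) (s 0) (p v)) else p v)"
  have "n 0 \<noteq> 0"
    using n0(2,3) by (auto simp: n_def)
  have n_lim: "(n \<longlongrightarrow> n 0) (at 0)"
    unfolding n_def by (auto intro!: tendsto_eq_intros)
  have s_lim: "(s \<longlongrightarrow> s 0) (at 0)"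
    unfolding s_def using n_lim \<open>n 0 \<noteq> 0\<close> by (auto intro!: tendsto_eq_intros)
  have "(\<lambda>\<delta>. q \<delta> v) \<midarrow>0\<rightarrow> p v" for v
  proof (cases "v \<in> A")
    case True
    have "((\<lambda>\<delta>. reflect (n \<delta>) (s \<delta>) x) \<longlongrightarrow> reflect (n 0) (s 0) x) (at 0)" for x
      unfolding reflect_def using n_lim s_lim \<open>n 0 \<noteq> 0\<close> by (auto intro!: tendsto_intros)
    from this[of "reflect (n 0) (s 0) (p v)"] show ?thesis
      using True by (simp add: q_def)
  qed (simp add: q_def)
  then have "eventually (\<lambda>\<delta>. norm (p v - q \<delta> v) < \<epsilon>) (at 0)" for v
    using \<epsilon>(1) by (simp add: tendsto_iff dist_norm norm_minus_commute)
  then have close: "eventually (\<lambda>\<delta>. \<forall>v\<in>V. norm (p v - q \<delta> v) < \<epsilon>) (at 0)"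
    using V(1) by (simp add: eventually_ball_finite)
  have ns: "n \<delta> \<bullet> (x - s \<delta>) = n \<delta> \<bullet> x - (c0 + \<delta> * c1)" if "n \<delta> \<noteq> 0" for \<delta> x
    using that by (simp add: s_def inner_diff_right)
  let ?a = "reflect (n 0) (s 0) (p a)"
  have "n 0 \<bullet> (?a - s 0) \<noteq> 0"
    unfolding inner_reflect ns[OF \<open>n 0 \<noteq> 0\<close>] using n0(3) by (simp add: n_def)
  moreover have "((\<lambda>\<delta>. n \<delta> \<bullet> (?a - s \<delta>)) \<longlongrightarrow> n 0 \<bullet> (?a - s 0)) (at 0)"
    using n_lim s_lim by (intro tendsto_intros)
  ultimately have "eventually (\<lambda>\<delta>. n \<delta> \<bullet> (?a - s \<delta>) \<noteq> 0) (at 0)"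
    by (intro tendsto_imp_eventually_ne)
  with close eventually_at_ball'[OF zero_less_one, of 0]
  have "eventually (\<lambda>\<delta>. (\<forall>v\<in>V. norm (p v - q \<delta> v) < \<epsilon>) \<and> n \<delta> \<bullet> (?a - s \<delta>) \<noteq> 0 \<and> \<delta> \<noteq> 0) (at (0::real))"
    by eventually_elim auto
  then obtain \<delta> where \<delta>: "\<forall>v\<in>V. norm (p v - q \<delta> v) < \<epsilon>" "n \<delta> \<bullet> (?a - s \<delta>) \<noteq> 0" "\<delta> \<noteq> 0"
    using eventually_happens'[OF at_neq_bot] by blast
  have "n \<delta> \<noteq> 0"
    using \<delta>(2) by auto
  have fix0: "n 0 \<bullet> (p z - s 0) = 0" if "z \<in> Z \<or> z = b" for z
    using that n0 unfolding ns[OF \<open>n 0 \<noteq> 0\<close>] by (auto simp: n_def)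
  have fixd: "n \<delta> \<bullet> (p z - s \<delta>) = 0" if "z \<in> Z" for z
    using that n0 n1 unfolding ns[OF \<open>n \<delta> \<noteq> 0\<close>] by (auto simp: n_def inner_add_left)
  have eqA: "norm (q \<delta> x - q \<delta> y) = norm (p x - p y)" if "x \<in> A" "y \<in> A \<union> Z" for x y
    using that fix0[of y] fixd[of y] by (auto simp: q_def norm_reflect_reflect norm_reflect_fixed)
  have "equivalent_realizations E p (q \<delta>)"
    unfolding equivalent_realizations_def
  proof (intro allI impI)
    fix x y assume xy: "{x, y} \<in> E"
    show "norm (p x - p y) = norm (q \<delta> x - q \<delta> y)"
    proof (cases "x \<in> A \<or> y \<in> A")
      case True
      then show ?thesis
        using E[of x y] E[of y x] xy eqA[of x y] eqA[of y x]
        by (auto simp: norm_minus_commute insert_commute)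
    qed (simp add: q_def)
  qed
  then have "congruent_realizations V p (q \<delta>)"
    using \<epsilon>(2) \<delta>(1) by blast
  \<comment> \<open>The distance between \<open>a\<close> and \<open>b\<close> must have changed:
    \<open>b\<close> lies on the first mirror but not on the second, and the image of
    \<open>a\<close> under the first reflection is off the second mirror.\<close>
  then have "(norm (q \<delta> a - q \<delta> b))\<^sup>2 = (norm (p a - p b))\<^sup>2"
    using V by (simp add: congruent_realizations_def)
  moreover have "(norm (q \<delta> a - q \<delta> b))\<^sup>2 = (norm (p a - p b))\<^sup>2
      + 4 * (n \<delta> \<bullet> (?a - s \<delta>)) * (n \<delta> \<bullet> (p b - s \<delta>)) / (n \<delta> \<bullet> n \<delta>)"
    using a b by (simp add: q_def norm_reflect_diff_square[of "n \<delta>"] norm_reflect_fixed[OF fix0])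
  moreover have "n \<delta> \<bullet> (p b - s \<delta>) \<noteq> 0"
    unfolding ns[OF \<open>n \<delta> \<noteq> 0\<close>] using n0(2) n1(2) \<delta>(3)
    by (simp add: n_def inner_add_left flip: right_diff_distrib)
  ultimately show False
    using \<delta>(2) \<open>n \<delta> \<noteq> 0\<close> by simp
qed

section \<open>Generic hyperplanes and small separators\<close>

lemma obtain_enumeration:
  assumes "finite S" "card S = CARD('d::finite)"
  obtains e :: "'d::finite \<Rightarrow> 'v" where "inj e" "range e = S"
proof -
  obtain e :: "'d \<Rightarrow> 'v" where "bij_betw e UNIV S"
    using finite_same_card_bij[of "UNIV :: 'd set" S] assms by auto
  then show ?thesis
    using that by (auto simp: bij_betw_def)
qed

lemma obtain_superset_card:
  assumes "finite U" "W \<subseteq> U" "card W \<le> k" "k \<le> card U"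
  obtains S where "W \<subseteq> S" "S \<subseteq> U" "card S = k"
proof -
  have "finite W"
    using assms finite_subset by blast
  then have "k - card W \<le> card (U - W)"
    using assms by (simp add: card_Diff_subset)
  then obtain T where T: "T \<subseteq> U - W" "card T = k - card W" "finite T"
    by (rule obtain_subset_with_card_n)
  then have "card (W \<union> T) = k"
    using assms \<open>finite W\<close> by (subst card_Un_disjoint) auto
  then show ?thesis
    using that[of "W \<union> T"] T assms by auto
qed

text \<open>If there are more than \<open>d\<close> vertices, \<open>W\<close> is enlarged to
  exactly \<open>d\<close> vertices other than \<open>a\<close>, and these span the hyperplane.
  Otherwise all points are linearly independent, and a linear system yields a normal with value 1 at
  \<open>a\<close> and 0 at every other vertex.\<close>

lemma generic_hyperplane:
  fixes p :: "'v \<Rightarrow> real ^ 'd::finite"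
  assumes V: "finite V" and p: "generic_realization V p"
    and W: "W \<subseteq> V" "card W \<le> CARD('d)" and a: "a \<in> V - W"
  shows "\<exists>n c. (\<forall>w\<in>W. n \<bullet> p w = c) \<and> n \<bullet> p a \<noteq> c"
proof (cases "card V \<le> CARD('d)")
  case True
  then obtain f :: "'v \<Rightarrow> 'd" where f: "inj_on f V"
    using V card_le_inj[of V "UNIV :: 'd set"] by auto
  \<comment> \<open>Rows that belong to no vertex are filled with unit vectors, so that the matrix
    is the identity at the test configuration \<open>?t\<close>.\<close>
  define M where "M = (\<lambda>p :: 'v \<Rightarrow> real ^ 'd. \<chi> i. if i \<in> f ` V then p (inv_into V f i) else axis i 1)"
  let ?t = "\<lambda>v. axis (f v) 1 :: real ^ 'd"
  have "M ?t = mat 1"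
    by (auto simp: M_def vec_eq_iff mat_def axis_def f_inv_into_f)
  then have "det (M ?t) \<noteq> 0" by simp
  moreover have "regular_at V ?t (\<lambda>p. M p $ i $ j)" for i j
    using regular_vec_at_nth[OF regular_vec_at_axis[of V ?t i]]
    by (cases "i \<in> f ` V") (auto simp: M_def inv_into_into intro!: regular_at_coord)
  ultimately have "det (M p) \<noteq> 0"
    by (intro generic_regular_nonzero[OF p regular_at_det])
  then have "surj ((*v) (M p))"
    by (simp flip: matrix_right_invertible_surjective invertible_right_inverse add: invertible_det_nz)
  then obtain n where n: "M p *v n = axis (f a) 1"
    by (metis surjD)
  have "p v \<bullet> n = (if v = a then 1 else 0)" if "v \<in> V" for v
    using arg_cong[OF n, of "\<lambda>x. x $ f v"] that a f
    by (auto simp: M_def matrix_vector_mul_component axis_def inj_on_eq_iff)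
  then show ?thesis
    using W a by (intro exI[of _ n] exI[of _ 0]) (auto simp: inner_commute)
next
  case False
  have "W \<subseteq> V - {a}" "CARD('d) \<le> card (V - {a})"
    using W a False V by auto
  then obtain S where S: "W \<subseteq> S" "S \<subseteq> V - {a}" "card S = CARD('d)"
    using obtain_superset_card[of "V - {a}" W "CARD('d)"] V W by auto
  have "finite S"
    using S(2) V by (meson finite_Diff finite_subset)
  then obtain e :: "'d \<Rightarrow> 'v" where e: "inj e" "range e = S"
    using obtain_enumeration[OF _ S(3)] by blast
  let ?n = "normal e p"
  have "?n \<bullet> p a \<noteq> ?n \<bullet> p (e base_index)"
    using generic_height_nonzero[OF p e(1), of a] e(2) S a by (auto simp: inner_diff_right)
  moreover have "?n \<bullet> p w = ?n \<bullet> p (e base_index)" if w: "w \<in> W" for w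
  proof -
    obtain i where "w = e i"
      using w S(1) e(2) by blast
    then show ?thesis
      using normal_orthogonal[of e p i] by (simp add: inner_diff_right)
  qed
  ultimately show ?thesis
    by blast
qed

text \<open>As \<open>Z\<close> has fewer than \<open>d\<close> vertices, a hyperplane through
  \<open>Z\<close> can also contain \<open>b\<close> and still avoid \<open>a\<close>, while a
  second one through \<open>Z\<close> avoids \<open>b\<close>. These two span the pencil.\<close>

lemma small_separator_not_locally_rigid:
  fixes p :: "'v \<Rightarrow> real ^ 'd::finite"
  assumes V: "finite V" and p: "generic_realization V p"
    and Z: "Z \<subseteq> V" "card Z < CARD('d)" and A: "A \<subseteq> V" "A \<inter> Z = {}"
    and E: "\<And>x y. {x, y} \<in> E \<Longrightarrow> x \<in> A \<Longrightarrow> y \<in> A \<union> Z"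
    and ab: "a \<in> A" "b \<in> V - A - Z"
  shows "\<not> locally_rigid_at V E p"
proof -
  have "card (insert b Z) \<le> CARD('d)" "card Z \<le> CARD('d)"
    using Z(2) card_insert_le_m1[of "CARD('d)" Z b] by auto
  then obtain n0 c0 n1 c1 where "\<forall>w\<in>insert b Z. n0 \<bullet> p w = c0" "n0 \<bullet> p a \<noteq> c0"
    "\<forall>w\<in>Z. n1 \<bullet> p w = c1" "n1 \<bullet> p b \<noteq> c1"
    using generic_hyperplane[OF V p, of "insert b Z" a] generic_hyperplane[OF V p, of Z b] Z A ab
    by blast
  then show ?thesis
    using V A ab E by (intro pencil_not_locally_rigid[of V a b A E Z n0 p c0 n1 c1]) auto
qed

lemma (in crossing)
  fixes E :: "'v set set" and p :: "'v \<Rightarrow> real ^ 'd"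
  assumes E: "\<And>x y. {x, y} \<in> E \<Longrightarrow> x \<in> B \<Longrightarrow> y \<in> B \<union> range eS"
      "\<And>x y. {x, y} \<in> E \<Longrightarrow> x \<in> D \<Longrightarrow> y \<in> D \<union> range eT"
  shows fold_twice_families:
      "generic_realization V p \<Longrightarrow> \<exists>Q. noncongruent_family V E p Q \<and> card Q = n"
    and crossing_not_rigid:
      "finite V \<Longrightarrow> B \<subseteq> V \<Longrightarrow> D \<subseteq> V \<Longrightarrow> (\<And>v. v \<in> V \<Longrightarrow> (u, v) \<in> (adj_on E V)\<^sup>*) \<Longrightarrow>
        \<not> rigid TYPE('d) V E"
proof -
  have "equivalent_realizations E p (partial_reflection eS B p)"
    "equivalent_realizations E p (partial_reflection eT D p)" for p
    by (rule partial_reflection_equivalent, erule (1) E)+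
  then have "equivalent_realizations E p (fold_twice p)" for p
    unfolding fold_twice_def using equivalent_realizations_trans by blast
  then have equiv: "equivalent_realizations E p ((fold_twice ^^ n) p)" for p n
    by (induction n) (auto intro: equivalent_realizations_trans)
  have "u \<in> V" "w \<in> V"
    using uw eS by auto
  then have noncong: "\<not> congruent_realizations V ((fold_twice ^^ m) p) ((fold_twice ^^ n) p)"
    if "generic_realization V p" "m < n" for p m n
    using generic_fold_twice_neq[OF that] unfolding congruent_realizations_def by blast
  show "\<exists>Q. noncongruent_family V E p Q \<and> card Q = n" if "generic_realization V p"
    using equiv noncong[OF that]
    by (rule noncongruent_sequence_families[of E p "\<lambda>n. (fold_twice ^^ n) p"])
  show "\<not> rigid TYPE('d) V E"
    if prems: "finite V" "B \<subseteq> V" "D \<subseteq> V" "\<And>v. v \<in> V \<Longrightarrow> (u, v) \<in> (adj_on E V)\<^sup>*"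
  proof
    assume rigid: "rigid TYPE('d) V E"
    have "\<exists>p :: 'v \<Rightarrow> real ^ 'd. generic_realization V p \<and>
        (\<forall>\<epsilon>>0. \<exists>n>0. \<forall>v\<in>V. norm (p v - (fold_twice ^^ n) p v) < \<epsilon>)"
      using prems(1-3) E prems(4) by (rule generic_recurrent_exists)
    then obtain p :: "'v \<Rightarrow> real ^ 'd" where p: "generic_realization V p"
      "\<And>\<epsilon>. \<epsilon> > 0 \<Longrightarrow> \<exists>n>0. \<forall>v\<in>V. norm (p v - (fold_twice ^^ n) p v) < \<epsilon>"
      by blast
    then have "locally_rigid_at V E p"
      using rigid by (simp add: rigid_iff)
    then obtain \<epsilon> where \<epsilon>: "\<epsilon> > 0"
      "\<And>q. equivalent_realizations E p q \<and> (\<forall>x\<in>V. norm (p x - q x) < \<epsilon>) \<Longrightarrow> congruent_realizations V p q"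
      unfolding locally_rigid_at_def by metis
    obtain n where "n > 0" "\<forall>v\<in>V. norm (p v - (fold_twice ^^ n) p v) < \<epsilon>"
      using p(2)[OF \<epsilon>(1)] by blast
    then have "n > 0" "congruent_realizations V p ((fold_twice ^^ n) p)"
      using \<epsilon>(2) equiv by simp_all
    then show False
      using noncong[OF p(1), of 0 n] by simp
  qed
qed


section \<open>Separators of size \<open>d\<close>\<close>

abbreviation reach :: "'v set set \<Rightarrow> 'v set \<Rightarrow> ('v \<times> 'v) set" where
  "reach E W \<equiv> (adj_on E W)\<^sup>*"

abbreviation component :: "'v set set \<Rightarrow> 'v set \<Rightarrow> 'v \<Rightarrow> 'v set" where
  "component E W x \<equiv> reach E W `` {x}"

lemma sym_reach: "sym (reach E W)"
  by (rule sym_rtrancl) (auto simp: sym_def adj_on_def insert_commute)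

lemma reach_sym: "(x, y) \<in> reach E W \<Longrightarrow> (y, x) \<in> reach E W"
  using sym_reach by (rule symD)

lemma reach_in: "(x, y) \<in> reach E W \<Longrightarrow> x \<in> W \<Longrightarrow> y \<in> W"
  by (induction rule: rtrancl_induct) (auto simp: adj_on_def)

lemma reach_edge: "{x, y} \<in> E \<Longrightarrow> x \<in> W \<Longrightarrow> y \<in> W \<Longrightarrow> (x, y) \<in> reach E W"
  by (intro r_into_rtrancl) (simp add: adj_on_def)

lemma comp_subset: "x \<in> W \<Longrightarrow> component E W x \<subseteq> W"
  using reach_in by fastforce

lemma comp_eq: "(x, y) \<in> reach E W \<Longrightarrow> component E W x = component E W y"
  using reach_sym rtrancl_trans by fast

lemma reach_avoiding:
  assumes "(x, y) \<in> reach E W" "x \<in> W" "W \<subseteq> V" "component E W x \<inter> S = {}"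
  shows "(x, y) \<in> reach E (V - S)"
  using assms(1)
proof (induction rule: rtrancl_induct)
  case (step y z)
  have "y \<in> component E W x" "z \<in> component E W x"
    using step.hyps by (auto intro: rtrancl_into_rtrancl)
  then have "(y, z) \<in> adj_on E (V - S)"
    using step.hyps(2) assms comp_subset[of x W E] by (auto simp: adj_on_def)
  with step.IH show ?case
    by (rule rtrancl_into_rtrancl)
qed simp

definition separates :: "'v set \<Rightarrow> 'v set set \<Rightarrow> 'v set \<Rightarrow> 'v \<Rightarrow> 'v \<Rightarrow> bool" where
  "separates V E S x y \<longleftrightarrow> x \<in> V - S \<and> y \<in> V - S \<and> (x, y) \<notin> reach E (V - S)"

definition separators :: "nat \<Rightarrow> 'v set \<Rightarrow> 'v set set \<Rightarrow> 'v \<Rightarrow> 'v \<Rightarrow> 'v set set" where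
  "separators d V E x y = {S. S \<subseteq> V \<and> card S = d \<and> separates V E S x y}"

text \<open>Expresses that \<open>A\<close> is a union of components after the removal of
  \<open>Z\<close>, in a form that is evidently inherited by graphs with fewer edges.\<close>

definition closed_up_to :: "'v set set \<Rightarrow> 'v set \<Rightarrow> 'v set \<Rightarrow> bool" where
  "closed_up_to E A Z \<longleftrightarrow> A \<inter> Z = {} \<and> (\<forall>x y. {x, y} \<in> E \<longrightarrow> x \<in> A \<longrightarrow> y \<in> A \<union> Z)"

lemma separates_sym: "separates V E S x y \<Longrightarrow> separates V E S y x"
  unfolding separates_def using reach_sym by fast

lemma separators_sym: "separators d V E x y = separators d V E y x"
  unfolding separators_def
  using separates_sym[of V E _ x y] separates_sym[of V E _ y x] by blast

lemma finite_separators: "finite V \<Longrightarrow> finite (separators d V E x y)"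
  by (rule finite_subset[of _ "Pow V"]) (auto simp: separators_def)

lemma simple_graph_edge: "simple_graph V E \<Longrightarrow> {x, y} \<in> E \<Longrightarrow> x \<in> V \<and> y \<in> V \<and> x \<noteq> y"
  unfolding simple_graph_def by (auto simp: doubleton_eq_iff)

lemma closed_up_to_comp:
  assumes "simple_graph V E" "x \<in> V - S"
  shows "closed_up_to E (component E (V - S) x) S"
  unfolding closed_up_to_def
proof (intro conjI allI impI)
  show "component E (V - S) x \<inter> S = {}"
    using comp_subset[OF assms(2), of E] by blast
  fix y z assume yz: "{y, z} \<in> E" "y \<in> component E (V - S) x"
  then have "z \<in> V" "y \<in> V - S"
    using simple_graph_edge[OF assms(1)] comp_subset[OF assms(2), of E] by blast+
  then show "z \<in> component E (V - S) x \<union> S"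
    using yz by (auto intro: rtrancl_trans reach_edge)
qed

text \<open>A rigid graph with more than \<open>d\<close> vertices has no separations of the following two kinds.\<close>

definition small_separation :: "nat \<Rightarrow> 'v set \<Rightarrow> 'v set set \<Rightarrow> bool" where
  "small_separation d V E \<longleftrightarrow>
     (\<exists>Z A. Z \<subseteq> V \<and> card Z < d \<and> A \<subseteq> V \<and> A \<noteq> {} \<and> V - A - Z \<noteq> {} \<and> closed_up_to E A Z)"

definition crossing_separations :: "nat \<Rightarrow> 'v set \<Rightarrow> 'v set set \<Rightarrow> bool" where
  "crossing_separations d V E \<longleftrightarrow>
     (\<exists>S T B D. S \<subseteq> V \<and> T \<subseteq> V \<and> card S = d \<and> card T = d \<and> B \<subseteq> V \<and> D \<subseteq> V \<and>
        closed_up_to E B S \<and> closed_up_to E D T \<and>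
        (S - T) - D \<noteq> {} \<and> S \<inter> D \<noteq> {} \<and> (T - S) - B \<noteq> {} \<and> T \<inter> B \<noteq> {})"

lemma closed_up_to_mono: "E \<subseteq> E' \<Longrightarrow> closed_up_to E' A Z \<Longrightarrow> closed_up_to E A Z"
  by (auto simp: closed_up_to_def)

lemma small_separation_mono: "E \<subseteq> E' \<Longrightarrow> small_separation d V E' \<Longrightarrow> small_separation d V E"
  unfolding small_separation_def using closed_up_to_mono by metis

lemma crossing_separations_mono:
  "E \<subseteq> E' \<Longrightarrow> crossing_separations d V E' \<Longrightarrow> crossing_separations d V E"
  unfolding crossing_separations_def using closed_up_to_mono by metis

lemma reach_of_not_small_separation:
  assumes V: "simple_graph V E" "card V \<ge> d + 1" "d \<ge> 1" and "\<not> small_separation d V E"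
    and x: "x \<in> V" and y: "y \<in> V"
  shows "(x, y) \<in> reach E V"
proof (rule ccontr)
  assume *: "(x, y) \<notin> reach E V"
  then have "x \<noteq> y" by auto
  have fin: "finite V"
    using V(1) by (simp add: simple_graph_def)
  then have "card (V - {x, y}) = card V - 2"
    using x y \<open>x \<noteq> y\<close> by (simp add: card_Diff_subset)
  then have "d - 1 \<le> card (V - {x, y})"
    using V(2) by simp
  then obtain Z where Z: "Z \<subseteq> V - {x, y}" "card Z = d - 1"
    by (rule obtain_subset_with_card_n)
  let ?A = "component E V x"
  have "closed_up_to E ?A {}" "?A \<subseteq> V"
    using closed_up_to_comp[OF V(1), of x "{}"] comp_subset[OF x, of E] x by simp_all
  then have "closed_up_to E (?A - Z) Z" "?A - Z \<subseteq> V"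
    by (auto simp: closed_up_to_def)
  moreover have "x \<in> ?A - Z" "y \<in> V - (?A - Z) - Z"
    using x y Z * by auto
  moreover have "Z \<subseteq> V" "card Z < d"
    using Z V(3) by auto
  ultimately show False
    using assms(4) unfolding small_separation_def by blast
qed

lemma not_rigid_families:
  fixes p :: "'v \<Rightarrow> real ^ 'd::finite"
  assumes V: "simple_graph V E" and p: "generic_realization V p"
    and sep: "small_separation CARD('d) V E \<or> crossing_separations CARD('d) V E"
  shows "\<exists>Q. noncongruent_family V E p Q \<and> card Q = n"
  using sep
proof
  assume "small_separation CARD('d) V E"
  then obtain Z A a b where "Z \<subseteq> V" "card Z < CARD('d)" "A \<subseteq> V" "closed_up_to E A Z"
    "a \<in> A" "b \<in> V - A - Z"
    unfolding small_separation_def by blast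
  then have "\<not> locally_rigid_at V E p"
    using V by (intro small_separator_not_locally_rigid[OF _ p, of Z A E a b])
      (auto simp: closed_up_to_def simple_graph_def)
  then show ?thesis
    by (rule not_locally_rigid_families)
next
  assume "crossing_separations CARD('d) V E"
  then obtain S T B D where *: "S \<subseteq> V" "T \<subseteq> V" "card S = CARD('d)" "card T = CARD('d)"
    "closed_up_to E B S" "closed_up_to E D T"
    "(S - T) - D \<noteq> {}" "S \<inter> D \<noteq> {}" "(T - S) - B \<noteq> {}" "T \<inter> B \<noteq> {}"
    unfolding crossing_separations_def by blast
  then obtain u w a b where uw: "u \<in> (S - T) - D" "w \<in> S \<inter> D" "a \<in> (T - S) - B" "b \<in> T \<inter> B"
    by blast
  have "finite S" "finite T"
    using V * finite_subset by (auto simp: simple_graph_def)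
  obtain eS :: "'d \<Rightarrow> 'v" where eS: "inj eS" "range eS = S"
    using obtain_enumeration[OF \<open>finite S\<close> *(3)] .
  obtain eT :: "'d \<Rightarrow> 'v" where eT: "inj eT" "range eT = T"
    using obtain_enumeration[OF \<open>finite T\<close> *(4)] .
  note e = eS eT
  have cl: "B \<inter> S = {}" "\<And>x y. {x, y} \<in> E \<Longrightarrow> x \<in> B \<Longrightarrow> y \<in> B \<union> S"
    "D \<inter> T = {}" "\<And>x y. {x, y} \<in> E \<Longrightarrow> x \<in> D \<Longrightarrow> y \<in> D \<union> T"
    using *(5,6) by (auto simp: closed_up_to_def)
  have m: "u \<in> S - T" "w \<in> S - T" "u \<notin> D" "w \<in> D" "a \<in> T - S" "b \<in> T - S" "a \<notin> B" "b \<in> B"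
    using uw cl(1,3) by blast+
  interpret crossing V eS eT B D u w a b
    by unfold_locales (simp_all only: e *(1,2) cl(1,3) m not_False_eq_True)
  show ?thesis
    by (rule fold_twice_families[OF _ _ p]) (simp_all only: e cl(2,4))
qed

lemma rigid_separations:
  fixes V :: "'v set"
  assumes V: "simple_graph V E" "card V \<ge> CARD('d::finite) + 1" and rigid: "rigid TYPE('d) V E"
  shows "\<not> small_separation CARD('d) V E" "\<not> crossing_separations CARD('d) V E"
proof -
  have fin: "finite V"
    using V(1) by (simp add: simple_graph_def)
  show small: "\<not> small_separation CARD('d) V E"
  proof
    assume "small_separation CARD('d) V E"
    then obtain Z A a b where *: "Z \<subseteq> V" "card Z < CARD('d)" "A \<subseteq> V" "closed_up_to E A Z"
      "a \<in> A" "b \<in> V - A - Z"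
      unfolding small_separation_def by blast
    obtain p :: "'v \<Rightarrow> real ^ 'd" where p: "generic_realization V p"
      using generic_realization_exists[OF fin] by blast
    have "\<not> locally_rigid_at V E p"
      using * by (intro small_separator_not_locally_rigid[OF fin p, of Z A E a b])
        (auto simp: closed_up_to_def)
    then show False
      using rigid p by (simp add: rigid_iff)
  qed
  show "\<not> crossing_separations CARD('d) V E"
  proof
    assume "crossing_separations CARD('d) V E"
    then obtain S T B D where *: "S \<subseteq> V" "T \<subseteq> V" "card S = CARD('d)" "card T = CARD('d)"
      "B \<subseteq> V" "D \<subseteq> V" "closed_up_to E B S" "closed_up_to E D T"
      "(S - T) - D \<noteq> {}" "S \<inter> D \<noteq> {}" "(T - S) - B \<noteq> {}" "T \<inter> B \<noteq> {}"
      unfolding crossing_separations_def by blast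
    then obtain u w a b where uw: "u \<in> (S - T) - D" "w \<in> S \<inter> D" "a \<in> (T - S) - B" "b \<in> T \<inter> B"
      by blast
    have "finite S" "finite T"
      using fin * finite_subset by auto
    obtain eS :: "'d \<Rightarrow> 'v" where eS: "inj eS" "range eS = S"
      using obtain_enumeration[OF \<open>finite S\<close> *(3)] .
    obtain eT :: "'d \<Rightarrow> 'v" where eT: "inj eT" "range eT = T"
      using obtain_enumeration[OF \<open>finite T\<close> *(4)] .
    note e = eS eT
    have cl: "B \<inter> S = {}" "\<And>x y. {x, y} \<in> E \<Longrightarrow> x \<in> B \<Longrightarrow> y \<in> B \<union> S"
      "D \<inter> T = {}" "\<And>x y. {x, y} \<in> E \<Longrightarrow> x \<in> D \<Longrightarrow> y \<in> D \<union> T"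
      using *(7,8) by (auto simp: closed_up_to_def)
    have m: "u \<in> S - T" "w \<in> S - T" "u \<notin> D" "w \<in> D" "a \<in> T - S" "b \<in> T - S" "a \<notin> B" "b \<in> B"
      using uw cl(1,3) by blast+
    interpret crossing V eS eT B D u w a b
      by unfold_locales (simp_all only: e *(1,2) cl(1,3) m not_False_eq_True)
    have "u \<in> V"
      using m(1) *(1) by blast
    then have conn: "(u, v) \<in> reach E V" if "v \<in> V" for v
      using that by (intro reach_of_not_small_separation[OF V _ small]) (simp_all add: Suc_le_eq)
    have "\<not> rigid TYPE('d) V E"
      by (rule crossing_not_rigid) (simp_all only: e cl(2,4) fin *(5,6) conn)
    then show False
      using rigid by simp
  qed
qed

section \<open>Separators of size \<open>d\<close> do not cross\<close>

locale separated_graph =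
  fixes d :: nat and V :: "'v set" and E :: "'v set set"
  assumes simple: "simple_graph V E" and d: "d \<ge> 1" and card_V: "card V \<ge> d + 1"
    and no_small: "\<not> small_separation d V E" and no_crossing: "\<not> crossing_separations d V E"
begin

lemma finite_V: "finite V"
  using simple by (simp add: simple_graph_def)

text \<open>Otherwise \<open>T - {t}\<close>, which has fewer than \<open>d\<close> vertices, would
  already separate the component from \<open>t\<close>.\<close>

lemma full_neighbourhood:
  assumes T: "T \<subseteq> V" "card T = d" "t \<in> T" and x: "x \<in> V - T"
  obtains v where "v \<in> component E (V - T) x" "{t, v} \<in> E"
proof (rule ccontr)
  let ?A = "component E (V - T) x"
  assume "\<not> thesis"
  with that have no: "{t, v} \<notin> E" if "v \<in> ?A" for v
    using \<open>v \<in> ?A\<close> by blast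
  have "finite T"
    using T finite_V finite_subset by blast
  then have "card (T - {t}) < d"
    using T card_Diff1_less by metis
  moreover have "closed_up_to E ?A (T - {t})"
    using closed_up_to_comp[OF simple x] no unfolding closed_up_to_def
    by (auto simp: insert_commute)
  moreover have "?A \<subseteq> V" "x \<in> ?A" "t \<in> V - ?A - (T - {t})"
    using comp_subset[OF x, of E] x T by auto
  ultimately show False
    using no_small T unfolding small_separation_def by blast
qed

text \<open>Walk inside the component of \<open>x\<close> to a neighbour of \<open>t\<close>, then
  step to \<open>t\<close>.\<close>

lemma reach_via_component:
  assumes T: "T \<subseteq> V" "card T = d" "t \<in> T" and x: "x \<in> V - T"
    and S: "component E (V - T) x \<inter> S = {}" "t \<notin> S"
  shows "(x, t) \<in> reach E (V - S)"
proof -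
  obtain v where v: "v \<in> component E (V - T) x" "{t, v} \<in> E"
    using full_neighbourhood[OF T x] .
  then have "(x, v) \<in> reach E (V - S)"
    using x S(1) by (intro reach_avoiding) auto
  moreover have "v \<in> V - S"
    using v S comp_subset[OF x, of E] by blast
  then have "(v, t) \<in> reach E (V - S)"
    using v(2) T S by (intro reach_edge) (auto simp: insert_commute)
  ultimately show ?thesis
    by (rule rtrancl_trans)
qed

text \<open>A component of \<open>G - T\<close> that avoids \<open>S\<close> would connect
  \<open>t\<close> and \<open>t'\<close>, since both have neighbours in it. So if \<open>S\<close>
  separates them, it meets every component of \<open>G - T\<close>; then \<open>T\<close> separates
  vertices of \<open>S\<close> in turn, and the separations cross.\<close>

lemma separators_do_not_cross:
  assumes T: "T \<in> separators d V E x y" and S: "S \<subseteq> V" "card S = d" and t: "t \<in> T - S" "t' \<in> T - S"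
  shows "(t, t') \<in> reach E (V - S)"
proof (rule ccontr)
  assume *: "(t, t') \<notin> reach E (V - S)"
  have T': "T \<subseteq> V" "card T = d" "x \<in> V - T" "y \<in> V - T" "(x, y) \<notin> reach E (V - T)"
    using T by (auto simp: separators_def separates_def)
  have meet: "component E (V - T) z \<inter> S \<noteq> {}" if "z \<in> V - T" for z
  proof
    assume "component E (V - T) z \<inter> S = {}"
    then have "(z, t) \<in> reach E (V - S)" "(z, t') \<in> reach E (V - S)"
      using reach_via_component[OF T'(1,2) _ that] t by auto
    then show False
      using * reach_sym rtrancl_trans by fast
  qed
  obtain u w where uw: "u \<in> component E (V - T) x" "u \<in> S" "w \<in> component E (V - T) y" "w \<in> S"
    using meet T'(3,4) by blast
  have "u \<notin> T"
    using uw comp_subset[OF T'(3), of E] by blast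
  moreover have "u \<notin> component E (V - T) y"
    using uw(1) T'(5) reach_sym rtrancl_trans by fast
  moreover have "t' \<in> component E (V - S) t'" "t \<notin> component E (V - S) t'"
    using * reach_sym by fast+
  moreover have "t' \<in> V - S"
    using t T' by blast
  ultimately have ne: "(S - T) - component E (V - T) y \<noteq> {}" "S \<inter> component E (V - T) y \<noteq> {}"
    "(T - S) - component E (V - S) t' \<noteq> {}" "T \<inter> component E (V - S) t' \<noteq> {}"
    using uw t by blast+
  have sub: "component E (V - S) t' \<subseteq> V" "component E (V - T) y \<subseteq> V"
    using comp_subset[OF T'(4), of E] comp_subset[OF \<open>t' \<in> V - S\<close>, of E] by blast+
  have "crossing_separations d V E"
    unfolding crossing_separations_def
    by (intro exI[of _ S] exI[of _ T] exI[of _ "component E (V - S) t'"] exI[of _ "component E (V - T) y"] conjI)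
      (fact S T' sub ne closed_up_to_comp[OF simple T'(4)] closed_up_to_comp[OF simple \<open>t' \<in> V - S\<close>])+
  then show False
    using no_crossing by simp
qed

text \<open>By the absence of crossings, \<open>T - S\<close> lies within a single component of
  \<open>G - S\<close>.\<close>

lemma separator_one_side:
  assumes T: "T \<in> separators d V E x' y'" and S: "S \<in> separators d V E x y"
    and t: "t \<in> T" "t \<in> component E (V - S) y"
  shows "T \<inter> component E (V - S) x = {}"
proof (rule ccontr)
  have S': "S \<subseteq> V" "card S = d" "x \<in> V - S" "y \<in> V - S" "(x, y) \<notin> reach E (V - S)"
    using S by (auto simp: separators_def separates_def)
  assume "T \<inter> component E (V - S) x \<noteq> {}"
  then obtain t' where t': "t' \<in> T" "(x, t') \<in> reach E (V - S)"
    by blast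
  then have "t' \<in> V - S" "t \<in> V - S"
    using S'(3,4) t(2) reach_in[of x t'] reach_in[of y t] by auto
  then have "(t, t') \<in> reach E (V - S)"
    using separators_do_not_cross[OF T S'(1,2)] t(1) t'(1) by blast
  moreover have "(t', x) \<in> reach E (V - S)"
    using t'(2) by (rule reach_sym)
  ultimately have "(y, x) \<in> reach E (V - S)"
    using t(2) by (auto intro: rtrancl_trans)
  then show False
    using S'(5) reach_sym by fast
qed

text \<open>Replace \<open>y\<close> by a vertex \<open>z\<close> of \<open>T - S\<close>. Then
  \<open>S\<close> remains, because \<open>T\<close> misses the component of \<open>x\<close> in
  \<open>G - S\<close>, and \<open>T\<close> is lost. A separator \<open>R\<close> of
  \<open>x\<close> and \<open>z\<close> must meet the component of \<open>x\<close> in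
  \<open>G - T\<close>, so it misses that of \<open>y\<close>. Hence \<open>y\<close> stays
  connected to \<open>z\<close>, and \<open>R\<close> separates \<open>x\<close> from
  \<open>y\<close> as well.\<close>

lemma fewer_separators:
  assumes S: "S \<in> separators d V E x y" and T: "T \<in> separators d V E x y" and "S \<noteq> T"
    and disj: "T \<inter> component E (V - S) x = {}"
  obtains z where "S \<in> separators d V E x z" "separators d V E x z \<subset> separators d V E x y"
proof -
  have S': "S \<subseteq> V" "card S = d" "x \<in> V - S" "y \<in> V - S" "(x, y) \<notin> reach E (V - S)"
    using S by (auto simp: separators_def separates_def)
  have T': "T \<subseteq> V" "card T = d" "x \<in> V - T" "y \<in> V - T" "(x, y) \<notin> reach E (V - T)"
    using T by (auto simp: separators_def separates_def)
  have "finite S"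
    using S' finite_V finite_subset by blast
  then have "\<not> T \<subseteq> S"
    using S' T' \<open>S \<noteq> T\<close> card_subset_eq by metis
  then obtain z where z: "z \<in> T" "z \<notin> S" by blast
  have 1: "S \<in> separators d V E x z"
    using S' T' z disj unfolding separators_def separates_def by blast
  have 2: "T \<notin> separators d V E x z"
    using z by (simp add: separators_def separates_def)
  have "R \<in> separators d V E x y" if R: "R \<in> separators d V E x z" for R
  proof -
    have R': "R \<subseteq> V" "card R = d" "x \<in> V - R" "z \<in> V - R" "(x, z) \<notin> reach E (V - R)"
      using R by (auto simp: separators_def separates_def)
    have "R \<inter> component E (V - T) y = {}"
    proof (rule ccontr)
      assume "R \<inter> component E (V - T) y \<noteq> {}"
      then have "R \<inter> component E (V - T) x = {}"
        using separator_one_side[OF R T] by blast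
      then have "(x, z) \<in> reach E (V - R)"
        using reach_via_component[OF T'(1,2) z(1) T'(3), of R] R'(4) by blast
      then show False
        using R'(5) by simp
    qed
    then have yz: "(y, z) \<in> reach E (V - R)" and "y \<notin> R"
      using reach_via_component[OF T'(1,2) z(1) T'(4), of R] R'(4) by blast+
    have "(x, y) \<notin> reach E (V - R)"
      using yz R'(5) by (auto intro: rtrancl_trans)
    then show ?thesis
      using R' T'(4) \<open>y \<notin> R\<close> by (simp add: separators_def separates_def)
  qed
  with 1 2 T show ?thesis
    by (intro that[of z]) auto
qed

text \<open>In a minimal pair, a second separator would miss the component of one of the two
  vertices in the complement of the first. Then \<open>fewer_separators\<close>, applied with
  \<open>x\<close> and \<open>y\<close> possibly exchanged, contradicts minimality.\<close>

lemma unique_separator_exists: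
  assumes "S \<in> separators d V E x y"
  obtains x' y' S' where "separators d V E x' y' = {S'}"
proof -
  let ?P = "\<lambda>(x, y). separators d V E x y \<noteq> {}"
  obtain xy where "?P xy" and min: "\<And>xy'. ?P xy' \<Longrightarrow>
      card (case xy of (x, y) \<Rightarrow> separators d V E x y) \<le> card (case xy' of (x, y) \<Rightarrow> separators d V E x y)"
    using ex_has_least_nat[of ?P "(x, y)" "\<lambda>xy. card (case xy of (x, y) \<Rightarrow> separators d V E x y)"] assms
    by blast
  then obtain x y S where S: "S \<in> separators d V E x y"
    and min: "\<And>x' y'. separators d V E x' y' \<noteq> {} \<Longrightarrow> card (separators d V E x y) \<le> card (separators d V E x' y')"
    by (cases xy) force
  have "T = S" if T: "T \<in> separators d V E x y" for T
  proof (rule ccontr)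
    assume "T \<noteq> S"
    have no: False if "S \<in> separators d V E x' z" "separators d V E x' z \<subset> separators d V E x y" for x' z
      using min[of x' z] that psubset_card_mono[OF finite_separators[OF finite_V] that(2)] by auto
    have "T \<inter> component E (V - S) x = {} \<or> T \<inter> component E (V - S) y = {}"
      using separator_one_side[OF T S] by blast
    then show False
    proof
      assume "T \<inter> component E (V - S) x = {}"
      then show False
        using fewer_separators[OF S T] \<open>T \<noteq> S\<close> no by metis
    next
      assume "T \<inter> component E (V - S) y = {}"
      then show False
        using fewer_separators[of S y x T] S T \<open>T \<noteq> S\<close> no separators_sym[of d V E x y] by metis
    qed
  qed
  then have "separators d V E x y = {S}"
    using S by blast
  then show ?thesis
    by (rule that)
qed

lemma separated_graph_supergraph: "E \<subseteq> E' \<Longrightarrow> simple_graph V E' \<Longrightarrow> separated_graph d V E'"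
  using d card_V no_small no_crossing small_separation_mono crossing_separations_mono
  by unfold_locales blast+

end

section \<open>Adding edges\<close>

lemma reach_add_edges:
  assumes "E \<subseteq> E'" "\<And>u v. {u, v} \<in> E' - E \<Longrightarrow> u \<in> V - R \<Longrightarrow> v \<in> V - R \<Longrightarrow> (u, v) \<in> reach E (V - R)"
  shows "reach E' (V - R) = reach E (V - R)"
proof (rule rtrancl_subset)
  show "adj_on E (V - R) \<subseteq> adj_on E' (V - R)"
    using assms(1) by (auto simp: adj_on_def)
  show "adj_on E' (V - R) \<subseteq> reach E (V - R)"
  proof
    fix e assume "e \<in> adj_on E' (V - R)"
    then obtain u v where "e = (u, v)" "{u, v} \<in> E'" "u \<in> V - R" "v \<in> V - R"
      by (auto simp: adj_on_def)
    then show "e \<in> reach E (V - R)"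
      using assms(2)[of u v] reach_edge[of u v E "V - R"] by blast
  qed
qed

lemma num_components_pos:
  assumes "finite V" "S \<subseteq> V" "card S < card V"
  shows "num_components_minus V E S \<ge> 1"
proof -
  have "V - S \<noteq> {}"
    using assms(2,3) by auto
  then have "(V - S) // reach E (V - S) \<noteq> {}"
    by (simp add: quotient_is_empty)
  moreover have "finite ((V - S) // reach E (V - S))"
    unfolding quotient_def using assms by simp
  ultimately show ?thesis
    unfolding num_components_minus_def by (metis card_gt_0_iff One_nat_def Suc_leI)
qed

lemma num_components_connected:
  assumes "x \<in> V - S" "\<And>y. y \<in> V - S \<Longrightarrow> (x, y) \<in> reach E (V - S)"
  shows "num_components_minus V E S = 1"
proof -
  have "component E (V - S) y = component E (V - S) x" if "y \<in> V - S" for y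
    using comp_eq[OF assms(2)[OF that]] by simp
  then have "(V - S) // reach E (V - S) = (\<Union>y\<in>V - S. {component E (V - S) x})"
    unfolding quotient_def by (intro SUP_cong) auto
  also have "\<dots> = {component E (V - S) x}"
    using assms(1) by blast
  finally have "(V - S) // reach E (V - S) = {component E (V - S) x}" .
  then show ?thesis
    by (simp add: num_components_minus_def)
qed

text \<open>All new edges run between the components of \<open>x\<close> and \<open>y\<close>, so
  these two become one and the others stay as they are.\<close>

lemma num_components_merge:
  assumes V: "finite V" and sep: "separates V E S x y"
    and E': "E \<subseteq> E'" "\<And>u v. {u, v} \<in> E' - E \<Longrightarrow>
        u \<in> component E (V - S) x \<and> v \<in> component E (V - S) y \<or> v \<in> component E (V - S) x \<and> u \<in> component E (V - S) y"
    and ne: "{x, y} \<in> E'"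
  shows "int (num_components_minus V E' S) = int (num_components_minus V E S) - 1"
proof -
  let ?W = "V - S"
  let ?C = "component E ?W" and ?C' = "component E' ?W"
  have xy: "x \<in> ?W" "y \<in> ?W" "(x, y) \<notin> reach E ?W"
    using sep by (auto simp: separates_def)
  have mono: "reach E ?W \<subseteq> reach E' ?W"
    by (rule rtrancl_mono) (use E'(1) in \<open>auto simp: adj_on_def\<close>)
  have xy': "(x, y) \<in> reach E' ?W"
    using ne xy by (intro reach_edge)
  have merged: "?C' z = ?C x \<union> ?C y" if "z \<in> ?C x \<union> ?C y" for z
  proof -
    have "?C' z = ?C' x"
      using that mono xy' comp_eq[of x z E' ?W] comp_eq[of y z E' ?W] comp_eq[OF xy'] by blast
    moreover have "w \<in> ?C x \<union> ?C y" if "(x, w) \<in> reach E' ?W" for w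
      using that
    proof (induction rule: rtrancl_induct)
      case (step v w)
      then have vw: "v \<in> ?W" "w \<in> ?W" "{v, w} \<in> E'"
        by (auto simp: adj_on_def)
      show ?case
      proof (cases "{v, w} \<in> E")
        case True
        then have "(v, w) \<in> reach E ?W"
          using vw by (intro reach_edge)
        then show ?thesis
          using step.IH by (auto intro: rtrancl_trans)
      next
        case False
        then show ?thesis
          using E'(2)[of v w] vw by blast
      qed
    qed simp
    moreover have "?C x \<union> ?C y \<subseteq> ?C' x"
      using mono xy' by (auto intro: rtrancl_trans)
    ultimately show ?thesis
      by blast
  qed
  have other: "?C' z = ?C z" if z: "z \<in> ?W" "z \<notin> ?C x \<union> ?C y" for z
  proof -
    have "w \<in> ?C z" if "(z, w) \<in> reach E' ?W" for w
      using that
    proof (induction rule: rtrancl_induct)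
      case (step v w)
      then have vw: "v \<in> ?W" "w \<in> ?W" "{v, w} \<in> E'"
        by (auto simp: adj_on_def)
      have "v \<notin> ?C x \<union> ?C y"
        using step.IH z(2) reach_sym rtrancl_trans by fast
      then have "{v, w} \<in> E"
        using E'(2)[of v w] vw(3) by blast
      then have "(v, w) \<in> reach E ?W"
        using vw by (intro reach_edge)
      then show ?case
        using step.IH by (auto intro: rtrancl_trans)
    qed simp
    then show ?thesis
      using mono by blast
  qed
  let ?Q = "?W // reach E ?W" and ?Q' = "?W // reach E' ?W"
  have Q_mem: "?C z \<in> ?Q" if "z \<in> ?W" for z
    using that by (rule quotientI)
  have "?Q' = insert (?C x \<union> ?C y) (?Q - {?C x, ?C y})"
  proof (intro set_eqI iffI)
    fix X assume "X \<in> ?Q'"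
    then obtain z where z: "z \<in> ?W" "X = ?C' z"
      by (auto simp: quotient_def)
    show "X \<in> insert (?C x \<union> ?C y) (?Q - {?C x, ?C y})"
    proof (cases "z \<in> ?C x \<union> ?C y")
      case False
      then have "?C z \<noteq> ?C x" "?C z \<noteq> ?C y"
        by blast+
      then show ?thesis
        using other[OF z(1) False] z Q_mem[OF z(1)] by simp
    qed (use merged z in simp)
  next
    fix X assume X: "X \<in> insert (?C x \<union> ?C y) (?Q - {?C x, ?C y})"
    show "X \<in> ?Q'"
    proof (cases "X = ?C x \<union> ?C y")
      case True
      then show ?thesis
        using merged[of x] xy quotientI[of x ?W "reach E' ?W"] by auto
    next
      case False
      then obtain z where z: "z \<in> ?W" "X = ?C z" "?C z \<noteq> ?C x" "?C z \<noteq> ?C y"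
        using X by (auto simp: quotient_def)
      then have "z \<notin> ?C x \<union> ?C y"
        using comp_eq[of x z E ?W] comp_eq[of y z E ?W] by blast
      then show ?thesis
        using other z quotientI[of z ?W "reach E' ?W"] by auto
    qed
  qed
  moreover have "?C x \<union> ?C y \<notin> ?Q - {?C x, ?C y}"
  proof
    assume "?C x \<union> ?C y \<in> ?Q - {?C x, ?C y}"
    then obtain z where "?C x \<union> ?C y = ?C z"
      by (auto simp: quotient_def)
    then have "(z, x) \<in> reach E ?W" "(z, y) \<in> reach E ?W"
      by blast+
    then show False
      using xy(3) reach_sym rtrancl_trans by fast
  qed
  moreover have fin: "finite ?Q"
    unfolding quotient_def using V by simp
  moreover have "?C x \<noteq> ?C y"
    using xy(3) by blast
  then have "card (?Q - {?C x, ?C y}) = card ?Q - 2" "card {?C x, ?C y} = 2"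
    using Q_mem xy by (simp_all add: card_Diff_subset)
  moreover have "card {?C x, ?C y} \<le> card ?Q"
    using Q_mem xy fin by (intro card_mono) auto
  ultimately show ?thesis
    by (simp add: num_components_minus_def)
qed

section \<open>The separator count under added edges\<close>

lemma finite_subsets_card: "finite V \<Longrightarrow> finite {S. S \<subseteq> V \<and> card S = d}"
  by (rule finite_subset[of _ "Pow V"]) auto

lemma separator_count_nonneg:
  assumes "finite V" "card V \<ge> d + 1"
  shows "separator_count d V E \<ge> 0"
  unfolding separator_count_def
proof (rule sum_nonneg)
  fix S assume "S \<in> {S. S \<subseteq> V \<and> card S = d}"
  then have "num_components_minus V E S \<ge> 1"
    using assms by (intro num_components_pos) auto
  then show "int (num_components_minus V E S) - 1 \<ge> 0"
    by simp
qed

lemma separator_count_add_edges: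
  assumes "E \<subseteq> E'" "\<And>u v. {u, v} \<in> E' - E \<Longrightarrow> separators d V E u v = {}"
  shows "separator_count d V E' = separator_count d V E"
proof -
  have "reach E' (V - S) = reach E (V - S)" if "S \<subseteq> V" "card S = d" for S
    using assms that unfolding separators_def separates_def by (intro reach_add_edges) blast+
  then show ?thesis
    unfolding separator_count_def num_components_minus_def by (intro sum.cong) auto
qed

lemma separator_count_zero:
  assumes "finite V" "card V \<ge> d + 1" "\<And>x y. separators d V E x y = {}"
  shows "separator_count d V E = 0"
  unfolding separator_count_def
proof (intro sum.neutral ballI)
  fix S assume S: "S \<in> {S. S \<subseteq> V \<and> card S = d}"
  then have "V - S \<noteq> {}"
    using assms(2) by auto
  then obtain x where x: "x \<in> V - S" by blast
  have "num_components_minus V E S = 1"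
    using x S assms(3) unfolding separators_def separates_def
    by (intro num_components_connected[OF x]) blast
  then show "int (num_components_minus V E S) - 1 = 0"
    by simp
qed

text \<open>Since \<open>S\<close> is the only separator of the ends of such an edge, the components
  of \<open>G - R\<close> do not change for any other \<open>R\<close> of size
  \<open>d\<close>.\<close>

definition merging_edges :: "nat \<Rightarrow> 'v set \<Rightarrow> 'v set set \<Rightarrow> 'v set \<Rightarrow> 'v \<Rightarrow> 'v \<Rightarrow> 'v set set" where
  "merging_edges d V E S x y =
     {{u, v} | u v. u \<in> component E (V - S) x \<and> v \<in> component E (V - S) y \<and> separators d V E u v = {S}}"

lemma merging_edgesD:
  assumes "{u, v} \<in> merging_edges d V E S x y"
  shows "separators d V E u v = {S}"
    "u \<in> component E (V - S) x \<and> v \<in> component E (V - S) y \<or> v \<in> component E (V - S) x \<and> u \<in> component E (V - S) y"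
  using assms separators_sym[of d V E u v] by (auto simp: merging_edges_def doubleton_eq_iff)

lemma separator_count_merging_edges:
  assumes V: "finite V" and S: "separators d V E x y = {S}"
  shows "separator_count d V (E \<union> merging_edges d V E S x y) = separator_count d V E - 1"
proof -
  let ?F = "merging_edges d V E S x y"
  let ?I = "{S. S \<subseteq> V \<and> card S = d}"
  have S': "S \<in> ?I" "separates V E S x y"
    using S by (auto simp: separators_def)
  have "{x, y} \<in> ?F"
    using S by (auto simp: merging_edges_def)
  have "int (num_components_minus V (E \<union> ?F) S) = int (num_components_minus V E S) - 1"
  proof (rule num_components_merge[OF V S'(2)])
    fix u v assume "{u, v} \<in> E \<union> ?F - E"
    then have "{u, v} \<in> ?F" by blast
    then show "u \<in> component E (V - S) x \<and> v \<in> component E (V - S) y \<or>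
        v \<in> component E (V - S) x \<and> u \<in> component E (V - S) y"
      by (rule merging_edgesD(2))
  qed (use \<open>{x, y} \<in> ?F\<close> in simp_all)
  moreover have "num_components_minus V (E \<union> ?F) R = num_components_minus V E R" if R: "R \<in> ?I - {S}" for R
  proof -
    have "reach (E \<union> ?F) (V - R) = reach E (V - R)"
    proof (rule reach_add_edges)
      fix u v assume uv: "{u, v} \<in> E \<union> ?F - E" "u \<in> V - R" "v \<in> V - R"
      then have "R \<notin> separators d V E u v"
        using merging_edgesD(1)[of u v d V E S x y] R by auto
      then show "(u, v) \<in> reach E (V - R)"
        using R uv(2,3) by (auto simp: separators_def separates_def)
    qed simp
    then show ?thesis
      by (simp add: num_components_minus_def)
  qed
  ultimately show ?thesis
    unfolding separator_count_def
    using S'(1) finite_subsets_card[OF V, of d] by (simp add: sum.remove[of ?I S])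
qed


section \<open>Menger's theorem\<close>

lemma reach_mono: "E \<subseteq> E' \<Longrightarrow> W \<subseteq> W' \<Longrightarrow> reach E W \<subseteq> reach E' W'"
  by (rule rtrancl_mono) (auto simp: adj_on_def)

lemma reach_last_edge:
  assumes "(a, s) \<in> reach E W" "a \<noteq> s" "a \<in> W"
  obtains z where "(a, z) \<in> reach E (W - {s})" "{z, s} \<in> E" "z \<in> W - {s}"
proof -
  have "(z \<noteq> s \<and> (a, z) \<in> reach E (W - {s})) \<or>
      (\<exists>z. (a, z) \<in> reach E (W - {s}) \<and> {z, s} \<in> E \<and> z \<in> W - {s})"
    if "(a, z) \<in> reach E W" for z
    using that
  proof (induction rule: rtrancl_induct)
    case (step z z')
    then have e: "{z, z'} \<in> E" "z \<in> W" "z' \<in> W"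
      by (auto simp: adj_on_def)
    show ?case
    proof (cases "\<exists>z. (a, z) \<in> reach E (W - {s}) \<and> {z, s} \<in> E \<and> z \<in> W - {s}")
      case False
      with step.IH have z: "z \<noteq> s" "(a, z) \<in> reach E (W - {s})"
        by auto
      then have "z' \<noteq> s"
        using e False by blast
      then have "(z, z') \<in> reach E (W - {s})"
        using e z by (intro reach_edge) auto
      then show ?thesis
        using \<open>z' \<noteq> s\<close> z by (auto intro: rtrancl_trans)
    qed simp
  qed (use assms in simp)
  with assms(1) show ?thesis
    using that by blast
qed

lemma reach_in_comp: "(a, z) \<in> reach E W \<Longrightarrow> a \<in> W \<Longrightarrow> (a, z) \<in> reach E (component E W a)"
  using reach_avoiding[of a z E W W "W - component E W a"] comp_subset[of a W E]
  by (simp add: double_diff)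

definition separates_sets :: "'v set \<Rightarrow> 'v set set \<Rightarrow> 'v set \<Rightarrow> 'v set \<Rightarrow> 'v set \<Rightarrow> bool" where
  "separates_sets V E A B X \<longleftrightarrow> (\<forall>a\<in>A - X. \<forall>b\<in>B - X. (a, b) \<notin> reach E (V - X))"

lemma separates_sets_sym: "separates_sets V E A B X \<Longrightarrow> separates_sets V E B A X"
  unfolding separates_sets_def using reach_sym by fast

text \<open>
  A family of disjoint paths is represented by their vertex sets, which may contain additional
  vertices: families of this kind can be joined by taking unions.
\<close>

definition linkage :: "'v set \<Rightarrow> 'v set set \<Rightarrow> 'v set \<Rightarrow> 'v set \<Rightarrow> 'v set set \<Rightarrow> bool" where
  "linkage V E A B L \<longleftrightarrow>
     (\<forall>P\<in>L. P \<subseteq> V \<and> (\<exists>a\<in>A \<inter> P. \<exists>b\<in>B \<inter> P. (a, b) \<in> reach E P)) \<and> pairwise disjnt L"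

lemma linkage_mono:
  assumes "linkage V E A B L" "E \<subseteq> E'"
  shows "linkage V E' A B L"
  unfolding linkage_def
proof (intro conjI ballI)
  fix P assume "P \<in> L"
  then show "P \<subseteq> V" and "\<exists>a\<in>A \<inter> P. \<exists>b\<in>B \<inter> P. (a, b) \<in> reach E' P"
    using assms(1) reach_mono[OF assms(2) order_refl, of P] unfolding linkage_def by fast+
qed (use assms(1) in \<open>simp add: linkage_def\<close>)

text \<open>As there are as many disjoint members as vertices in \<open>S\<close>, each member
  contains exactly one \<open>s\<close> from \<open>S\<close>, and \<open>S\<close> can index them.
  A member is trimmed to \<open>s\<close> and the vertices reachable from its start without passing
  through \<open>s\<close>; so everything in it except \<open>s\<close> is reached from
  \<open>A\<close> outside \<open>S\<close>.\<close>

lemma linkage_endpoints: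
  assumes L: "linkage V E A S L" and S: "finite S" "card S = card L"
  obtains f where "\<And>s. s \<in> S \<Longrightarrow> f s \<subseteq> V" "\<And>s. s \<in> S \<Longrightarrow> f s \<inter> S = {s}"
    "\<And>s. s \<in> S \<Longrightarrow> \<exists>a\<in>A \<inter> f s. (a, s) \<in> reach E (f s) \<and>
        (\<forall>v\<in>f s - {s}. a \<noteq> s \<and> (a, v) \<in> reach E (f s - {s}))"
    "\<And>s t. s \<in> S \<Longrightarrow> t \<in> S \<Longrightarrow> s \<noteq> t \<Longrightarrow> f s \<inter> f t = {}"
proof (cases "L = {}")
  case True
  then have "S = {}"
    using S by simp
  then show ?thesis
    using that[of "\<lambda>_. {}"] by simp
next
  case False
  have "\<exists>b\<in>S \<inter> P. \<exists>a\<in>A \<inter> P. (a, b) \<in> reach E P" if "P \<in> L" for P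
    using L that unfolding linkage_def by blast
  then obtain h where h: "\<And>P. P \<in> L \<Longrightarrow> h P \<in> S \<inter> P"
    "\<And>P. P \<in> L \<Longrightarrow> \<exists>a\<in>A \<inter> P. (a, h P) \<in> reach E P"
    by metis
  have disj: "P \<inter> Q = {}" if "P \<in> L" "Q \<in> L" "P \<noteq> Q" for P Q
    using L that unfolding linkage_def pairwise_def disjnt_def by blast
  have inj: "inj_on h L"
  proof (rule inj_onI)
    fix P Q assume "P \<in> L" "Q \<in> L" "h P = h Q"
    then show "P = Q"
      using h(1)[of P] h(1)[of Q] disj[of P Q] by auto
  qed
  have "h ` L \<subseteq> S"
    using h(1) by blast
  then have img: "h ` L = S"
    using S inj by (intro card_subset_eq) (simp_all add: card_image)
  define g where "g = inv_into L h"
  have g: "g s \<in> L" "h (g s) = s" if "s \<in> S" for s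
    using that img by (auto simp: g_def inv_into_into f_inv_into_f)
  have g_disj: "g s \<inter> g t = {}" if "s \<in> S" "t \<in> S" "s \<noteq> t" for s t
    using g[OF that(1)] g[OF that(2)] that(3) disj[of "g s" "g t"] by metis
  have "\<forall>s\<in>S. \<exists>a\<in>A \<inter> g s. (a, s) \<in> reach E (g s)"
    using g h(2) by metis
  then obtain a where a: "\<And>s. s \<in> S \<Longrightarrow> a s \<in> A \<inter> g s" "\<And>s. s \<in> S \<Longrightarrow> (a s, s) \<in> reach E (g s)"
    by metis
  define f where "f = (\<lambda>s. if a s = s then {s} else insert s (component E (g s - {s}) (a s)))"
  have s_in: "s \<in> g s" if "s \<in> S" for s
    using g[OF that] h(1)[of "g s"] by auto
  have sub: "f s \<subseteq> g s" if "s \<in> S" for s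
    using s_in[OF that] a(1)[OF that] comp_subset[of "a s" "g s - {s}" E] by (auto simp: f_def)
  show ?thesis
  proof (rule that[of f])
    fix s assume s: "s \<in> S"
    show "f s \<subseteq> V"
      using sub[OF s] g[OF s] L by (auto simp: linkage_def)
    have "t = s" if "t \<in> f s" "t \<in> S" for t
      using g_disj[OF s that(2)] sub[OF s] s_in[OF that(2)] that(1) by blast
    moreover have "s \<in> f s"
      by (simp add: f_def)
    ultimately show "f s \<inter> S = {s}"
      using s by blast
    show "\<exists>a\<in>A \<inter> f s. (a, s) \<in> reach E (f s) \<and>
        (\<forall>v\<in>f s - {s}. a \<noteq> s \<and> (a, v) \<in> reach E (f s - {s}))"
    proof (cases "a s = s")
      case True
      then show ?thesis
        using a(1)[OF s] by (intro bexI[of _ s]) (auto simp: f_def)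
    next
      case False
      let ?C = "component E (g s - {s}) (a s)"
      have f: "f s = insert s ?C"
        using False by (simp add: f_def)
      have as: "a s \<in> g s - {s}"
        using a(1)[OF s] False by simp
      have s_C: "s \<notin> ?C"
        using comp_subset[OF as, of E] by blast
      obtain z where z: "(a s, z) \<in> reach E (g s - {s})" "{z, s} \<in> E" "z \<in> g s - {s}"
        using a(1,2)[OF s] False by (auto elim: reach_last_edge)
      have C: "(a s, v) \<in> reach E ?C" if "v \<in> ?C" for v
        using that as by (intro reach_in_comp) auto
      have "(a s, z) \<in> reach E (f s)"
        using C[of z] z(1) reach_mono[of E E ?C "f s"] f by blast
      moreover have "(z, s) \<in> reach E (f s)"
        using z(1,2) f by (intro reach_edge) auto
      ultimately have "(a s, s) \<in> reach E (f s)"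
        by (rule rtrancl_trans)
      moreover have "f s - {s} = ?C"
        using f s_C by blast
      ultimately show ?thesis
        using a(1)[OF s] f False C by (intro bexI[of _ "a s"]) auto
    qed
  next
    fix s t assume "s \<in> S" "t \<in> S" "s \<noteq> t"
    then show "f s \<inter> f t = {}"
      using g_disj sub by blast
  qed
qed

lemma reach_insert_edge:
  assumes "(a, z) \<in> reach (insert e E) W"
  shows "(a, z) \<in> reach E W \<or>
    (\<exists>x y. e = {x, y} \<and> x \<in> W \<and> y \<in> W \<and> (a, x) \<in> reach E W \<and> (y, z) \<in> reach E W)"
  using assms
proof (induction rule: rtrancl_induct)
  case (step z z')
  then have e: "{z, z'} \<in> insert e E" "z \<in> W" "z' \<in> W"
    by (auto simp: adj_on_def)
  show ?case
  proof (cases "{z, z'} \<in> E")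
    case True
    then have "(z, z') \<in> reach E W"
      using e by (intro reach_edge)
    then show ?thesis
      using step.IH rtrancl_trans by metis
  next
    case False
    then have ez: "e = {z, z'}"
      using e by simp
    from step.IH show ?thesis
    proof
      assume "(a, z) \<in> reach E W"
      then show ?thesis
        using ez e by blast
    next
      assume "\<exists>x y. e = {x, y} \<and> x \<in> W \<and> y \<in> W \<and> (a, x) \<in> reach E W \<and> (y, z) \<in> reach E W"
      then obtain x y where "e = {x, y}" "(a, x) \<in> reach E W" by blast
      then show ?thesis
        using ez e by (auto simp: doubleton_eq_iff)
    qed
  qed
qed simp

text \<open>A walk from \<open>A\<close> that avoids \<open>Z\<close> can never use the additional
  edge: it cannot reach \<open>x\<close> or enter \<open>X\<close>, by the choice of
  \<open>Z\<close>, and it cannot reach \<open>y\<close>, since it would continue to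
  \<open>b\<close> outside \<open>X\<close>. So it is a walk in the old graph that avoids
  \<open>X\<close> and cannot end in \<open>B\<close>.\<close>

lemma separates_sets_delete_edge:
  assumes X: "separates_sets V E A B X" and y: "(y, b) \<in> reach E (V - X)" "b \<in> B - X"
    and A: "A \<subseteq> V" and Z: "separates_sets V E A (insert x X) Z"
  shows "separates_sets V (insert {x, y} E) A B Z"
proof -
  let ?S = "insert x X"
  have "a \<notin> X \<and> (a, z) \<in> reach E (V - Z - X)"
    if a: "a \<in> A - Z" and "(a, z) \<in> reach (insert {x, y} E) (V - Z)" for a z
    using that(2)
  proof (induction rule: rtrancl_induct)
    case base
    have "a \<notin> X"
      using Z a by (auto simp: separates_sets_def)
    then show ?case by simp
  next
    case (step z z')
    then have e: "{z, z'} \<in> insert {x, y} E" "z \<in> V - Z" "z' \<in> V - Z"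
      by (auto simp: adj_on_def)
    from step.IH have aX: "a \<notin> X" and az: "(a, z) \<in> reach E (V - Z - X)"
      by auto
    have az1: "(a, z) \<in> reach E (V - Z)" and az2: "(a, z) \<in> reach E (V - X)"
      using az reach_mono[of E E "V - Z - X" "V - Z"] reach_mono[of E E "V - Z - X" "V - X"] by blast+
    have no: "s \<notin> ?S" if "s \<notin> Z" "(a, s) \<in> reach E (V - Z)" for s
      using Z a that by (auto simp: separates_sets_def)
    have "z \<notin> X"
      using az aX a A reach_in[of a z E "V - Z - X"] by auto
    have "z \<noteq> x"
      using no[OF _ az1] e by blast
    moreover have "z \<noteq> y"
    proof
      assume "z = y"
      then have "(a, b) \<in> reach E (V - X)"
        using az2 y(1) by (auto intro: rtrancl_trans)
      then show False
        using X a aX y(2) by (auto simp: separates_sets_def)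
    qed
    ultimately have "{z, z'} \<in> E"
      using e(1) by (auto simp: doubleton_eq_iff)
    then have "(z, z') \<in> reach E (V - Z)"
      using e by (intro reach_edge)
    then have "z' \<notin> ?S"
      using no[of z'] az1 e(3) by (auto intro: rtrancl_trans)
    then have "(z, z') \<in> reach E (V - Z - X)"
      using e \<open>z \<notin> X\<close> \<open>{z, z'} \<in> E\<close> by (intro reach_edge) auto
    then show ?case
      using aX az by (auto intro: rtrancl_trans)
  qed
  then have *: "a \<notin> X" "(a, z) \<in> reach E (V - Z - X)"
    if "a \<in> A - Z" "(a, z) \<in> reach (insert {x, y} E) (V - Z)" for a z
    using that by blast+
  show ?thesis
    unfolding separates_sets_def
  proof (intro ballI notI)
    fix a c assume ac: "a \<in> A - Z" "c \<in> B - Z" "(a, c) \<in> reach (insert {x, y} E) (V - Z)"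
    note ac' = *[OF ac(1,3)]
    then have "c \<notin> X"
      using ac A reach_in[of a c E "V - Z - X"] by auto
    moreover have "(a, c) \<in> reach E (V - X)"
      using ac' reach_mono[of E E "V - Z - X" "V - X"] by blast
    ultimately show False
      using X ac ac' by (auto simp: separates_sets_def)
  qed
qed

text \<open>Goering's proof by deleting an edge.\<close>

lemma menger_linkage:
  assumes "finite E" and V: "finite V" and AB: "A \<subseteq> V" "B \<subseteq> V"
    and "\<And>X. X \<subseteq> V \<Longrightarrow> separates_sets V E A B X \<Longrightarrow> k \<le> card X"
  shows "\<exists>L. linkage V E A B L \<and> finite L \<and> card L = k"
  using assms(1,3-)
proof (induction E arbitrary: A B rule: finite_induct)
  case empty
  have "adj_on {} W = {}" for W :: "'a set"
    by (simp add: adj_on_def)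
  then have "separates_sets V {} A B (A \<inter> B)"
    by (auto simp: separates_sets_def)
  then have "k \<le> card (A \<inter> B)"
    using empty.prems by blast
  then obtain T where T: "T \<subseteq> A \<inter> B" "card T = k" "finite T"
    by (rule obtain_subset_with_card_n)
  have "linkage V {} A B ((\<lambda>v. {v}) ` T)"
    unfolding linkage_def
    using T(1) empty.prems(1) by (auto simp: pairwise_def disjnt_def)
  then show ?case
    using T by (intro exI[of _ "(\<lambda>v. {v}) ` T"]) (simp add: card_image)
next
  case (insert e E)
  show ?case
  proof (cases "\<forall>X\<subseteq>V. separates_sets V E A B X \<longrightarrow> k \<le> card X")
    case True
    then obtain L where L: "linkage V E A B L" "finite L" "card L = k"
      using insert.IH insert.prems(1,2) by blast
    have "linkage V (insert e E) A B L"
      using L(1) by (rule linkage_mono) blast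
    then show ?thesis
      using L by blast
  next
    case False
    then obtain X where X: "X \<subseteq> V" "separates_sets V E A B X" "card X < k"
      by auto
    then have finX: "finite X"
      using V finite_subset by blast
    have "\<not> separates_sets V (insert e E) A B X"
      using insert.prems(3)[OF X(1)] X(3) by auto
    then obtain a b where ab: "a \<in> A - X" "b \<in> B - X" "(a, b) \<in> reach (insert e E) (V - X)"
      by (auto simp: separates_sets_def)
    moreover have "(a, b) \<notin> reach E (V - X)"
      using X(2) ab by (auto simp: separates_sets_def)
    ultimately obtain x y where xy: "e = {x, y}" "x \<in> V - X" "y \<in> V - X"
      "(a, x) \<in> reach E (V - X)" "(y, b) \<in> reach E (V - X)"
      using reach_insert_edge by metis
    \<comment> \<open>With an end of \<open>e\<close> added, \<open>X\<close> separates
      \<open>A\<close> from \<open>B\<close> even in the presence of \<open>e\<close>. So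
      \<open>card X + 1\<close> is at least \<open>k\<close>, while \<open>card X\<close> is less
      than \<open>k\<close>.\<close>
    have card: "card (insert z X) = k" if z: "z \<in> {x, y}" for z
    proof -
      have "adj_on (insert e E) (V - insert z X) \<subseteq> adj_on E (V - X)"
        using z xy(1) by (auto simp: adj_on_def doubleton_eq_iff)
      then have "reach (insert e E) (V - insert z X) \<subseteq> reach E (V - X)"
        by (rule rtrancl_mono)
      then have "separates_sets V (insert e E) A B (insert z X)"
        using X(2) unfolding separates_sets_def by blast
      then have "k \<le> card (insert z X)"
        using insert.prems(3)[of "insert z X"] X(1) z xy by auto
      then show ?thesis
        using X(3) finX card_insert_le_m1[of k X z] by (simp add: card_insert_if split: if_splits)
    qed
    have "\<exists>L. linkage V E A (insert x X) L \<and> finite L \<and> card L = k"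
    proof (rule insert.IH)
      fix Z assume Z: "Z \<subseteq> V" "separates_sets V E A (insert x X) Z"
      show "k \<le> card Z"
        using insert.prems(3)[OF Z(1)] separates_sets_delete_edge[OF X(2) xy(5) ab(2) insert.prems(1) Z(2)]
        by (simp add: xy(1))
    qed (use insert.prems X xy in auto)
    then obtain L where L: "linkage V E A (insert x X) L" "card L = k" by blast
    have "\<exists>M. linkage V E B (insert y X) M \<and> finite M \<and> card M = k"
    proof (rule insert.IH)
      fix Z assume Z: "Z \<subseteq> V" "separates_sets V E B (insert y X) Z"
      have "separates_sets V (insert {y, x} E) B A Z"
        using reach_sym[OF xy(4)] ab(1) insert.prems(2) Z(2)
        by (rule separates_sets_delete_edge[OF separates_sets_sym[OF X(2)]])
      from separates_sets_sym[OF this] show "k \<le> card Z"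
        using insert.prems(3)[OF Z(1)] by (simp add: xy(1) insert_commute)
    qed (use insert.prems X xy in auto)
    then obtain M where M: "linkage V E B (insert y X) M" "card M = k" by blast
    obtain f where f: "\<And>s. s \<in> insert x X \<Longrightarrow> f s \<subseteq> V" "\<And>s. s \<in> insert x X \<Longrightarrow> f s \<inter> insert x X = {s}"
      "\<And>s. s \<in> insert x X \<Longrightarrow> \<exists>a\<in>A \<inter> f s. (a, s) \<in> reach E (f s) \<and>
        (\<forall>v\<in>f s - {s}. a \<noteq> s \<and> (a, v) \<in> reach E (f s - {s}))"
      "\<And>s t. s \<in> insert x X \<Longrightarrow> t \<in> insert x X \<Longrightarrow> s \<noteq> t \<Longrightarrow> f s \<inter> f t = {}"
      using finX card[of x] L by (elim linkage_endpoints) auto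
    obtain g where g: "\<And>s. s \<in> insert y X \<Longrightarrow> g s \<subseteq> V" "\<And>s. s \<in> insert y X \<Longrightarrow> g s \<inter> insert y X = {s}"
      "\<And>s. s \<in> insert y X \<Longrightarrow> \<exists>a\<in>B \<inter> g s. (a, s) \<in> reach E (g s) \<and>
        (\<forall>v\<in>g s - {s}. a \<noteq> s \<and> (a, v) \<in> reach E (g s - {s}))"
      "\<And>s t. s \<in> insert y X \<Longrightarrow> t \<in> insert y X \<Longrightarrow> s \<noteq> t \<Longrightarrow> g s \<inter> g t = {}"
      using finX card[of y] M by (elim linkage_endpoints) auto
    have avoid: "\<exists>a\<in>A' - X. (a, v) \<in> reach E (V - X)"
      if s: "s \<in> insert z X" "z \<notin> X" and h: "h s \<subseteq> V" "h s \<inter> insert z X = {s}"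
        "\<exists>a\<in>A' \<inter> h s. (a, s) \<in> reach E (h s) \<and> (\<forall>v\<in>h s - {s}. a \<noteq> s \<and> (a, v) \<in> reach E (h s - {s}))"
        and v: "v \<in> h s" "v \<notin> X" for s z h v A'
    proof -
      obtain a where a: "a \<in> A' \<inter> h s" "(a, s) \<in> reach E (h s)"
        "\<forall>v\<in>h s - {s}. a \<noteq> s \<and> (a, v) \<in> reach E (h s - {s})"
        using h(3) by blast
      show ?thesis
      proof (cases "v = s")
        case True
        then have "s = z" "h s \<subseteq> V - X"
          using s v h by auto
        then show ?thesis
          using a v True reach_mono[of E E "h s" "V - X"] by blast
      next
        case False
        then have "a \<noteq> s" "(a, v) \<in> reach E (h s - {s})"
          using a(3) v(1) by auto
        moreover have "h s - {s} \<subseteq> V - X"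
          using h(1,2) by blast
        ultimately show ?thesis
          using a(1) reach_mono[of E E "h s - {s}" "V - X"] by blast
      qed
    qed
    \<comment> \<open>A common vertex outside \<open>X\<close> would connect \<open>A\<close> to
      \<open>B\<close> in the complement of \<open>X\<close> without the edge \<open>e\<close>. So
      the two linkages meet only in vertices of \<open>X\<close>, where they are to be
      joined.\<close>
    have meet: "s = v \<and> t = v" if st: "s \<in> insert x X" "t \<in> insert y X" and v: "v \<in> f s" "v \<in> g t" for s t v
    proof -
      have "v \<in> X"
      proof (rule ccontr)
        assume "v \<notin> X"
        obtain a' where a': "a' \<in> A - X" "(a', v) \<in> reach E (V - X)"
          using avoid[of s x f A v] st(1) xy(2) f(1-3)[OF st(1)] v(1) \<open>v \<notin> X\<close> by blast
        obtain b' where b': "b' \<in> B - X" "(b', v) \<in> reach E (V - X)"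
          using avoid[of t y g B v] st(2) xy(3) g(1-3)[OF st(2)] v(2) \<open>v \<notin> X\<close> by blast
        have "(a', b') \<in> reach E (V - X)"
          using a'(2) reach_sym[OF b'(2)] by (rule rtrancl_trans)
        then show False
          using X(2) a'(1) b'(1) by (simp add: separates_sets_def)
      qed
      then have "v \<in> f s \<inter> insert x X" "v \<in> g t \<inter> insert y X"
        using v by auto
      then show ?thesis
        unfolding f(2)[OF st(1)] g(2)[OF st(2)] by simp
    qed
    \<comment> \<open>The parts ending in \<open>x\<close> and in \<open>y\<close> are joined by the
      edge \<open>e\<close>, all others at their common vertex in \<open>X\<close>.\<close>
    define \<phi> where "\<phi> = (\<lambda>s. if s = x then y else s)"
    have \<phi>: "\<phi> s \<in> insert y X" if "s \<in> insert x X" for s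
      using that by (auto simp: \<phi>_def)
    have \<phi>_inj: "\<phi> s \<noteq> \<phi> t" if "s \<in> insert x X" "t \<in> insert x X" "s \<noteq> t" for s t
      using that xy by (auto simp: \<phi>_def)
    define R where "R = (\<lambda>s. f s \<union> g (\<phi> s))"
    have R_ne: "s \<in> R s" if "s \<in> insert x X" for s
      using f(2)[OF that] by (auto simp: R_def)
    have R_disj: "R s \<inter> R t = {}" if st: "s \<in> insert x X" "t \<in> insert x X" "s \<noteq> t" for s t
    proof -
      have "f s \<inter> g (\<phi> t) = {}" if "s \<in> insert x X" "t \<in> insert x X" "s \<noteq> t" for s t
      proof (rule ccontr)
        assume "f s \<inter> g (\<phi> t) \<noteq> {}"
        then have "s = \<phi> t"
          using meet[OF that(1) \<phi>[OF that(2)]] by blast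
        then show False
          using that xy(2,3) meet[OF that(1) \<phi>[OF that(2)]] \<open>f s \<inter> g (\<phi> t) \<noteq> {}\<close> xy
          by (auto simp: \<phi>_def split: if_splits)
      qed
      then show ?thesis
        using f(4)[OF st] g(4)[OF \<phi>[OF st(1)] \<phi>[OF st(2)] \<phi>_inj[OF st]] st
        unfolding R_def by blast
    qed
    have "inj_on R (insert x X)"
      using R_ne R_disj by (intro inj_onI) blast
    then have "card (R ` insert x X) = k"
      using card[of x] by (simp only: card_image insertI1)
    moreover have "linkage V (insert e E) A B (R ` insert x X)"
      unfolding linkage_def
    proof (intro conjI ballI)
      show "pairwise disjnt (R ` insert x X)"
        using R_disj by (intro pairwise_imageI) (simp add: disjnt_def)
      fix P assume "P \<in> R ` insert x X"
      then obtain s where s: "s \<in> insert x X" and P: "P = R s" by blast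
      show "P \<subseteq> V"
        using f(1)[OF s] g(1)[OF \<phi>[OF s]] by (simp add: P R_def)
      obtain a' where a': "a' \<in> A \<inter> f s" "(a', s) \<in> reach E (f s)"
        using f(3)[OF s] by blast
      obtain b' where b': "b' \<in> B \<inter> g (\<phi> s)" "(b', \<phi> s) \<in> reach E (g (\<phi> s))"
        using g(3)[OF \<phi>[OF s]] by blast
      have "(a', s) \<in> reach (insert e E) P"
        using a'(2) reach_mono[of E "insert e E" "f s" P] by (auto simp: P R_def)
      moreover have "(s, \<phi> s) \<in> reach (insert e E) P"
      proof (cases "s = x")
        case True
        have "\<phi> s \<in> P"
          using g(2)[OF \<phi>[OF s]] by (auto simp: P R_def)
        then show ?thesis
          using True R_ne[OF s] xy(1) by (intro reach_edge) (auto simp: P \<phi>_def)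
      qed (simp add: \<phi>_def)
      moreover have "(\<phi> s, b') \<in> reach (insert e E) P"
        using reach_sym[OF b'(2)] reach_mono[of E "insert e E" "g (\<phi> s)" P] by (auto simp: P R_def)
      ultimately have "(a', b') \<in> reach (insert e E) P"
        by (meson rtrancl_trans)
      then show "\<exists>a\<in>A \<inter> P. \<exists>b\<in>B \<inter> P. (a, b) \<in> reach (insert e E) P"
        using a'(1) b'(1) by (auto simp: P R_def)
    qed
    ultimately show ?thesis
      using finX by blast
  qed
qed

section \<open>From linkages to internally disjoint paths\<close>

lemma successively_reach:
  "successively (\<lambda>u v. {u, v} \<in> E) xs \<Longrightarrow> xs \<noteq> [] \<Longrightarrow> set xs \<subseteq> W \<Longrightarrow> (hd xs, last xs) \<in> reach E W"
proof (induction xs rule: induct_list012)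
  case (3 x y zs)
  then have "(y, last (y # zs)) \<in> reach E W" "(x, y) \<in> reach E W"
    by (auto intro: reach_edge)
  then show ?case
    by (auto intro: rtrancl_trans)
qed simp_all

lemma reach_path:
  assumes "(a, b) \<in> reach E W" "a \<in> W"
  shows "\<exists>xs. is_path W E a b xs"
  using assms
proof (induction rule: rtrancl_induct)
  case base
  then show ?case
    by (intro exI[of _ "[a]"]) (simp add: is_path_def)
next
  case (step y z)
  then obtain xs where xs: "is_path W E a y xs" by blast
  have e: "{y, z} \<in> E" "z \<in> W"
    using step.hyps by (auto simp: adj_on_def)
  show ?case
  proof (cases "z \<in> set xs")
    case True
    then obtain us vs where u: "xs = us @ z # vs"
      by (auto dest: split_list)
    have "successively (\<lambda>u v. {u, v} \<in> E) (us @ [z])"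
      using xs by (auto simp: u is_path_def successively_append_iff)
    then have "is_path W E a z (us @ [z])"
      using xs by (cases us) (auto simp: u is_path_def)
    then show ?thesis by blast
  next
    case False
    then have "is_path W E a z (xs @ [z])"
      using xs e by (auto simp: is_path_def successively_append_iff)
    then show ?thesis by blast
  qed
qed

lemma finite_paths:
  assumes "finite V"
  shows "finite {xs. is_path V E x y xs}"
proof (rule finite_subset)
  show "{xs. is_path V E x y xs} \<subseteq> {xs. set xs \<subseteq> V \<and> length xs \<le> card V}"
    using assms card_mono by (auto simp: is_path_def simp flip: distinct_card)
  show "finite {xs. set xs \<subseteq> V \<and> length xs \<le> card V}"
    using assms by (rule finite_lists_length_le)
qed

abbreviation disjoint_paths :: "'v set \<Rightarrow> 'v set set \<Rightarrow> 'v \<Rightarrow> 'v \<Rightarrow> 'v list set \<Rightarrow> bool" where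
  "disjoint_paths V E x y P \<equiv>
     (\<forall>xs\<in>P. is_path V E x y xs) \<and> pairwise (\<lambda>xs ys. set xs \<inter> set ys \<subseteq> {x, y}) P"

lemma finite_disjoint_paths_cards:
  assumes "finite V"
  shows "finite {card P | P. disjoint_paths V E x y P}"
proof (rule finite_subset)
  show "{card P | P. disjoint_paths V E x y P} \<subseteq> card ` Pow {xs. is_path V E x y xs}"
    by auto
qed (use finite_paths[OF assms] in simp)

lemma card_le_local_connectivity:
  assumes "finite V" "disjoint_paths V E x y P"
  shows "card P \<le> local_connectivity V E x y"
  unfolding local_connectivity_def using assms by (intro Max_ge finite_disjoint_paths_cards) auto

text \<open>Every path meets \<open>S\<close>, and paths that share only their ends meet it in
  different vertices.\<close>

lemma local_connectivity_le_separator: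
  assumes V: "finite V" and S: "S \<subseteq> V" "x \<in> V - S" "y \<in> V - S" "(x, y) \<notin> reach E (V - S)"
  shows "local_connectivity V E x y \<le> card S"
  unfolding local_connectivity_def
proof (rule Max.boundedI[OF finite_disjoint_paths_cards[OF V]])
  have "disjoint_paths V E x y {}" by simp
  then show "{card P | P. disjoint_paths V E x y P} \<noteq> {}" by blast
  fix n assume "n \<in> {card P | P. disjoint_paths V E x y P}"
  then obtain P where P: "n = card P" "\<And>xs. xs \<in> P \<Longrightarrow> is_path V E x y xs"
    "pairwise (\<lambda>xs ys. set xs \<inter> set ys \<subseteq> {x, y}) P"
    by auto
  have "\<exists>v. v \<in> set xs \<inter> S" if "xs \<in> P" for xs
  proof (rule ccontr)
    assume "\<nexists>v. v \<in> set xs \<inter> S"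
    then have "set xs \<subseteq> V - S"
      using P(2)[OF that] by (auto simp: is_path_def)
    then have "(x, y) \<in> reach E (V - S)"
      using P(2)[OF that] successively_reach[of E xs "V - S"] by (auto simp: is_path_def)
    then show False
      using S(4) by simp
  qed
  then obtain h where h: "\<And>xs. xs \<in> P \<Longrightarrow> h xs \<in> set xs \<inter> S"
    by metis
  have "inj_on h P"
  proof (rule inj_onI, rule ccontr)
    fix xs ys assume "xs \<in> P" "ys \<in> P" "h xs = h ys" "xs \<noteq> ys"
    then have "h xs \<in> {x, y}" "h xs \<in> S"
      using h[of xs] h[of ys] P(3) by (auto simp: pairwise_def)
    then show False
      using S by auto
  qed
  then show "n \<le> card S"
    unfolding P(1) using h V S(1) finite_subset by (intro card_inj_on_le[of h]) auto
qed

text \<open>The linkage is taken between the neighbourhoods of \<open>x\<close> and \<open>y\<close>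
  in the graph without these two vertices. As they are not adjacent, every path from
  \<open>x\<close> to \<open>y\<close> passes through both neighbourhoods.\<close>

theorem menger:
  assumes V: "finite V" and E: "finite E" and xy: "x \<in> V" "y \<in> V" "x \<noteq> y" "{x, y} \<notin> E"
    and sep: "\<And>S. S \<subseteq> V - {x, y} \<Longrightarrow> (x, y) \<notin> reach E (V - S) \<Longrightarrow> k \<le> card S"
  shows "k \<le> local_connectivity V E x y"
proof -
  let ?V = "V - {x, y}"
  let ?A = "{a \<in> ?V. {x, a} \<in> E}" and ?B = "{b \<in> ?V. {b, y} \<in> E}"
  have "\<exists>L. linkage ?V E ?A ?B L \<and> finite L \<and> card L = k"
  proof (rule menger_linkage[OF E])
    fix S assume S: "S \<subseteq> ?V" "separates_sets ?V E ?A ?B S"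
    have "(x, y) \<notin> reach E (V - S)"
    proof
      assume "(x, y) \<in> reach E (V - S)"
      then obtain b where b: "(x, b) \<in> reach E (V - S - {y})" "{b, y} \<in> E" "b \<in> V - S - {y}"
        using xy S(1) by (auto elim: reach_last_edge)
      have "b \<noteq> x"
        using b(2) xy(4) by auto
      then obtain a where a: "(b, a) \<in> reach E (V - S - {y} - {x})" "{a, x} \<in> E" "a \<in> V - S - {y} - {x}"
        using reach_sym[OF b(1)] b(3) by (auto elim: reach_last_edge)
      have "V - S - {y} - {x} = ?V - S"
        by auto
      then have "(a, b) \<in> reach E (?V - S)"
        using reach_sym[OF a(1)] by simp
      moreover have "a \<in> ?A - S" "b \<in> ?B - S"
        using a b \<open>b \<noteq> x\<close> by (auto simp: insert_commute)
      ultimately show False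
        using S(2) by (auto simp: separates_sets_def)
    qed
    then show "k \<le> card S"
      using sep S(1) by blast
  qed (use V in auto)
  then obtain L where L: "linkage ?V E ?A ?B L" "finite L" "card L = k"
    by blast
  \<comment> \<open>Each path is required to meet its set \<open>P\<close>, which makes the paths
    chosen for different sets distinct.\<close>
  have "\<exists>xs. is_path V E x y xs \<and> set xs \<subseteq> P \<union> {x, y} \<and> set xs \<inter> P \<noteq> {}" if PL: "P \<in> L" for P
  proof -
    note * = bspec[OF conjunct1[OF L(1)[unfolded linkage_def]] PL]
    obtain a b where ab: "a \<in> ?A \<inter> P" "b \<in> ?B \<inter> P" "(a, b) \<in> reach E P"
      using conjunct2[OF *] by (elim bexE)
    have P: "P \<subseteq> ?V"
      using conjunct1[OF *] .
    obtain xs where xs: "is_path P E a b xs"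
      using reach_path[OF ab(3)] ab(1) by blast
    then have xs': "xs \<noteq> []" "hd xs = a" "last xs = b" "distinct xs" "set xs \<subseteq> P"
      "successively (\<lambda>u v. {u, v} \<in> E) xs"
      by (simp_all add: is_path_def)
    have "x \<notin> set xs" "y \<notin> set xs"
      using xs'(5) P by blast+
    moreover have "{x, a} \<in> E" "{b, y} \<in> E"
      using ab by simp_all
    moreover have "set xs \<subseteq> V"
      using xs'(5) P by blast
    ultimately have "is_path V E x y (x # xs @ [y])"
      using xs' xy(1-3) by (simp add: is_path_def successively_append_iff successively_Cons)
    moreover have "a \<in> set xs"
      using xs'(1,2) by auto
    ultimately show ?thesis
      using xs ab(1) by (intro exI[of _ "x # xs @ [y]"]) (auto simp: is_path_def)
  qed
  then obtain \<pi> where \<pi>: "\<And>P. P \<in> L \<Longrightarrow> is_path V E x y (\<pi> P)"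
    "\<And>P. P \<in> L \<Longrightarrow> set (\<pi> P) \<subseteq> P \<union> {x, y}" "\<And>P. P \<in> L \<Longrightarrow> set (\<pi> P) \<inter> P \<noteq> {}"
    by metis
  have disj: "P \<inter> Q = {}" "P \<inter> {x, y} = {}" if "P \<in> L" "Q \<in> L" "P \<noteq> Q" for P Q
    using L(1) that unfolding linkage_def pairwise_def disjnt_def by blast+
  have meet: "set (\<pi> P) \<inter> set (\<pi> Q) \<subseteq> {x, y}" if "P \<in> L" "Q \<in> L" "P \<noteq> Q" for P Q
    using \<pi>(2)[OF that(1)] \<pi>(2)[OF that(2)] disj(1)[OF that] by blast
  have "inj_on \<pi> L"
  proof (rule inj_onI, rule ccontr)
    fix P Q assume PQ: "P \<in> L" "Q \<in> L" "\<pi> P = \<pi> Q" "P \<noteq> Q"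
    then have "set (\<pi> P) \<subseteq> {x, y}"
      using meet[OF PQ(1,2,4)] by simp
    then show False
      using \<pi>(3)[OF PQ(1)] disj(2)[OF PQ(1,2,4)] by blast
  qed
  moreover have "disjoint_paths V E x y (\<pi> ` L)"
    using \<pi>(1) meet by (auto intro!: pairwise_imageI)
  then have "card (\<pi> ` L) \<le> local_connectivity V E x y"
    by (rule card_le_local_connectivity[OF V])
  ultimately show ?thesis
    using L(3) by (simp add: card_image)
qed


section \<open>Counting realizations\<close>

lemma transpose_mult_rows:
  fixes M :: "real ^ 'n::finite ^ 'n"
  shows "transpose M *v \<alpha> = (\<Sum>i\<in>UNIV. \<alpha> $ i *\<^sub>R (M $ i))"
  by (simp add: vec_eq_iff matrix_vector_mult_def transpose_def mult.commute)

lemma det_nonzero_surj: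
  fixes M :: "real ^ 'n::finite ^ 'n"
  shows "det M \<noteq> 0 \<Longrightarrow> surj ((*v) M)"
  by (simp flip: matrix_right_invertible_surjective invertible_right_inverse add: invertible_det_nz)

lemma simplex_matrix_rows_sum:
  "(\<Sum>i\<in>UNIV. \<alpha> $ i *\<^sub>R (simplex_matrix e p y $ i)) =
     \<alpha> $ base_index *\<^sub>R y + (\<Sum>i\<in>UNIV. \<alpha> $ i *\<^sub>R (p (e i) - p (e base_index)))"
proof -
  have "(\<Sum>i\<in>UNIV. \<alpha> $ i *\<^sub>R (simplex_matrix e p y $ i)) =
      (\<Sum>i\<in>UNIV. (if i = base_index then \<alpha> $ base_index *\<^sub>R y else 0)
        + \<alpha> $ i *\<^sub>R (p (e i) - p (e base_index)))"
    by (rule sum.cong) (auto simp: simplex_matrix_def)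
  then show ?thesis
    by (simp add: sum.distrib)
qed

lemma inner_dist_identity:
  fixes x y z :: "'a::real_inner"
  shows "2 * ((x - z) \<bullet> (y - z)) = (norm (x - z))\<^sup>2 + (norm (y - z))\<^sup>2 - (norm (x - y))\<^sup>2"
  unfolding power2_norm_eq_inner
  by (simp add: inner_diff_left inner_diff_right inner_commute algebra_simps)

section \<open>Two realizations with isometric simplices: heights over their hyperplanes\<close>

context
  fixes e :: "'d::finite \<Rightarrow> 'v" and p q :: "'v \<Rightarrow> real ^ 'd"
  assumes np: "normal e p \<noteq> 0"
    and dist: "\<And>i j. norm (q (e i) - q (e j)) = norm (p (e i) - p (e j))"
begin

private abbreviation "P i \<equiv> p (e i) - p (e base_index)"
private abbreviation "Q i \<equiv> q (e i) - q (e base_index)"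

private lemma gram: "Q i \<bullet> Q j = P i \<bullet> P j"
  using inner_dist_identity[of "p (e i)" "p (e base_index)" "p (e j)"]
    inner_dist_identity[of "q (e i)" "q (e base_index)" "q (e j)"] by (simp add: dist)

private lemma gram_sum:
  "(\<Sum>i\<in>UNIV. \<alpha> $ i *\<^sub>R Q i) \<bullet> (\<Sum>i\<in>UNIV. \<beta> $ i *\<^sub>R Q i) =
   (\<Sum>i\<in>UNIV. \<alpha> $ i *\<^sub>R P i) \<bullet> (\<Sum>i\<in>UNIV. \<beta> $ i *\<^sub>R P i)"
  by (simp only: inner_sum_left inner_sum_right inner_scaleR_left inner_scaleR_right gram)

private lemma det_P: "det (transpose (simplex_matrix e p (normal e p))) \<noteq> 0"
  using np by (simp flip: normal_inner)

text \<open>Nondegeneracy depends only on the Gram matrix of the edge vectors. These are completed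
  by a vector \<open>y\<close> orthogonal to them, and a linear dependence would have coefficient
  zero at \<open>y\<close>; the remaining combination has the same norm in \<open>p\<close>, where
  the edge vectors are independent.\<close>

lemma normal_nonzero_isometric: "normal e q \<noteq> 0"
proof -
  have "row base_index (simplex_matrix e q 0) = 0"
    by (simp add: row_def simplex_matrix_def vec_eq_iff)
  then have "det (simplex_matrix e q 0) = 0"
    by (rule det_zero_row)
  then obtain y where y: "y \<noteq> 0" "simplex_matrix e q 0 *v y = 0"
    using det_nonzero_iff_kernel by blast
  have yQ: "Q i \<bullet> y = 0" for i
    using arg_cong[OF y(2), of "\<lambda>x. x $ i"]
    by (cases "i = base_index") (simp_all add: simplex_matrix_mult)
  have "\<alpha> = 0" if "transpose (simplex_matrix e q y) *v \<alpha> = 0" for \<alpha>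
  proof -
    have *: "\<alpha> $ base_index *\<^sub>R y + (\<Sum>i\<in>UNIV. \<alpha> $ i *\<^sub>R Q i) = 0"
      using that by (simp only: transpose_mult_rows simplex_matrix_rows_sum)
    have "\<alpha> $ base_index * (y \<bullet> y) = 0"
      using arg_cong[OF *, of "\<lambda>x. x \<bullet> y"] by (simp only: inner_add_left inner_sum_left inner_scaleR_left yQ) simp
    then have \<alpha>0: "\<alpha> $ base_index = 0"
      using y(1) by simp
    then have "(\<Sum>i\<in>UNIV. \<alpha> $ i *\<^sub>R Q i) = 0"
      using * by (simp only: scaleR_zero_left add_0)
    then have "(\<Sum>i\<in>UNIV. \<alpha> $ i *\<^sub>R P i) \<bullet> (\<Sum>i\<in>UNIV. \<alpha> $ i *\<^sub>R P i) = 0"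
      by (simp only: inner_zero_left flip: gram_sum[of \<alpha> \<alpha>])
    then have "(\<Sum>i\<in>UNIV. \<alpha> $ i *\<^sub>R P i) = 0"
      by (simp only: inner_eq_zero_iff)
    then have "transpose (simplex_matrix e p (normal e p)) *v \<alpha> = 0"
      using \<alpha>0 by (simp only: transpose_mult_rows simplex_matrix_rows_sum scaleR_zero_left add_0)
    then show ?thesis
      using det_P det_nonzero_iff_kernel by blast
  qed
  then have "det (transpose (simplex_matrix e q y)) \<noteq> 0"
    using det_nonzero_iff_kernel by blast
  then have "normal e q \<bullet> y \<noteq> 0"
    by (simp add: normal_inner)
  then show ?thesis
    by auto
qed

text \<open>The component in the hyperplane is determined by the inner products with the edge
  vectors, which are the same in \<open>p\<close> and \<open>q\<close>. So one coefficient vector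
  \<alpha> serves both realizations, and only the normal component may differ.\<close>

private lemma decompose:
  assumes u: "\<And>i. norm (q u - q (e i)) = norm (p u - p (e i))"
  obtains \<alpha> where
    "p u - p (e base_index) = (\<Sum>i\<in>UNIV. \<alpha> $ i *\<^sub>R P i)
      + ((normal e p \<bullet> (p u - p (e base_index))) / (normal e p \<bullet> normal e p)) *\<^sub>R normal e p"
    "q u - q (e base_index) = (\<Sum>i\<in>UNIV. \<alpha> $ i *\<^sub>R Q i)
      + ((normal e q \<bullet> (q u - q (e base_index))) / (normal e q \<bullet> normal e q)) *\<^sub>R normal e q"
proof -
  let ?n = "normal e p" and ?m = "normal e q"
  let ?a = "p u - p (e base_index)" and ?b = "q u - q (e base_index)"
  have "surj ((*v) (transpose (simplex_matrix e p ?n)))"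
    using det_P by (rule det_nonzero_surj)
  then obtain \<alpha> where "transpose (simplex_matrix e p ?n) *v \<alpha> = ?a"
    by (metis surjD)
  then have a: "?a = \<alpha> $ base_index *\<^sub>R ?n + (\<Sum>i\<in>UNIV. \<alpha> $ i *\<^sub>R P i)"
    by (simp only: transpose_mult_rows simplex_matrix_rows_sum)
  have nP: "?n \<bullet> (\<Sum>i\<in>UNIV. \<alpha> $ i *\<^sub>R P i) = 0" and mQ: "?m \<bullet> (\<Sum>i\<in>UNIV. \<alpha> $ i *\<^sub>R Q i) = 0"
    by (simp_all only: inner_sum_right inner_scaleR_right normal_orthogonal mult_zero_right sum.neutral_const)
  have "?n \<bullet> ?a = \<alpha> $ base_index * (?n \<bullet> ?n)"
    unfolding arg_cong[OF a, of "\<lambda>x. ?n \<bullet> x"] inner_add_right nP by simp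
  then have \<alpha>: "\<alpha> $ base_index = (?n \<bullet> ?a) / (?n \<bullet> ?n)"
    using np by simp
  let ?r = "?b - (\<Sum>i\<in>UNIV. \<alpha> $ i *\<^sub>R Q i)"
  have ub: "?b \<bullet> Q i = ?a \<bullet> P i" for i
    using inner_dist_identity[of "p u" "p (e base_index)" "p (e i)"]
      inner_dist_identity[of "q u" "q (e base_index)" "q (e i)"] by (simp add: dist u)
  have "?r \<bullet> Q j = 0" for j
  proof -
    have "?r \<bullet> Q j = ?a \<bullet> P j - (\<Sum>i\<in>UNIV. \<alpha> $ i *\<^sub>R P i) \<bullet> P j"
      by (simp only: inner_diff_left[of ?b] inner_sum_left inner_scaleR_left gram ub)
    also have "\<dots> = 0"
      unfolding arg_cong[OF a, of "\<lambda>x. x \<bullet> P j"] inner_add_left[of "\<alpha> $ base_index *\<^sub>R ?n"]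
      by (simp add: normal_orthogonal)
    finally show ?thesis .
  qed
  then obtain c where c: "?r = c *\<^sub>R ?m"
    using normal_unique[OF normal_nonzero_isometric, of ?r] by blast
  then have b: "?b = (\<Sum>i\<in>UNIV. \<alpha> $ i *\<^sub>R Q i) + c *\<^sub>R ?m"
    by (simp add: algebra_simps)
  have "?m \<bullet> ?b = c * (?m \<bullet> ?m)"
    unfolding arg_cong[OF b, of "\<lambda>x. ?m \<bullet> x"] inner_add_right mQ by simp
  then have "c = (?m \<bullet> ?b) / (?m \<bullet> ?m)"
    using normal_nonzero_isometric by simp
  with a b \<alpha> show ?thesis
    by (intro that[of \<alpha>]) (simp_all only: add.commute)
qed

text \<open>For a nondegenerate simplex, the signed distance of \<open>u\<close> from the hyperplane
  of \<open>e\<close> in the realization \<open>r\<close>.\<close>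

definition height :: "('v \<Rightarrow> real ^ 'd) \<Rightarrow> 'v \<Rightarrow> real" where
  "height r u = (normal e r \<bullet> (r u - r (e base_index))) / norm (normal e r)"

lemma height_mult:
  "height r u * height r v = (normal e r \<bullet> (r u - r (e base_index)))
    * (normal e r \<bullet> (r v - r (e base_index))) / (normal e r \<bullet> normal e r)"
  by (simp add: height_def dot_square_norm power2_eq_square)

text \<open>The components in the hyperplanes have the same inner product in both realizations,
  because the Gram matrices agree; only the product of the heights can change.\<close>

lemma dist_height:
  assumes u: "\<And>i. norm (q u - q (e i)) = norm (p u - p (e i))"
    and v: "\<And>i. norm (q v - q (e i)) = norm (p v - p (e i))"
  shows "(norm (q u - q v))\<^sup>2 =
    (norm (p u - p v))\<^sup>2 - 2 * (height q u * height q v - height p u * height p v)"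
proof -
  let ?n = "normal e p" and ?m = "normal e q"
  let ?a = "\<lambda>u. p u - p (e base_index)" and ?b = "\<lambda>u. q u - q (e base_index)"
  obtain \<alpha> where \<alpha>: "?a u = (\<Sum>i\<in>UNIV. \<alpha> $ i *\<^sub>R P i) + ((?n \<bullet> ?a u) / (?n \<bullet> ?n)) *\<^sub>R ?n"
    "?b u = (\<Sum>i\<in>UNIV. \<alpha> $ i *\<^sub>R Q i) + ((?m \<bullet> ?b u) / (?m \<bullet> ?m)) *\<^sub>R ?m"
    using u by (rule decompose)
  obtain \<beta> where \<beta>: "?a v = (\<Sum>i\<in>UNIV. \<beta> $ i *\<^sub>R P i) + ((?n \<bullet> ?a v) / (?n \<bullet> ?n)) *\<^sub>R ?n"
    "?b v = (\<Sum>i\<in>UNIV. \<beta> $ i *\<^sub>R Q i) + ((?m \<bullet> ?b v) / (?m \<bullet> ?m)) *\<^sub>R ?m"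
    using v by (rule decompose)
  have orth: "(\<Sum>i\<in>UNIV. \<gamma> $ i *\<^sub>R P i) \<bullet> ?n = 0" "(\<Sum>i\<in>UNIV. \<gamma> $ i *\<^sub>R Q i) \<bullet> ?m = 0" for \<gamma>
    by (simp_all only: inner_commute[of _ ?n] inner_commute[of _ ?m] inner_sum_right
        inner_scaleR_right normal_orthogonal mult_zero_right sum.neutral_const)
  have split: "(x + s *\<^sub>R n) \<bullet> (y + t *\<^sub>R n) = x \<bullet> y + s * t * (n \<bullet> n)"
    if "x \<bullet> n = 0" "y \<bullet> n = 0" for x y n :: "real ^ 'd" and s t
    using that by (simp add: inner_add_left inner_add_right inner_commute)
  have "?a u \<bullet> ?a v = (\<Sum>i\<in>UNIV. \<alpha> $ i *\<^sub>R P i) \<bullet> (\<Sum>i\<in>UNIV. \<beta> $ i *\<^sub>R P i) + height p u * height p v"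
    by (subst \<alpha>(1), subst \<beta>(1), subst split[OF orth(1) orth(1)]) (use np in \<open>simp add: height_mult\<close>)
  moreover have "?b u \<bullet> ?b v = (\<Sum>i\<in>UNIV. \<alpha> $ i *\<^sub>R Q i) \<bullet> (\<Sum>i\<in>UNIV. \<beta> $ i *\<^sub>R Q i) + height q u * height q v"
    by (subst \<alpha>(2), subst \<beta>(2), subst split[OF orth(2) orth(2)])
      (use normal_nonzero_isometric in \<open>simp add: height_mult\<close>)
  ultimately have "?b u \<bullet> ?b v - ?a u \<bullet> ?a v = height q u * height q v - height p u * height p v"
    using gram_sum[of \<alpha> \<beta>] by simp
  then show ?thesis
    using inner_dist_identity[of "p u" "p (e base_index)" "p v"]
      inner_dist_identity[of "q u" "q (e base_index)" "q v"] u[of base_index] v[of base_index]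
    by simp
qed

text \<open>Equal distances within \<open>X\<close> make all products of two heights agree, so the
  heights agree up to a common sign, which is read off at \<open>x\<close>.\<close>

lemma height_sign:
  assumes x: "x \<in> X" and hx: "height p x \<noteq> 0"
    and S: "\<And>u i. u \<in> X \<Longrightarrow> norm (q u - q (e i)) = norm (p u - p (e i))"
    and X: "\<And>u v. u \<in> X \<Longrightarrow> v \<in> X \<Longrightarrow> norm (q u - q v) = norm (p u - p v)"
  obtains s where "s = 1 \<or> s = -1" "\<And>u. u \<in> X \<Longrightarrow> height q u = s * height p u"
proof -
  have eq: "height q u * height q v = height p u * height p v" if "u \<in> X" "v \<in> X" for u v
    using dist_height[OF S[OF that(1)] S[OF that(2)]] X[OF that] by simp
  have "(height q x)\<^sup>2 = (height p x)\<^sup>2"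
    using eq[OF x x] by (simp add: power2_eq_square)
  then have "height q x = height p x \<or> height q x = - height p x"
    by (simp add: power2_eq_iff)
  then obtain s :: real where s: "s = 1 \<or> s = -1" "height q x = s * height p x"
    by (metis mult_1 mult_minus1)
  have "height q u = s * height p u" if "u \<in> X" for u
    using eq[OF that x] s hx by auto
  with s(1) show ?thesis
    by (rule that)
qed

text \<open>The heights of \<open>X\<close> and of \<open>Y\<close> are each preserved up to a sign.
  If the signs agree, so do the distances across; if they differ, one side has been reflected
  relative to the other.\<close>

lemma reflection_dichotomy:
  assumes hp: "\<And>u. u \<in> X \<union> Y \<Longrightarrow> height p u \<noteq> 0"
    and S: "\<And>u i. u \<in> X \<union> Y \<Longrightarrow> norm (q u - q (e i)) = norm (p u - p (e i))"
    and X: "\<And>u v. u \<in> X \<Longrightarrow> v \<in> X \<Longrightarrow> norm (q u - q v) = norm (p u - p v)"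
    and Y: "\<And>u v. u \<in> Y \<Longrightarrow> v \<in> Y \<Longrightarrow> norm (q u - q v) = norm (p u - p v)"
    and U: "X \<subseteq> U" "Y \<inter> U = {}"
  shows "(\<forall>u\<in>X. \<forall>v\<in>Y. norm (q u - q v) = norm (p u - p v)) \<or>
    (\<forall>u\<in>X. \<forall>v\<in>Y. norm (q u - q v) = norm (partial_reflection e U p u - partial_reflection e U p v))"
proof (cases "X = {} \<or> Y = {}")
  case False
  then obtain x y where xy: "x \<in> X" "y \<in> Y" by blast
  obtain s where s: "s = 1 \<or> s = -1" "\<And>u. u \<in> X \<Longrightarrow> height q u = s * height p u"
    using xy(1) hp S X by (rule_tac height_sign[of x X]) auto
  obtain t where t: "t = 1 \<or> t = -1" "\<And>u. u \<in> Y \<Longrightarrow> height q u = t * height p u"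
    using xy(2) hp S Y by (rule_tac height_sign[of y Y]) auto
  have d: "(norm (q u - q v))\<^sup>2 = (norm (p u - p v))\<^sup>2 - 2 * (s * t - 1) * (height p u * height p v)"
    if "u \<in> X" "v \<in> Y" for u v
  proof -
    have "(norm (q u - q v))\<^sup>2 =
        (norm (p u - p v))\<^sup>2 - 2 * (height q u * height q v - height p u * height p v)"
      using that by (intro dist_height S) auto
    then show ?thesis
      by (simp add: s(2)[OF that(1)] t(2)[OF that(2)] algebra_simps)
  qed
  have "s * t = 1 \<or> s * t = -1"
    using s(1) t(1) by auto
  then show ?thesis
  proof
    assume "s * t = 1"
    then show ?thesis
      using d by (auto simp: power2_eq_iff_nonneg)
  next
    assume st: "s * t = -1"
    have "norm (q u - q v) = norm (partial_reflection e U p u - partial_reflection e U p v)"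
      if "u \<in> X" "v \<in> Y" for u v
    proof -
      have "(norm (q u - q v))\<^sup>2 = (norm (partial_reflection e U p u - partial_reflection e U p v))\<^sup>2"
        using d[OF that] st norm_partial_reflection_square[of u U v e p] that U
        by (simp add: height_mult subset_iff disjoint_iff)
      then show ?thesis
        by (simp add: power2_eq_iff_nonneg)
    qed
    then show ?thesis by blast
  qed
qed auto

end

section \<open>Graphs in which nonadjacent vertices have a separator\<close>

lemma separatorsD:
  assumes "S \<in> separators d V E x y"
  shows "S \<subseteq> V" "card S = d" "x \<in> V - S" "y \<in> V - S" "(x, y) \<notin> reach E (V - S)"
  using assms by (auto simp: separators_def separates_def)

lemma reach_merging_edges:
  assumes R: "R \<subseteq> V" "card R = d" "R \<noteq> S"
  shows "reach (E \<union> merging_edges d V E S x y) (V - R) = reach E (V - R)"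
proof (rule reach_add_edges)
  fix u v assume uv: "{u, v} \<in> E \<union> merging_edges d V E S x y - E" "u \<in> V - R" "v \<in> V - R"
  then have "R \<notin> separators d V E u v"
    using merging_edgesD(1)[of u v d V E S x y] R by auto
  then show "(u, v) \<in> reach E (V - R)"
    using R uv(2,3) by (auto simp: separators_def separates_def)
qed simp

lemma reach_merging_edges_separator:
  assumes "(z, w) \<in> reach (E \<union> merging_edges d V E S x y) (V - S)"
  shows "(z, w) \<in> reach E (V - S) \<or>
    z \<in> component E (V - S) x \<union> component E (V - S) y \<and> w \<in> component E (V - S) x \<union> component E (V - S) y"
  using assms
proof (induction rule: rtrancl_induct)
  case (step w w')
  let ?X = "component E (V - S) x \<union> component E (V - S) y"
  have ww: "{w, w'} \<in> E \<union> merging_edges d V E S x y" "w \<in> V - S" "w' \<in> V - S"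
    using step.hyps(2) by (auto simp: adj_on_def)
  show ?case
  proof (cases "{w, w'} \<in> E")
    case True
    then have "(w, w') \<in> reach E (V - S)"
      using ww by (intro reach_edge)
    then show ?thesis
      using step.IH by (auto intro: rtrancl_trans)
  next
    case False
    then have "{w, w'} \<in> merging_edges d V E S x y"
      using ww(1) by blast
    then have w: "w \<in> ?X" "w' \<in> ?X"
      using merging_edgesD(2) by fast+
    from step.IH have "z \<in> ?X"
    proof
      assume "(z, w) \<in> reach E (V - S)"
      then show ?thesis
        using w(1) by (auto dest: reach_sym intro: rtrancl_trans)
    qed blast
    then show ?thesis
      using w(2) by blast
  qed
qed simp

context separated_graph
begin

lemma simple_graph_merging_edges:
  assumes S: "separators d V E x y = {S}"
  shows "simple_graph V (E \<union> merging_edges d V E S x y)"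
proof -
  have xy: "x \<in> V - S" "y \<in> V - S" "(x, y) \<notin> reach E (V - S)"
    using separatorsD[of S d V E x y, unfolded S] by simp_all
  have *: "u \<in> V \<and> v \<in> V \<and> u \<noteq> v" if "u \<in> component E (V - S) x" "v \<in> component E (V - S) y" for u v
  proof -
    have "u \<noteq> v"
      using that xy(3) by (auto dest: reach_sym intro: rtrancl_trans)
    then show ?thesis
      using that comp_subset[OF xy(1), of E] comp_subset[OF xy(2), of E] by blast
  qed
  have "merging_edges d V E S x y \<subseteq> {{u, v} | u v. u \<in> V \<and> v \<in> V \<and> u \<noteq> v}"
  proof
    fix e assume "e \<in> merging_edges d V E S x y"
    then obtain u v where "e = {u, v}" "u \<in> component E (V - S) x" "v \<in> component E (V - S) y"
      unfolding merging_edges_def by (elim CollectE exE conjE)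
    then show "e \<in> {{u, v} | u v. u \<in> V \<and> v \<in> V \<and> u \<noteq> v}"
      using *[of u v] by auto
  qed
  then show ?thesis
    using simple unfolding simple_graph_def by (intro conjI Un_least) simp_all
qed

lemma separated_graph_merging_edges:
  assumes "separators d V E x y = {S}"
  shows "separated_graph d V (E \<union> merging_edges d V E S x y)"
  using simple_graph_merging_edges[OF assms] by (intro separated_graph_supergraph) auto

text \<open>Otherwise adding merging edges would lower the count to \<open>-1\<close>, although it
  is nonnegative.\<close>

lemma separators_empty_of_count:
  assumes "separator_count d V E = 0"
  shows "separators d V E x y = {}"
proof (rule ccontr)
  assume "separators d V E x y \<noteq> {}"
  then obtain S0 where "S0 \<in> separators d V E x y" by blast
  then obtain x' y' S where S: "separators d V E x' y' = {S}"
    by (rule unique_separator_exists)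
  then have "separator_count d V (E \<union> merging_edges d V E S x' y') < 0"
    using separator_count_merging_edges[OF finite_V S] assms by simp
  then show False
    using separator_count_nonneg[OF finite_V card_V] by (meson not_less)
qed

text \<open>Otherwise some \<open>T\<close> separates \<open>u\<close> from \<open>s\<close>. It
  misses the component of \<open>v\<close> or that of \<open>u\<close> in \<open>G - S\<close>. In
  the first case \<open>v\<close> stays connected to \<open>s\<close>, so \<open>T\<close> is a
  separator of \<open>u\<close> and \<open>v\<close> without \<open>s\<close>, different from
  \<open>S\<close>; in the second case \<open>u\<close> stays connected to \<open>s\<close>.\<close>

lemma separator_adjacent:
  assumes nonadj: "\<And>u v. u \<in> V \<Longrightarrow> v \<in> V \<Longrightarrow> u \<noteq> v \<Longrightarrow> {u, v} \<notin> E \<Longrightarrow> separators d V E u v \<noteq> {}"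
    and S: "separators d V E u v = {S}" and s: "s \<in> S"
  shows "{u, s} \<in> E"
proof (rule ccontr)
  assume "{u, s} \<notin> E"
  have S': "S \<subseteq> V" "card S = d" "u \<in> V - S" "v \<in> V - S" "S \<in> separators d V E u v"
    using separatorsD[of S d V E u v, unfolded S] S by simp_all
  have "u \<in> V" "s \<in> V" "u \<noteq> s"
    using S' s by blast+
  then obtain T where T: "T \<in> separators d V E u s"
    using nonadj[of u s] \<open>{u, s} \<notin> E\<close> by blast
  note T' = separatorsD[OF T]
  show False
  proof (cases "T \<inter> component E (V - S) v = {}")
    case True
    then have vs: "(v, s) \<in> reach E (V - T)"
      using reach_via_component[OF S'(1,2) s S'(4)] T' by blast
    have "v \<notin> T"
      using True by blast
    moreover have "(u, v) \<notin> reach E (V - T)"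
      using vs T'(5) by (auto intro: rtrancl_trans)
    ultimately have "T \<in> separators d V E u v"
      using T' S' by (simp add: separators_def separates_def)
    then show False
      using S s T'(4) by auto
  next
    case False
    then have "T \<inter> component E (V - S) u = {}"
      using separator_one_side[OF T S'(5)] by blast
    then show False
      using reach_via_component[OF S'(1,2) s S'(3)] T' by blast
  qed
qed

text \<open>A separator of two vertices of \<open>S\<close> would cross \<open>S\<close>.\<close>

lemma separator_clique:
  assumes nonadj: "\<And>u v. u \<in> V \<Longrightarrow> v \<in> V \<Longrightarrow> u \<noteq> v \<Longrightarrow> {u, v} \<notin> E \<Longrightarrow> separators d V E u v \<noteq> {}"
    and S: "S \<in> separators d V E x y" and st: "s \<in> S" "t \<in> S" "s \<noteq> t"
  shows "{s, t} \<in> E"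
proof (rule ccontr)
  assume "{s, t} \<notin> E"
  moreover have "S \<subseteq> V"
    using S by (simp add: separators_def)
  ultimately obtain T where "T \<in> separators d V E s t"
    using nonadj[of s t] st by blast
  note T = separatorsD[OF this]
  show False
    using separators_do_not_cross[OF S T(1,2), of s t] st T(3-5) by blast
qed

text \<open>All vertices of \<open>S\<close> are adjacent to both \<open>u\<close> and
  \<open>u'\<close>, so a separator of these two contains \<open>S\<close> and hence equals it; but
  \<open>S\<close> does not separate them.\<close>

lemma separator_side_clique:
  assumes nonadj: "\<And>u v. u \<in> V \<Longrightarrow> v \<in> V \<Longrightarrow> u \<noteq> v \<Longrightarrow> {u, v} \<notin> E \<Longrightarrow> separators d V E u v \<noteq> {}"
    and u: "separators d V E u v = {S}" and u': "separators d V E u' v' = {S}"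
    and "u \<noteq> u'" "(u, u') \<in> reach E (V - S)"
  shows "{u, u'} \<in> E"
proof (rule ccontr)
  assume *: "{u, u'} \<notin> E"
  have S': "S \<subseteq> V" "card S = d" "u \<in> V" "u' \<in> V"
    using separatorsD[of S d V E u v, unfolded u] separatorsD[of S d V E u' v', unfolded u'] by simp_all
  then obtain T where T: "T \<in> separators d V E u u'"
    using nonadj[of u u'] * \<open>u \<noteq> u'\<close> by blast
  note T' = separatorsD[OF T]
  have "S \<subseteq> T"
  proof
    fix s assume "s \<in> S"
    have "{u, s} \<in> E" "{s, u'} \<in> E"
      using separator_adjacent[OF nonadj u \<open>s \<in> S\<close>] separator_adjacent[OF nonadj u' \<open>s \<in> S\<close>]
      by (simp_all add: insert_commute)
    show "s \<in> T"
    proof (rule ccontr)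
      assume "s \<notin> T"
      then have "s \<in> V - T"
        using S'(1) \<open>s \<in> S\<close> by blast
      then have "(u, s) \<in> reach E (V - T)" "(s, u') \<in> reach E (V - T)"
        using T'(3,4) \<open>{u, s} \<in> E\<close> \<open>{s, u'} \<in> E\<close> by (auto intro: reach_edge)
      then show False
        using T'(5) by (auto intro: rtrancl_trans)
    qed
  qed
  then have "S = T"
    using S'(2) T'(1,2) finite_subset[OF T'(1) finite_V] by (intro card_subset_eq) simp_all
  then show False
    using assms(5) T'(5) by simp
qed

end

lemma obtain_separator_reflection:
  fixes p :: "'v \<Rightarrow> real ^ 'd::finite"
  assumes V: "simple_graph V E" and p: "generic_realization V p"
    and S: "S \<in> separators CARD('d) V E x y"
  obtains e :: "'d \<Rightarrow> 'v" where "inj e" "range e = S" "S \<subseteq> V" "component E (V - S) x \<inter> S = {}"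
    "component E (V - S) x \<subseteq> V"
    "generic_realization V (partial_reflection e (component E (V - S) x) p)"
    "equivalent_realizations E p (partial_reflection e (component E (V - S) x) p)"
    "\<forall>u\<in>component E (V - S) x. \<forall>v\<in>component E (V - S) y.
      norm (partial_reflection e (component E (V - S) x) p u - partial_reflection e (component E (V - S) x) p v)
        \<noteq> norm (p u - p v)"
proof -
  let ?U = "component E (V - S) x"
  note S' = separatorsD[OF S]
  have "finite S"
    using V S'(1) finite_subset by (auto simp: simple_graph_def)
  then obtain e :: "'d \<Rightarrow> 'v" where e: "inj e" "range e = S"
    using obtain_enumeration S'(2) by blast
  have U: "?U \<inter> S = {}" "\<And>x y. {x, y} \<in> E \<Longrightarrow> x \<in> ?U \<Longrightarrow> y \<in> ?U \<union> S" "?U \<subseteq> V"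
    using closed_up_to_comp[OF V S'(3)] comp_subset[OF S'(3), of E] by (auto simp: closed_up_to_def)
  have n: "normal e p \<noteq> 0"
    using p e S'(1) by (intro generic_normal_nonzero) auto
  show ?thesis
  proof (rule that[OF e S'(1) U(1,3)])
    show "generic_realization V (partial_reflection e ?U p)"
      using p e S'(1) U(1) n by (intro generic_partial_reflection) auto
    show "equivalent_realizations E p (partial_reflection e ?U p)"
      using U(2) e(2) by (intro partial_reflection_equivalent) auto
    show "\<forall>u\<in>?U. \<forall>v\<in>component E (V - S) y.
        norm (partial_reflection e ?U p u - partial_reflection e ?U p v) \<noteq> norm (p u - p v)"
    proof (intro ballI)
      fix u v assume uv: "u \<in> ?U" "v \<in> component E (V - S) y"
      have "v \<notin> ?U"
        using uv(2) S'(5) by (auto dest: reach_sym intro: rtrancl_trans)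
      moreover have "v \<in> V - S"
        using uv(2) comp_subset[OF S'(4), of E] by blast
      ultimately show "norm (partial_reflection e ?U p u - partial_reflection e ?U p v) \<noteq> norm (p u - p v)"
        using p e S'(1) U(1,3) uv(1) by (intro norm_partial_reflection_neq) auto
    qed
  qed
qed

section \<open>Lower and upper bound for the number of realizations\<close>

lemma equivalent_realizations_mono:
  "E \<subseteq> E' \<Longrightarrow> equivalent_realizations E' p q \<Longrightarrow> equivalent_realizations E p q"
  by (auto simp: equivalent_realizations_def)

theorem separator_count_lower_bound:
  fixes p :: "'v \<Rightarrow> real ^ 'd::finite"
  assumes V: "simple_graph V E" "card V \<ge> CARD('d) + 1" and p: "generic_realization V p"
  shows "\<exists>Q. noncongruent_family V E p Q \<and> card Q = 2 ^ nat (separator_count CARD('d) V E)"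
  using V(1) p
proof (induction "nat (separator_count CARD('d) V E)" arbitrary: E p)
  case 0
  then show ?case
    by (intro exI[of _ "{p}"]) (simp add: noncongruent_family_singleton)
next
  case (Suc n)
  have fin: "finite V"
    using V(1) by (simp add: simple_graph_def)
  show ?case
  proof (cases "small_separation CARD('d) V E \<or> crossing_separations CARD('d) V E")
    case True
    then show ?thesis
      using not_rigid_families Suc.prems by blast
  next
    case False
    then interpret separated_graph "CARD('d)" V E
      using Suc.prems(1) V(2) by unfold_locales (auto simp: Suc_le_eq)
    obtain x0 y0 S0 where "S0 \<in> separators CARD('d) V E x0 y0"
      using separator_count_zero[OF fin V(2), of E] Suc.hyps(2) by force
    then obtain x y S where S: "separators CARD('d) V E x y = {S}"
      by (rule unique_separator_exists)
    let ?E = "E \<union> merging_edges CARD('d) V E S x y" and ?U = "component E (V - S) x"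
    have "S \<in> separators CARD('d) V E x y"
      using S by simp
    then obtain e :: "'d \<Rightarrow> 'v" where "inj e" "range e = S" "S \<subseteq> V" "?U \<inter> S = {}" "?U \<subseteq> V"
      and e: "generic_realization V (partial_reflection e ?U p)"
      "equivalent_realizations E p (partial_reflection e ?U p)"
      "\<forall>u\<in>?U. \<forall>v\<in>component E (V - S) y.
        norm (partial_reflection e ?U p u - partial_reflection e ?U p v) \<noteq> norm (p u - p v)"
      by (rule obtain_separator_reflection[OF Suc.prems])
    have n: "n = nat (separator_count CARD('d) V ?E)"
      using separator_count_merging_edges[OF fin S] Suc.hyps(2) by simp
    have simple': "simple_graph V ?E"
      using S by (rule simple_graph_merging_edges)
    obtain Q1 where Q1: "noncongruent_family V ?E p Q1" "card Q1 = 2 ^ n"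
      using Suc.hyps(1)[OF n simple' Suc.prems(2)] n by auto
    obtain Q2 where Q2: "noncongruent_family V ?E (partial_reflection e ?U p) Q2" "card Q2 = 2 ^ n"
      using Suc.hyps(1)[OF n simple' e(1)] n by auto
    have xy: "{x, y} \<in> ?E" "x \<in> V" "y \<in> V"
      using separatorsD[of S "CARD('d)" V E x y, unfolded S] S by (auto simp: merging_edges_def)
    \<comment> \<open>The new edge \<open>{x, y}\<close> has different lengths in \<open>p\<close>
      and in its reflection, so members of different families are told apart by this
      distance.\<close>
    have cross: "\<not> congruent_realizations V q r" "\<not> congruent_realizations V r q"
      if "q \<in> Q1" "r \<in> Q2" for q r
    proof -
      have "norm (p x - p y) = norm (q x - q y)"
        "norm (partial_reflection e ?U p x - partial_reflection e ?U p y) = norm (r x - r y)"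
        using Q1(1) Q2(1) that xy(1) unfolding noncongruent_family_def equivalent_realizations_def
        by blast+
      then have "norm (q x - q y) \<noteq> norm (r x - r y)"
        using bspec[OF bspec[OF e(3), of x], of y] by auto
      then show "\<not> congruent_realizations V q r" "\<not> congruent_realizations V r q"
        using xy(2,3) unfolding congruent_realizations_def by metis+
    qed
    then have "Q1 \<inter> Q2 = {}"
      by fastforce
    then have "card (Q1 \<union> Q2) = 2 ^ Suc n"
      using Q1 Q2 by (subst card_Un_disjoint) (auto simp: noncongruent_family_def)
    moreover have "equivalent_realizations E p q" if "q \<in> Q1 \<union> Q2" for q
      using that
    proof
      assume "q \<in> Q1"
      then have "equivalent_realizations ?E p q"
        using Q1(1) by (simp add: noncongruent_family_def)
      then show ?thesis
        by (rule equivalent_realizations_mono[rotated]) simp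
    next
      assume "q \<in> Q2"
      then have "equivalent_realizations ?E (partial_reflection e ?U p) q"
        using Q2(1) by (simp add: noncongruent_family_def)
      then have "equivalent_realizations E (partial_reflection e ?U p) q"
        by (rule equivalent_realizations_mono[rotated]) simp
      with e(2) show ?thesis
        by (rule equivalent_realizations_trans)
    qed
    moreover have "pairwise (\<lambda>q r. \<not> congruent_realizations V q r) (Q1 \<union> Q2)"
      using Q1(1) Q2(1) cross unfolding noncongruent_family_def pairwise_def by blast
    ultimately show ?thesis
      using Q1(1) Q2(1) Suc.hyps(2)
      by (intro exI[of _ "Q1 \<union> Q2"]) (simp add: noncongruent_family_def)
  qed
qed

theorem separator_count_upper_bound:
  fixes p :: "'v \<Rightarrow> real ^ 'd::finite"
  assumes "separated_graph CARD('d) V E"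
    and "\<And>u v. u \<in> V \<Longrightarrow> v \<in> V \<Longrightarrow> u \<noteq> v \<Longrightarrow> {u, v} \<notin> E \<Longrightarrow> separators CARD('d) V E u v \<noteq> {}"
    and "generic_realization V p" "noncongruent_family V E p Q"
  shows "card Q \<le> 2 ^ nat (separator_count CARD('d) V E)"
  using assms
proof (induction "nat (separator_count CARD('d) V E)" arbitrary: E p Q)
  case 0
  interpret separated_graph "CARD('d)" V E
    by fact
  have "separator_count CARD('d) V E = 0"
    using 0(1) separator_count_nonneg[OF finite_V card_V, of E] by simp
  then have "{u, v} \<in> E" if "u \<in> V" "v \<in> V" "u \<noteq> v" for u v
    using separators_empty_of_count 0(3) that by blast
  then have cong: "congruent_realizations V p q" if "equivalent_realizations E p q" for q
    using that unfolding congruent_realizations_def equivalent_realizations_def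
    by (metis norm_zero diff_self)
  have "q = r" if "q \<in> Q" "r \<in> Q" for q r
  proof (rule ccontr)
    assume "q \<noteq> r"
    have "congruent_realizations V p q" "congruent_realizations V p r"
      using cong 0(5) that by (simp_all add: noncongruent_family_def)
    then have "congruent_realizations V q r"
      using congruent_realizations_sym congruent_realizations_trans by blast
    then show False
      using 0(5) that \<open>q \<noteq> r\<close> by (simp add: noncongruent_family_def pairwise_def)
  qed
  then have "card Q \<le> 1"
    using 0(5) by (simp add: noncongruent_family_def card_le_Suc0_iff_eq)
  then show ?case
    using 0(1) by simp
next
  case (Suc n)
  interpret separated_graph "CARD('d)" V E
    by fact
  note nonadj = Suc.prems(2) and p = Suc.prems(3)
  obtain x0 y0 S0 where "S0 \<in> separators CARD('d) V E x0 y0"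
    using separator_count_zero[OF finite_V card_V, of E] Suc.hyps(2) by force
  then obtain x y S where S: "separators CARD('d) V E x y = {S}"
    by (rule unique_separator_exists)
  let ?F = "merging_edges CARD('d) V E S x y"
  let ?E = "E \<union> ?F" and ?U = "component E (V - S) x" and ?W = "component E (V - S) y"
  have S': "S \<in> separators CARD('d) V E x y" "S \<subseteq> V" "x \<in> V - S" "y \<in> V - S" "(x, y) \<notin> reach E (V - S)"
    using separatorsD[of S "CARD('d)" V E x y, unfolded S] S by simp_all
  obtain e :: "'d \<Rightarrow> 'v" where e: "inj e" "range e = S" "S \<subseteq> V" "?U \<inter> S = {}" "?U \<subseteq> V"
    "generic_realization V (partial_reflection e ?U p)"
    "equivalent_realizations E p (partial_reflection e ?U p)"
    "\<forall>u\<in>?U. \<forall>v\<in>?W. norm (partial_reflection e ?U p u - partial_reflection e ?U p v) \<noteq> norm (p u - p v)"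
    by (rule obtain_separator_reflection[OF simple p S'(1)])
  let ?p = "partial_reflection e ?U p"
  have n: "n = nat (separator_count CARD('d) V ?E)"
    using separator_count_merging_edges[OF finite_V S] Suc.hyps(2) by simp
  have sep': "separated_graph CARD('d) V ?E"
    using S by (rule separated_graph_merging_edges)
  \<comment> \<open>The assumption on nonadjacent pairs survives: a separator other than
    \<open>S\<close> still separates, and a pair whose only separator \<open>S\<close> stops
    separating has become an edge.\<close>
  have nonadj': "separators CARD('d) V ?E u v \<noteq> {}"
    if uv: "u \<in> V" "v \<in> V" "u \<noteq> v" "{u, v} \<notin> ?E" for u v
  proof (cases "separators CARD('d) V E u v = {S}")
    case True
    have S2: "u \<in> V - S" "v \<in> V - S" "(u, v) \<notin> reach E (V - S)" "card S = CARD('d)"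
      using separatorsD[of S "CARD('d)" V E u v, unfolded True] by simp_all
    have "(u, v) \<notin> reach ?E (V - S)"
    proof
      assume "(u, v) \<in> reach ?E (V - S)"
      from reach_merging_edges_separator[OF this] S2(3)
      have "u \<in> ?U \<union> ?W" "v \<in> ?U \<union> ?W"
        by auto
      moreover have "\<not> (u \<in> ?U \<and> v \<in> ?U)" "\<not> (u \<in> ?W \<and> v \<in> ?W)"
        using S2(3) by (auto dest: reach_sym intro: rtrancl_trans)
      ultimately have "{u, v} \<in> ?F"
        using True separators_sym[of "CARD('d)" V E u v] unfolding merging_edges_def
        by (auto simp: insert_commute)
      then show False
        using uv(4) by blast
    qed
    then have "S \<in> separators CARD('d) V ?E u v"
      using S2 S'(2) by (simp add: separators_def separates_def)
    then show ?thesis by blast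
  next
    case False
    then obtain R where R: "R \<in> separators CARD('d) V E u v" "R \<noteq> S"
      using nonadj[OF uv(1-3)] uv(4) by blast
    then have "R \<in> separators CARD('d) V ?E u v"
      using reach_merging_edges[of R V "CARD('d)" S E x y] by (simp add: separators_def separates_def)
    then show ?thesis by blast
  qed
  \<comment> \<open>All merging edges run between \<open>X\<close> and \<open>Y\<close>. Together
    with \<open>S\<close> each of these sets is a clique, so the shape of either side is fixed and
    \<open>q\<close> can differ from \<open>p\<close> there only by a reflection of one
    side.\<close>
  define X where "X = {u \<in> ?U. \<exists>v. separators CARD('d) V E u v = {S}}"
  define Y where "Y = {u \<in> ?W. \<exists>v. separators CARD('d) V E u v = {S}}"
  have XY: "X \<subseteq> V - S" "Y \<subseteq> V - S" "Y \<inter> ?U = {}" "X \<subseteq> ?U"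
  proof -
    show "X \<subseteq> V - S" "Y \<subseteq> V - S"
      using comp_subset[OF S'(3), of E] comp_subset[OF S'(4), of E] by (auto simp: X_def Y_def)
    show "Y \<inter> ?U = {}"
      using S'(5) unfolding Y_def by (auto dest: reach_sym intro: rtrancl_trans)
  qed (auto simp: X_def)
  have XY_sep: "\<exists>v. separators CARD('d) V E u v = {S}" if "u \<in> X \<union> Y" for u
    using that by (auto simp: X_def Y_def)
  have np: "normal e p \<noteq> 0"
    using p e S'(2) by (intro generic_normal_nonzero) auto
  have "equivalent_realizations ?E p q \<or> equivalent_realizations ?E ?p q" if q: "q \<in> Q" for q
  proof -
    have eq: "equivalent_realizations E p q"
      using Suc.prems(4) q by (simp add: noncongruent_family_def)
    have adj: "norm (q u - q v) = norm (p u - p v)" if "u \<noteq> v \<Longrightarrow> {u, v} \<in> E" for u v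
      using that eq by (cases "u = v") (simp_all add: equivalent_realizations_def)
    have dS: "norm (q (e i) - q (e j)) = norm (p (e i) - p (e j))" for i j
    proof (rule adj)
      assume "e i \<noteq> e j"
      then show "{e i, e j} \<in> E"
        using e(2) by (intro separator_clique[OF nonadj S'(1)]) auto
    qed
    have dXY: "norm (q u - q (e i)) = norm (p u - p (e i))" if u: "u \<in> X \<union> Y" for u i
    proof (rule adj)
      obtain v where "separators CARD('d) V E u v = {S}"
        using XY_sep[OF u] by blast
      then show "{u, e i} \<in> E"
        using e(2) by (intro separator_adjacent[OF nonadj]) auto
    qed
    have dX: "norm (q u - q v) = norm (p u - p v)" if "u \<in> X" "v \<in> X" for u v
    proof (rule adj)
      assume "u \<noteq> v"
      moreover have "(u, v) \<in> reach E (V - S)"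
        using that unfolding X_def by (auto dest: reach_sym intro: rtrancl_trans)
      ultimately show "{u, v} \<in> E"
        using that XY_sep[of u] XY_sep[of v] separator_side_clique[OF nonadj] by auto
    qed
    have dY: "norm (q u - q v) = norm (p u - p v)" if "u \<in> Y" "v \<in> Y" for u v
    proof (rule adj)
      assume "u \<noteq> v"
      moreover have "(u, v) \<in> reach E (V - S)"
        using that unfolding Y_def by (auto dest: reach_sym intro: rtrancl_trans)
      ultimately show "{u, v} \<in> E"
        using that XY_sep[of u] XY_sep[of v] separator_side_clique[OF nonadj] by auto
    qed
    have hp: "height e p u \<noteq> 0" if "u \<in> X \<union> Y" for u
      using generic_height_nonzero[OF p e(1), of u] e(2) S'(2) XY(1,2) np that
      by (auto simp: height_def)
    have F: "u \<in> X \<and> v \<in> Y \<or> v \<in> X \<and> u \<in> Y" if "{u, v} \<in> ?F" for u v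
    proof -
      have "separators CARD('d) V E u v = {S}" "separators CARD('d) V E v u = {S}"
        using merging_edgesD(1)[OF that] separators_sym[of "CARD('d)" V E u v] by simp_all
      then show ?thesis
        using merging_edgesD(2)[OF that] unfolding X_def Y_def by blast
    qed
    show ?thesis
      using reflection_dichotomy[OF np dS hp dXY dX dY XY(4,3)]
    proof
      assume *: "\<forall>u\<in>X. \<forall>v\<in>Y. norm (q u - q v) = norm (p u - p v)"
      have "norm (p u - p v) = norm (q u - q v)" if "{u, v} \<in> ?E" for u v
      proof (cases "{u, v} \<in> E")
        case False
        then show ?thesis
          using F[of u v] that * by (auto simp: norm_minus_commute)
      qed (use eq in \<open>simp add: equivalent_realizations_def\<close>)
      then show ?thesis
        by (simp add: equivalent_realizations_def)
    next
      assume *: "\<forall>u\<in>X. \<forall>v\<in>Y. norm (q u - q v) = norm (?p u - ?p v)"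
      have "norm (?p u - ?p v) = norm (q u - q v)" if "{u, v} \<in> ?E" for u v
      proof (cases "{u, v} \<in> E")
        case False
        then show ?thesis
          using F[of u v] that * by (metis UnE norm_minus_commute)
      qed (use eq e(7) in \<open>simp add: equivalent_realizations_def\<close>)
      then show ?thesis
        by (simp add: equivalent_realizations_def)
    qed
  qed
  then have Q: "Q = {q \<in> Q. equivalent_realizations ?E p q} \<union> {q \<in> Q. equivalent_realizations ?E ?p q}"
    by blast
  have fam: "noncongruent_family V ?E r {q \<in> Q. equivalent_realizations ?E r q}" for r
    using Suc.prems(4) unfolding noncongruent_family_def by (auto intro: pairwise_subset)
  have "card {q \<in> Q. equivalent_realizations ?E p q} \<le> 2 ^ n"
    using Suc.hyps(1)[OF n sep' nonadj' p fam] n by simp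
  moreover have "card {q \<in> Q. equivalent_realizations ?E ?p q} \<le> 2 ^ n"
    using Suc.hyps(1)[OF n sep' nonadj' e(6) fam] n by simp
  ultimately have "card Q \<le> 2 ^ n + 2 ^ n"
    by (subst Q) (rule order_trans[OF card_Un_le add_mono])
  then show ?case
    using Suc.hyps(2)[symmetric] by simp
qed


section \<open>Globally linked pairs\<close>

lemma separator_not_globally_linked:
  assumes V: "simple_graph V E" and S: "S \<in> separators CARD('d::finite) V E x y"
  shows "\<not> globally_linked TYPE('d) V E x y"
proof
  assume linked: "globally_linked TYPE('d) V E x y"
  have "finite V"
    using V by (simp add: simple_graph_def)
  then obtain p :: "'a \<Rightarrow> real ^ 'd" where p: "generic_realization V p"
    using generic_realization_exists by blast
  obtain e :: "'d \<Rightarrow> 'a" where "inj e" "range e = S" "S \<subseteq> V" "component E (V - S) x \<inter> S = {}"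
    "component E (V - S) x \<subseteq> V"
    "generic_realization V (partial_reflection e (component E (V - S) x) p)"
    and e: "equivalent_realizations E p (partial_reflection e (component E (V - S) x) p)"
    "\<forall>u\<in>component E (V - S) x. \<forall>v\<in>component E (V - S) y.
      norm (partial_reflection e (component E (V - S) x) p u - partial_reflection e (component E (V - S) x) p v)
        \<noteq> norm (p u - p v)"
    by (rule obtain_separator_reflection[OF V p S])
  show False
    using linked p e(1) bspec[OF bspec[OF e(2), of x], of y] unfolding globally_linked_def by auto
qed

text \<open>Menger's theorem, where separating sets with fewer than \<open>d\<close> vertices are
  excluded by the absence of small separations.\<close>

lemma (in separated_graph) local_connectivity_iff:
  assumes xy: "x \<in> V" "y \<in> V" "x \<noteq> y" "{x, y} \<notin> E"
  shows "local_connectivity V E x y \<ge> d + 1 \<longleftrightarrow> separators d V E x y = {}"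
proof
  assume *: "local_connectivity V E x y \<ge> d + 1"
  show "separators d V E x y = {}"
  proof (rule ccontr)
    assume "separators d V E x y \<noteq> {}"
    then obtain S where "S \<in> separators d V E x y" by blast
    note S = separatorsD[OF this]
    show False
      using local_connectivity_le_separator[OF finite_V S(1,3-5)] S(2) * by simp
  qed
next
  assume no_sep: "separators d V E x y = {}"
  have "E \<subseteq> Pow V"
    using simple by (auto simp: simple_graph_def)
  then have "finite E"
    using finite_V finite_subset by blast
  then show "local_connectivity V E x y \<ge> d + 1"
  proof (rule menger[OF finite_V _ xy])
    fix S assume S: "S \<subseteq> V - {x, y}" "(x, y) \<notin> reach E (V - S)"
    have x: "x \<in> V - S"
      using S xy by blast
    show "d + 1 \<le> card S"
    proof (rule ccontr)
      assume "\<not> d + 1 \<le> card S"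
      then consider "card S = d" | "card S < d"
        by linarith
      then show False
      proof cases
        case 1
        then have "S \<in> separators d V E x y"
          using S xy by (auto simp: separators_def separates_def)
        then show False
          using no_sep by blast
      next
        case 2
        have "y \<in> V - component E (V - S) x - S" "x \<in> component E (V - S) x" "component E (V - S) x \<subseteq> V"
          using S xy comp_subset[OF x, of E] by auto
        then show False
          using 2 S closed_up_to_comp[OF simple x] no_small unfolding small_separation_def by blast
      qed
    qed
  qed
qed

section \<open>The number of realizations\<close>

lemma ereal_powi_nonneg: "k \<ge> 0 \<Longrightarrow> ereal (2 powi k) = ereal_of_enat (enat (2 ^ nat k))"
  by (simp add: power_int_def)

lemma num_realizations_lower_bound:
  fixes p :: "'v \<Rightarrow> real ^ 'd::finite"
  assumes "simple_graph V E" "card V \<ge> CARD('d) + 1" "generic_realization V p"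
  shows "enat (2 ^ nat (separator_count CARD('d) V E)) \<le> num_realizations V E p"
  using separator_count_lower_bound[OF assms] card_le_num_realizations by metis

lemma num_realizations_ge_1: "num_realizations V E p \<ge> 1"
proof -
  have "enat (card {p}) \<le> num_realizations V E p"
    by (rule card_le_num_realizations[OF noncongruent_family_singleton])
  then show ?thesis
    by (simp add: one_enat_def)
qed

lemma separator_count_small:
  assumes "finite V" "card V \<le> d"
  shows "separator_count d V E = (if card V = d then -1 else 0)"
proof -
  have "S = V" "card V = d" if "S \<subseteq> V" "card S = d" for S
    using that assms card_mono[OF assms(1) that(1)] card_subset_eq[OF assms(1) that(1)] by auto
  then have "{S. S \<subseteq> V \<and> card S = d} = (if card V = d then {V} else {})"
    by auto
  then show ?thesis
    by (simp add: separator_count_def num_components_minus_def)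
qed

lemma joined_separated_graph:
  assumes V: "simple_graph V E" "card V \<ge> CARD('d::finite) + 1" and "rigid TYPE('d) V E"
  shows "separated_graph CARD('d) V E"
  using rigid_separations[OF assms] V by unfold_locales (auto simp: Suc_le_eq)

lemma joined_num_realizations:
  fixes p :: "'v \<Rightarrow> real ^ 'd::finite"
  assumes V: "simple_graph V E" and joined: "joined TYPE('d) V E" and p: "generic_realization V p"
  shows "num_realizations V E p = enat (2 ^ nat (separator_count CARD('d) V E))"
proof (rule antisym)
  have card: "card V \<ge> CARD('d) + 1" and rigid: "rigid TYPE('d) V E"
    and linked: "\<And>x y. x \<in> V \<Longrightarrow> y \<in> V \<Longrightarrow> x \<noteq> y \<Longrightarrow> globally_linked TYPE('d) V E x y \<longleftrightarrow>
      {x, y} \<in> E \<or> local_connectivity V E x y \<ge> CARD('d) + 1"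
    using joined by (auto simp: joined_def)
  interpret separated_graph "CARD('d)" V E
    using V card rigid by (rule joined_separated_graph)
  \<comment> \<open>By Menger's theorem, such a pair is adjacent or has local connectivity above
    \<open>d\<close>, so it is globally linked. Adding all these pairs preserves the equivalent
    realizations as well as the count, and every pair that is still nonadjacent has a
    separator.\<close>
  let ?F = "{{x, y} | x y. x \<in> V \<and> y \<in> V \<and> x \<noteq> y \<and> separators CARD('d) V E x y = {}}"
  let ?E = "E \<union> ?F"
  have F: "x \<in> V \<and> y \<in> V \<and> x \<noteq> y \<and> separators CARD('d) V E x y = {}" if "{x, y} \<in> ?F" for x y
    using that separators_sym[of "CARD('d)" V E x y] by (auto simp: doubleton_eq_iff)
  have "simple_graph V ?E"
    using V unfolding simple_graph_def by blast
  then have sep': "separated_graph CARD('d) V ?E"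
    by (intro separated_graph_supergraph) auto
  have count: "separator_count CARD('d) V ?E = separator_count CARD('d) V E"
    by (rule separator_count_add_edges) (use F in blast)+
  have nonadj: "separators CARD('d) V ?E u v \<noteq> {}"
    if uv: "u \<in> V" "v \<in> V" "u \<noteq> v" "{u, v} \<notin> ?E" for u v
  proof -
    obtain S where S: "S \<in> separators CARD('d) V E u v"
      using uv by blast
    have "reach ?E (V - S) = reach E (V - S)"
    proof (rule reach_add_edges)
      fix x y assume "{x, y} \<in> ?E - E" "x \<in> V - S" "y \<in> V - S"
      then show "(x, y) \<in> reach E (V - S)"
        using F[of x y] separatorsD(1,2)[OF S] by (auto simp: separators_def separates_def)
    qed simp
    then have "S \<in> separators CARD('d) V ?E u v"
      using S by (simp add: separators_def separates_def)
    then show ?thesis by blast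
  qed
  have equiv: "equivalent_realizations ?E p q" if "equivalent_realizations E p q" for q
    unfolding equivalent_realizations_def
  proof (intro allI impI)
    fix x y assume "{x, y} \<in> ?E"
    show "norm (p x - p y) = norm (q x - q y)"
    proof (cases "{x, y} \<in> E")
      case False
      then have xy: "x \<in> V" "y \<in> V" "x \<noteq> y" "separators CARD('d) V E x y = {}"
        using F[of x y] \<open>{x, y} \<in> ?E\<close> by blast+
      then have "globally_linked TYPE('d) V E x y"
        using linked local_connectivity_iff False by blast
      then show ?thesis
        using p that by (simp add: globally_linked_def)
    qed (use that in \<open>simp add: equivalent_realizations_def\<close>)
  qed
  show "num_realizations V E p \<le> enat (2 ^ nat (separator_count CARD('d) V E))"
  proof (rule num_realizations_le)
    fix Q assume "noncongruent_family V E p Q"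
    then have "noncongruent_family V ?E p Q"
      using equiv by (simp add: noncongruent_family_def)
    from separator_count_upper_bound[OF sep' nonadj p this]
    show "card Q \<le> 2 ^ nat (separator_count CARD('d) V E)"
      by (simp add: count)
  qed
  show "enat (2 ^ nat (separator_count CARD('d) V E)) \<le> num_realizations V E p"
    using V card p by (rule num_realizations_lower_bound)
qed

text \<open>A generic realization that is not locally rigid would have infinitely many equivalent
  ones. A pair with a separator is not globally linked, by a partial reflection; a pair without
  separator that is not globally linked would yield one realization too many.\<close>

lemma joined_if_num_realizations:
  fixes V :: "'v set"
  assumes V: "simple_graph V E" and card: "card V \<ge> CARD('d::finite) + 1"
    and num: "\<And>p :: 'v \<Rightarrow> real ^ 'd. generic_realization V p \<Longrightarrow>
      num_realizations V E p = enat (2 ^ nat (separator_count CARD('d) V E))"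
  shows "joined TYPE('d) V E"
proof -
  have rigid: "rigid TYPE('d) V E"
    unfolding rigid_iff
  proof (intro allI impI, rule ccontr)
    fix p :: "'v \<Rightarrow> real ^ 'd" assume p: "generic_realization V p" "\<not> locally_rigid_at V E p"
    then have "num_realizations V E p = \<infinity>"
      by (intro num_realizations_infinite not_locally_rigid_families)
    then show False
      using num[OF p(1)] by simp
  qed
  interpret separated_graph "CARD('d)" V E
    using V card rigid by (rule joined_separated_graph)
  have "globally_linked TYPE('d) V E x y \<longleftrightarrow> {x, y} \<in> E \<or> local_connectivity V E x y \<ge> CARD('d) + 1"
    if xy: "x \<in> V" "y \<in> V" "x \<noteq> y" for x y
  proof (cases "{x, y} \<in> E")
    case True
    then show ?thesis
      by (simp add: globally_linked_def equivalent_realizations_def)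
  next
    case False
    have "globally_linked TYPE('d) V E x y" if no_sep: "separators CARD('d) V E x y = {}"
      unfolding globally_linked_def
    proof (intro allI impI, elim conjE, rule ccontr)
      fix p q :: "'v \<Rightarrow> real ^ 'd"
      assume p: "generic_realization V p" and q: "equivalent_realizations E p q"
        and neq: "norm (p x - p y) \<noteq> norm (q x - q y)"
      \<comment> \<open>As the pair has no separator, the additional edge leaves the count
        unchanged. So there are already \<open>2 ^ c_d\<close> realizations that preserve the
        distance of \<open>x\<close> and \<open>y\<close>, and \<open>q\<close> is a further
        one.\<close>
      let ?E = "insert {x, y} E"
      have "simple_graph V ?E"
        using V xy unfolding simple_graph_def by blast
      then obtain Q where Q: "noncongruent_family V ?E p Q"
        "card Q = 2 ^ nat (separator_count CARD('d) V ?E)"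
        using separator_count_lower_bound[OF _ card p] by blast
      have "separators CARD('d) V E u v = {}" if "{u, v} \<in> ?E - E" for u v
        using that no_sep separators_sym[of "CARD('d)" V E x y] by (auto simp: doubleton_eq_iff)
      then have "separator_count CARD('d) V ?E = separator_count CARD('d) V E"
        by (intro separator_count_add_edges) auto
      moreover have fam: "noncongruent_family V E p Q"
        using Q(1) equivalent_realizations_mono[of E ?E p] by (auto simp: noncongruent_family_def)
      moreover have "\<not> congruent_realizations V r q" if "r \<in> Q" for r
      proof -
        have "norm (p x - p y) = norm (r x - r y)"
          using Q(1) that by (simp add: noncongruent_family_def equivalent_realizations_def)
        then show ?thesis
          using neq xy unfolding congruent_realizations_def by metis
      qed
      ultimately have "enat (Suc (2 ^ nat (separator_count CARD('d) V E))) \<le> num_realizations V E p"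
        using noncongruent_family_insert[OF fam q] Q(2) card_le_num_realizations by metis
      then show False
        using num[OF p] by simp
    qed
    then show ?thesis
      using False xy local_connectivity_iff separator_not_globally_linked[OF V] by blast
  qed
  then show ?thesis
    using card rigid by (simp add: joined_def)
qed

text \<open>For nonadjacent \<open>x\<close> and \<open>y\<close>, all the other vertices together
  form a separator with fewer than \<open>d\<close> vertices.\<close>

lemma small_noncomplete_num_realizations:
  fixes p :: "'v \<Rightarrow> real ^ 'd::finite"
  assumes V: "simple_graph V E" and card: "card V < CARD('d)" and "\<not> complete_graph V E"
    and p: "generic_realization V p"
  shows "num_realizations V E p = \<infinity>"
proof -
  have fin: "finite V"
    using V by (simp add: simple_graph_def)
  obtain x y where xy: "x \<in> V" "y \<in> V" "x \<noteq> y" "{x, y} \<notin> E"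
    using assms(3) by (auto simp: complete_graph_def)
  have "card (V - {x, y}) < CARD('d)"
    using card card_mono[OF fin Diff_subset, of "{x, y}"] by simp
  moreover have "v \<in> {x} \<union> (V - {x, y})" if "{u, v} \<in> E" "u \<in> {x}" for u v
    using simple_graph_edge[OF V that(1)] that xy(4) by auto
  ultimately have "\<not> locally_rigid_at V E p"
    using xy by (intro small_separator_not_locally_rigid[OF fin p, of "V - {x, y}" "{x}" E x y]) auto
  then show ?thesis
    by (intro num_realizations_infinite not_locally_rigid_families)
qed

theorem theorem4p6:
  fixes V :: "'v set" and E :: "'v set set"
  assumes "simple_graph V E"
  shows "(\<forall>p :: 'v \<Rightarrow> real ^ 'd::finite. generic_realization V p \<longrightarrow>
            ereal_of_enat (num_realizations V E p) \<ge> ereal (2 powi separator_count CARD('d) V E)) \<and>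
         (\<not> small_complete_graph CARD('d) V E \<longrightarrow>
            (joined TYPE('d) V E \<longleftrightarrow>
               (\<forall>p :: 'v \<Rightarrow> real ^ 'd. generic_realization V p \<longrightarrow>
                  ereal_of_enat (num_realizations V E p)
                    = ereal (2 powi separator_count CARD('d) V E))))"
proof -
  have fin: "finite V"
    using assms by (simp add: simple_graph_def)
  show ?thesis
  proof (cases "card V \<ge> CARD('d) + 1")
    case True
    have eq: "ereal (2 powi separator_count CARD('d) V E)
        = ereal_of_enat (enat (2 ^ nat (separator_count CARD('d) V E)))"
      using separator_count_nonneg[OF fin True] by (rule ereal_powi_nonneg)
    have inj: "ereal_of_enat m = ereal_of_enat n \<longleftrightarrow> m = n" for m n
      by (metis antisym ereal_of_enat_le_iff order_refl)
    show ?thesis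
      unfolding eq inj ereal_of_enat_le_iff
      using num_realizations_lower_bound[OF assms True] joined_num_realizations[OF assms]
        joined_if_num_realizations[OF assms True] by blast
  next
    case False
    then have small: "separator_count CARD('d) V E = (if card V = CARD('d) then -1 else 0)"
      using fin by (intro separator_count_small) auto
    have "ereal (2 powi separator_count CARD('d) V E) \<le> ereal_of_enat 1"
      by (simp add: small one_enat_def)
    also have "\<dots> \<le> ereal_of_enat (num_realizations V E p)" for p :: "'v \<Rightarrow> real ^ 'd"
      unfolding ereal_of_enat_le_iff by (rule num_realizations_ge_1)
    finally have lower: "ereal (2 powi separator_count CARD('d) V E)
        \<le> ereal_of_enat (num_realizations V E p)" for p :: "'v \<Rightarrow> real ^ 'd" .
    obtain p :: "'v \<Rightarrow> real ^ 'd" where p: "generic_realization V p"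
      using generic_realization_exists[OF fin] by blast
    \<comment> \<open>With exactly \<open>d\<close> vertices the bound is 1/2, which no number of
      realizations attains; with fewer vertices the bound is 1, but the graph is not complete and
      the number is infinite.\<close>
    have "ereal_of_enat (num_realizations V E p) \<noteq> ereal (2 powi separator_count CARD('d) V E)"
      if "\<not> small_complete_graph CARD('d) V E"
    proof (cases "card V = CARD('d)")
      case True
      have "ereal (2 powi separator_count CARD('d) V E) < ereal_of_enat 1"
        by (simp add: small True one_enat_def)
      also have "\<dots> \<le> ereal_of_enat (num_realizations V E p)"
        unfolding ereal_of_enat_le_iff by (rule num_realizations_ge_1)
      finally show ?thesis by simp
    next
      case card: False
      then have "num_realizations V E p = \<infinity>"
        using that False p assms
        by (intro small_noncomplete_num_realizations) (auto simp: small_complete_graph_def)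
      then show ?thesis by simp
    qed
    moreover have "\<not> joined TYPE('d) V E"
      using False by (simp add: joined_def)
    ultimately show ?thesis
      using lower p by blast
  qed
qed

end
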